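(* (ZFC) There are no $\mu<\lambda$ such that for a club class $C$ of ordinals, $\mu$ is critical for $\lambda$'s exactingness at every $\zeta\in C$. In particular, there are no $\mu<\lambda$ such that for every $\zeta>\lambda$ and every elementary substructure $X\prec V_\zeta$ with $|X|=\lambda$ and $V_\lambda\cup\{\lambda\}\subseteq X$ there is an elementary embedding $j:X\to V_\zeta$ with $j(\lambda)=\lambda$ and $\mathrm{crit}(j)=\mu$.
   Context: Here $\mu$ and $\lambda$ are cardinals and $\zeta$ ranges over ordinals. For a cardinal $\lambda$ and an ordinal $\zeta>\lambda$, a cardinal $\mu<\lambda$ is critical for $\lambda$'s exactingness at $\zeta$ if for every elementary substructure $X\prec V_\zeta$ with $|X|=\lambda$ and $V_\lambda\cup\{\lambda\}\subseteq X$ there is an elementary embedding $j:X\to V_\zeta$ with $j(\lambda)=\lambda$ and $\mathrm{crit}(j)=\mu$. Here $\mathrm{crit}(j)$ is the least ordinal in the domain moved by $j$. A club class is a closed unbounded class of ordinals.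
   Formalization: Both claims are proved under the added hypothesis |V_λ ∪ {λ}| = λ; without it no X of size λ contains V_λ ∪ {λ}, criticality is vacuous, and the claim fails, e.g. for λ = ω_1, μ = ω and C all ordinals above ω_1. *)

theory Defs
  imports Main
begin

text \<open>
  A theorem of ZFC is rendered as a statement about every (possibly ill-founded) structure
  \<open>('v, \<epsilon>)\<close> satisfying the first-order ZFC axioms; by the completeness theorem this is the same
  as provability in ZFC. Every set-theoretic notion below is therefore given by a first-order
  condition on \<open>\<epsilon>\<close>, with quantifiers ranging over \<open>'v\<close> only. In particular natural numbers,
  formulas, satisfaction and elementarity of set-sized structures are the ones of the model, and
  need not agree with those of the metatheory. Classes are subsets of the model definable with
  parameters.
\<close>

datatype fm = Mem nat nat | Eq nat nat | Nand fm fm | Forall nat fm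

locale set_structure =
  fixes mem :: "'v \<Rightarrow> 'v \<Rightarrow> bool" (infix "\<epsilon>" 50)
begin

primrec sat :: "(nat \<Rightarrow> 'v) \<Rightarrow> fm \<Rightarrow> bool" where
  "sat e (Mem i j) \<longleftrightarrow> e i \<epsilon> e j"
| "sat e (Eq i j) \<longleftrightarrow> e i = e j"
| "sat e (Nand p q) \<longleftrightarrow> \<not> (sat e p \<and> sat e q)"
| "sat e (Forall i p) \<longleftrightarrow> (\<forall>x. sat (e(i := x)) p)"

text \<open>The values of \<open>e\<close> at nonzero arguments are the parameters.\<close>
definition definable_class :: "'v set \<Rightarrow> bool" where
  "definable_class C \<longleftrightarrow> (\<exists>p e. C = {x. sat (e(0 := x)) p})"

definition empty :: "'v \<Rightarrow> bool" where
  "empty a \<longleftrightarrow> (\<forall>x. \<not> x \<epsilon> a)"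

definition sub :: "'v \<Rightarrow> 'v \<Rightarrow> bool" where
  "sub a b \<longleftrightarrow> (\<forall>x. x \<epsilon> a \<longrightarrow> x \<epsilon> b)"

definition is_succ :: "'v \<Rightarrow> 'v \<Rightarrow> bool" where
  "is_succ b a \<longleftrightarrow> (\<forall>x. x \<epsilon> b \<longleftrightarrow> x \<epsilon> a \<or> x = a)"

definition is_upair :: "'v \<Rightarrow> 'v \<Rightarrow> 'v \<Rightarrow> bool" where
  "is_upair c a b \<longleftrightarrow> (\<forall>x. x \<epsilon> c \<longleftrightarrow> x = a \<or> x = b)"

definition is_pair :: "'v \<Rightarrow> 'v \<Rightarrow> 'v \<Rightarrow> bool" where
  "is_pair p a b \<longleftrightarrow> (\<forall>z. z \<epsilon> p \<longleftrightarrow> is_upair z a a \<or> is_upair z a b)"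

definition rel :: "'v \<Rightarrow> 'v \<Rightarrow> 'v \<Rightarrow> bool" where
  "rel r x y \<longleftrightarrow> (\<exists>p. p \<epsilon> r \<and> is_pair p x y)"

definition is_function :: "'v \<Rightarrow> 'v \<Rightarrow> 'v \<Rightarrow> bool" where
  "is_function f a b \<longleftrightarrow>
     (\<forall>p. p \<epsilon> f \<longrightarrow> (\<exists>x y. x \<epsilon> a \<and> y \<epsilon> b \<and> is_pair p x y)) \<and>
     (\<forall>x. x \<epsilon> a \<longrightarrow> (\<exists>!y. rel f x y))"

definition is_bijection :: "'v \<Rightarrow> 'v \<Rightarrow> 'v \<Rightarrow> bool" where
  "is_bijection f a b \<longleftrightarrow> is_function f a b \<and> (\<forall>y. y \<epsilon> b \<longrightarrow> (\<exists>!x. rel f x y))"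

definition transitive :: "'v \<Rightarrow> bool" where
  "transitive a \<longleftrightarrow> (\<forall>x. x \<epsilon> a \<longrightarrow> sub x a)"

definition ordinal :: "'v \<Rightarrow> bool" where
  "ordinal a \<longleftrightarrow> transitive a \<and> (\<forall>x. x \<epsilon> a \<longrightarrow> transitive x)"

definition limit_ordinal :: "'v \<Rightarrow> bool" where
  "limit_ordinal d \<longleftrightarrow> ordinal d \<and> \<not> empty d \<and> (\<forall>a. a \<epsilon> d \<longrightarrow> (\<exists>b. b \<epsilon> d \<and> a \<epsilon> b))"

definition is_omega :: "'v \<Rightarrow> bool" where
  "is_omega w \<longleftrightarrow> limit_ordinal w \<and> (\<forall>n. n \<epsilon> w \<longrightarrow> \<not> limit_ordinal n)"

definition cardinal :: "'v \<Rightarrow> bool" where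
  "cardinal k \<longleftrightarrow> ordinal k \<and> (\<forall>a. a \<epsilon> k \<longrightarrow> (\<nexists>f. is_bijection f a k))"

definition has_cardinality :: "'v \<Rightarrow> 'v \<Rightarrow> bool" where
  "has_cardinality a k \<longleftrightarrow> cardinal k \<and> (\<exists>f. is_bijection f a k)"

text \<open>\<open>v = V\<^sub>\<zeta>\<close>: the function \<open>f\<close> on \<open>\<zeta> + 1\<close> satisfies
  \<open>f \<alpha> = (\<Union>\<beta><\<alpha>. Pow (f \<beta>))\<close>.\<close>
definition is_V :: "'v \<Rightarrow> 'v \<Rightarrow> bool" where
  "is_V \<zeta> v \<longleftrightarrow> ordinal \<zeta> \<and>
     (\<exists>f d r. is_succ d \<zeta> \<and> is_function f d r \<and>
        (\<forall>\<alpha> y. rel f \<alpha> y \<longrightarrow>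
           (\<forall>x. x \<epsilon> y \<longleftrightarrow> (\<exists>\<beta> z. \<beta> \<epsilon> \<alpha> \<and> rel f \<beta> z \<and> sub x z))) \<and>
        rel f \<zeta> v)"

definition natural :: "'v \<Rightarrow> bool" where
  "natural n \<longleftrightarrow> (\<exists>w. is_omega w \<and> n \<epsilon> w)"

primrec is_num :: "nat \<Rightarrow> 'v \<Rightarrow> bool" where
  "is_num 0 x \<longleftrightarrow> empty x"
| "is_num (Suc k) x \<longleftrightarrow> (\<exists>y. is_num k y \<and> is_succ x y)"

text \<open>Inside the model, formulas are coded as triples \<open>(k, (a, b))\<close>, with tag \<open>k = 0, 1, 2, 3\<close>
  for \<open>v\<^sub>a \<in> v\<^sub>b\<close>, \<open>v\<^sub>a = v\<^sub>b\<close>, \<open>\<not> (a \<and> b)\<close> and \<open>\<forall>v\<^sub>a. b\<close>.\<close>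
definition is_node :: "nat \<Rightarrow> 'v \<Rightarrow> 'v \<Rightarrow> 'v \<Rightarrow> bool" where
  "is_node k a b c \<longleftrightarrow> (\<exists>t p. is_num k t \<and> is_pair p a b \<and> is_pair c t p)"

definition formula_closed :: "'v \<Rightarrow> bool" where
  "formula_closed S \<longleftrightarrow> (\<forall>a b c.
     (natural a \<and> natural b \<and> (is_node 0 a b c \<or> is_node 1 a b c) \<longrightarrow> c \<epsilon> S) \<and>
     (a \<epsilon> S \<and> b \<epsilon> S \<and> is_node 2 a b c \<longrightarrow> c \<epsilon> S) \<and>
     (natural a \<and> b \<epsilon> S \<and> is_node 3 a b c \<longrightarrow> c \<epsilon> S))"

text \<open>In a model of ZFC, \<open>V\<^sub>\<omega>\<close> is closed, so this is not vacuous.\<close>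
definition formula :: "'v \<Rightarrow> bool" where
  "formula c \<longleftrightarrow> (\<forall>S. formula_closed S \<longrightarrow> c \<epsilon> S)"

definition assignment :: "'v \<Rightarrow> 'v \<Rightarrow> bool" where
  "assignment s X \<longleftrightarrow> (\<exists>w. is_omega w \<and> is_function s w X)"

definition is_update :: "'v \<Rightarrow> 'v \<Rightarrow> 'v \<Rightarrow> 'v \<Rightarrow> bool" where
  "is_update t s i x \<longleftrightarrow>
     (\<forall>k y. natural k \<longrightarrow> (rel t k y \<longleftrightarrow> (if k = i then y = x else rel s k y)))"

text \<open>\<open>T\<close> obeys the Tarski clauses for the structure \<open>(X, \<in>)\<close>.\<close>
definition satisfaction_relation :: "'v \<Rightarrow> 'v \<Rightarrow> bool" where
  "satisfaction_relation X T \<longleftrightarrow> (\<forall>s a b c. assignment s X \<longrightarrow>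
     (natural a \<and> natural b \<and> is_node 0 a b c \<longrightarrow>
        (rel T c s \<longleftrightarrow> (\<exists>x y. rel s a x \<and> rel s b y \<and> x \<epsilon> y))) \<and>
     (natural a \<and> natural b \<and> is_node 1 a b c \<longrightarrow>
        (rel T c s \<longleftrightarrow> (\<exists>x y. rel s a x \<and> rel s b y \<and> x = y))) \<and>
     (formula a \<and> formula b \<and> is_node 2 a b c \<longrightarrow>
        (rel T c s \<longleftrightarrow> \<not> (rel T a s \<and> rel T b s))) \<and>
     (natural a \<and> formula b \<and> is_node 3 a b c \<longrightarrow>
        (rel T c s \<longleftrightarrow>
          (\<forall>x t. x \<epsilon> X \<and> assignment t X \<and> is_update t s a x \<longrightarrow> rel T b t))))"

definition satisfies :: "'v \<Rightarrow> 'v \<Rightarrow> 'v \<Rightarrow> bool" where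
  "satisfies X c s \<longleftrightarrow> (\<exists>T. satisfaction_relation X T \<and> rel T c s)"

definition elementary_substructure :: "'v \<Rightarrow> 'v \<Rightarrow> bool" where
  "elementary_substructure X Y \<longleftrightarrow> \<not> empty X \<and> sub X Y \<and>
     (\<forall>c s. formula c \<and> assignment s X \<longrightarrow> (satisfies X c s \<longleftrightarrow> satisfies Y c s))"

definition elementary_embedding :: "'v \<Rightarrow> 'v \<Rightarrow> 'v \<Rightarrow> bool" where
  "elementary_embedding j X Y \<longleftrightarrow> \<not> empty X \<and> is_function j X Y \<and>
     (\<forall>c s t. formula c \<and> assignment s X \<and> assignment t Y \<and>
        (\<forall>k x y. rel s k x \<and> rel j x y \<longrightarrow> rel t k y) \<longrightarrow>
        (satisfies X c s \<longleftrightarrow> satisfies Y c t))"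

text \<open>The domain of \<open>j\<close> need not be transitive, so only ordinals in the domain are compared.\<close>
definition is_crit :: "'v \<Rightarrow> 'v \<Rightarrow> bool" where
  "is_crit j \<mu> \<longleftrightarrow> ordinal \<mu> \<and> (\<exists>y. rel j \<mu> y \<and> y \<noteq> \<mu>) \<and>
     (\<forall>\<alpha> y. ordinal \<alpha> \<and> \<alpha> \<epsilon> \<mu> \<and> rel j \<alpha> y \<longrightarrow> y = \<alpha>)"

text \<open>\<open>b = V\<^sub>l \<union> {l}\<close>\<close>
definition is_base :: "'v \<Rightarrow> 'v \<Rightarrow> bool" where
  "is_base l b \<longleftrightarrow> (\<exists>v. is_V l v \<and> (\<forall>x. x \<epsilon> b \<longleftrightarrow> x \<epsilon> v \<or> x = l))"

text \<open>\<open>X \<prec> V\<^sub>\<zeta>\<close>, \<open>|X| = l\<close> and \<open>V\<^sub>l \<union> {l} \<subseteq> X\<close>\<close>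
definition exacting_domain :: "'v \<Rightarrow> 'v \<Rightarrow> 'v \<Rightarrow> bool" where
  "exacting_domain l \<zeta> X \<longleftrightarrow>
     (\<exists>v. is_V \<zeta> v \<and> elementary_substructure X v) \<and> has_cardinality X l \<and>
     (\<exists>b. is_base l b \<and> sub b X)"

text \<open>\<open>j : X \<rightarrow> V\<^sub>\<zeta>\<close> is elementary, \<open>j(l) = l\<close> and \<open>crit(j) = \<mu>\<close>\<close>
definition exacting_embedding :: "'v \<Rightarrow> 'v \<Rightarrow> 'v \<Rightarrow> 'v \<Rightarrow> 'v \<Rightarrow> bool" where
  "exacting_embedding \<mu> l \<zeta> X j \<longleftrightarrow>
     (\<exists>v. is_V \<zeta> v \<and> elementary_embedding j X v) \<and> rel j l l \<and> is_crit j \<mu>"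

definition critical_at :: "'v \<Rightarrow> 'v \<Rightarrow> 'v \<Rightarrow> bool" where
  "critical_at \<mu> l \<zeta> \<longleftrightarrow>
     cardinal \<mu> \<and> cardinal l \<and> ordinal \<zeta> \<and> \<mu> \<epsilon> l \<and> l \<epsilon> \<zeta> \<and>
     (\<forall>X. exacting_domain l \<zeta> X \<longrightarrow> (\<exists>j. exacting_embedding \<mu> l \<zeta> X j))"

text \<open>\<open>|V\<^sub>l \<union> {l}| = l\<close>. This holds iff there are sets \<open>X\<close> of size \<open>l\<close> containing
  \<open>V\<^sub>l \<union> {l}\<close>; otherwise (for instance if \<open>l = \<omega>\<^sub>1\<close>) every cardinal \<open>\<mu> < l\<close> is vacuously
  critical at every \<open>\<zeta> > l\<close>.\<close>
definition admits_domains :: "'v \<Rightarrow> bool" where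
  "admits_domains l \<longleftrightarrow> (\<exists>b. is_base l b \<and> has_cardinality b l)"

definition club_class :: "'v set \<Rightarrow> bool" where
  "club_class C \<longleftrightarrow> definable_class C \<and> (\<forall>\<zeta>\<in>C. ordinal \<zeta>) \<and>
     (\<forall>\<alpha>. ordinal \<alpha> \<longrightarrow> (\<exists>\<zeta>\<in>C. \<alpha> \<epsilon> \<zeta>)) \<and>
     (\<forall>\<delta>. limit_ordinal \<delta> \<and> (\<forall>\<alpha>. \<alpha> \<epsilon> \<delta> \<longrightarrow> (\<exists>\<beta>\<in>C. \<beta> \<epsilon> \<delta> \<and> \<alpha> \<epsilon> \<beta>)) \<longrightarrow> \<delta> \<in> C)"

end

locale ZFC_model = set_structure mem for mem :: "'v \<Rightarrow> 'v \<Rightarrow> bool" (infix "\<epsilon>" 50) +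
  assumes extensionality: "(\<forall>x. x \<epsilon> a \<longleftrightarrow> x \<epsilon> b) \<Longrightarrow> a = b"
    and foundation: "x \<epsilon> a \<Longrightarrow> \<exists>y. y \<epsilon> a \<and> (\<forall>z. z \<epsilon> y \<longrightarrow> \<not> z \<epsilon> a)"
    and pairing: "\<exists>c. \<forall>x. x \<epsilon> c \<longleftrightarrow> x = a \<or> x = b"
    and union: "\<exists>u. \<forall>x. x \<epsilon> u \<longleftrightarrow> (\<exists>y. y \<epsilon> a \<and> x \<epsilon> y)"
    and power_set: "\<exists>p. \<forall>x. x \<epsilon> p \<longleftrightarrow> sub x a"
    and infinity: "\<exists>w. (\<exists>z. z \<epsilon> w \<and> empty z) \<and> (\<forall>x. x \<epsilon> w \<longrightarrow> (\<exists>y. y \<epsilon> w \<and> is_succ y x))"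
    and separation: "\<exists>b. \<forall>x. x \<epsilon> b \<longleftrightarrow> x \<epsilon> a \<and> sat (e(0 := x)) p"
    and replacement: "(\<forall>x. x \<epsilon> a \<longrightarrow> (\<exists>!y. sat (e(0 := x, 1 := y)) p)) \<Longrightarrow>
          \<exists>b. \<forall>y. y \<epsilon> b \<longleftrightarrow> (\<exists>x. x \<epsilon> a \<and> sat (e(0 := x, 1 := y)) p)"
    and choice: "\<lbrakk>\<forall>x. x \<epsilon> F \<longrightarrow> \<not> empty x;
          \<forall>x y z. x \<epsilon> F \<and> y \<epsilon> F \<and> z \<epsilon> x \<and> z \<epsilon> y \<longrightarrow> x = y\<rbrakk> \<Longrightarrow>
          \<exists>c. \<forall>x. x \<epsilon> F \<longrightarrow> (\<exists>!z. z \<epsilon> c \<and> z \<epsilon> x)"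

end

theory Submission
  imports Defs
begin

text \<open>
  The idea is that a uniform critical point would be definable, and an elementary embedding cannot
  move what is definable from points that it fixes. Suppose that \<open>\<mu>\<close> is critical for \<open>\<lambda>\<close> at every
  \<open>\<zeta>\<close> in a club class \<open>C\<close>, and let \<open>C\<close> be given by the formula \<open>p\<close> with some parameters. Quantifying
  over all club classes is impossible in first-order logic, but quantifying over the parameters
  of \<open>p\<close> is not: let \<open>m\<close> be the least ordinal such that, for some choice of parameters, \<open>p\<close> defines
  a club class at each element of which \<open>m\<close> is critical for \<open>\<lambda>\<close>. Then \<open>m\<close> is definable from \<open>\<lambda>\<close> by
  a single formula \<open>q\<close>, and \<open>m\<close> has a club class \<open>D\<close> of its own. By the reflection theorem, a
  club class of \<open>\<zeta>\<close> is such that \<open>V\<^sub>\<zeta>\<close> decides \<open>q\<close> correctly; take such a \<open>\<zeta>\<close> in \<open>D\<close>. By the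
  Loewenheim-Skolem theorem there is some \<open>X \<prec> V\<^sub>\<zeta>\<close> of size \<open>\<lambda>\<close> with \<open>V\<^sub>\<lambda> \<union> {\<lambda>} \<subseteq> X\<close>, hence an
  elementary \<open>j : X \<rightarrow> V\<^sub>\<zeta>\<close> that fixes \<open>\<lambda>\<close> and moves \<open>m\<close>. But \<open>V\<^sub>\<zeta>\<close> satisfies \<open>q\<close> at \<open>(m, \<lambda>)\<close>, so it
  also does at \<open>(j(m), \<lambda>)\<close>, and \<open>j(m) = m\<close>. The second claim is the case where \<open>C\<close> consists of
  all ordinals above \<open>\<lambda>\<close>.

  The rest is the set theory behind these steps, developed inside an arbitrary model. Sets of
  the model are elements of the type \<open>'v\<close> and set operations are functions on \<open>'v\<close>, so that
  mathematics in the model looks like ordinary mathematics; the price is that separation,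
  replacement and induction apply only to predicates that are first-order definable. A
  calculus of closure rules, collected under the name \<open>dfn\<close>, discharges these conditions.

  Beyond \<open>\<omega>\<close>, the constructions all use one recursion theorem (\<open>wf_recursion\<close>): the cumulative
  hierarchy, transitive closures, the iteration in the proof of \<open>reflection\<close>, the truth
  predicate of a set structure (\<open>satisfaction_relation_exists\<close>), which must cover the formulas of
  the model including nonstandard ones, and the Skolem hull (\<open>exacting_domain_exists\<close>). The link
  between formulas of the metatheory and those of the model is \<open>satisfies_code\<close>. The argument
  above is \<open>embedding_fixes_definable\<close> and \<open>no_uniform_critical_cardinal\<close>.
\<close>

section \<open>Definability with parameters\<close>

primrec rename_vars :: "(nat \<Rightarrow> nat) \<Rightarrow> fm \<Rightarrow> fm" where
  "rename_vars f (Mem i j) = Mem (f i) (f j)"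
| "rename_vars f (Eq i j) = Eq (f i) (f j)"
| "rename_vars f (Nand p q) = Nand (rename_vars f p) (rename_vars f q)"
| "rename_vars f (Forall i p) = Forall (f i) (rename_vars f p)"

text \<open>
  A predicate depends on an environment and on parameters. Even variables of a formula hold the
  environment and odd variables the parameters, so there is always room for more of either.
\<close>

definition interleave :: "(nat \<Rightarrow> 'a) \<Rightarrow> (nat \<Rightarrow> 'a) \<Rightarrow> nat \<Rightarrow> 'a" where
  "interleave e c n = (if even n then e (n div 2) else c (n div 2))"

context set_structure
begin

lemma sat_rename_vars:
  assumes "inj f"
  shows "sat e (rename_vars f p) \<longleftrightarrow> sat (\<lambda>i. e (f i)) p"
proof (induction p arbitrary: e)
  case (Forall i p)
  have "(\<lambda>k. (e(f i := x)) (f k)) = (\<lambda>k. e (f k))(i := x)" for x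
    using assms by (auto simp: fun_eq_iff inj_eq)
  with Forall show ?case by simp
qed auto

text \<open>
  The set \<open>A\<close> holds the admissible parameters. With \<open>A = UNIV\<close> this is the notion needed for
  separation and replacement; with \<open>A = {l}\<close> it says which predicates an embedding that fixes \<open>l\<close>
  must respect. For empty \<open>A\<close> there are no parameter sequences; counting everything as definable then
  keeps the closure rules unconditional.
\<close>

definition definable :: "'v set \<Rightarrow> ((nat \<Rightarrow> 'v) \<Rightarrow> bool) \<Rightarrow> bool" where
  "definable A P \<longleftrightarrow>
     (A \<noteq> {} \<longrightarrow> (\<exists>p c. range c \<subseteq> A \<and> (\<forall>e. P e \<longleftrightarrow> sat (interleave e c) p)))"

text \<open>
  Terms are identified with the definable graph, where the value is variable \<open>0\<close> and the
  arguments are shifted up by one, as for a binder in de Bruijn notation.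
\<close>

definition defterm :: "'v set \<Rightarrow> ((nat \<Rightarrow> 'v) \<Rightarrow> 'v) \<Rightarrow> bool" where
  "defterm A t \<longleftrightarrow> definable A (\<lambda>e. e 0 = t (\<lambda>i. e (Suc i)))"

text \<open>
  The parameter sequences of the two formulas are interleaved and their odd variables renamed
  accordingly.
\<close>

lemma definable_nand:
  assumes "definable A P" "definable A Q"
  shows "definable A (\<lambda>e. \<not> (P e \<and> Q e))"
  unfolding definable_def
proof
  assume "A \<noteq> {}"
  with assms obtain p c q d where
    P: "range c \<subseteq> A" "\<And>e. P e \<longleftrightarrow> sat (interleave e c) p" and
    Q: "range d \<subseteq> A" "\<And>e. Q e \<longleftrightarrow> sat (interleave e d) q"
    unfolding definable_def by metis
  define f where "f n = (if even n then n else 2 * n - 1)" for n :: nat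
  define g where "g n = (if even n then n else 2 * n + 1)" for n :: nat
  have "inj f" "inj g"
    unfolding inj_def f_def g_def by (auto split: if_splits elim!: oddE)
  moreover have "(\<lambda>i. interleave e (interleave c d) (f i)) = interleave e c" for e
  proof
    fix i show "interleave e (interleave c d) (f i) = interleave e c i"
    proof (cases "even i")
      case False
      then obtain k where "i = Suc (2 * k)" by (auto elim: oddE)
      then have "odd i" "f i = Suc (2 * (2 * k))" by (auto simp: f_def)
      with \<open>i = _\<close> show ?thesis by (simp add: interleave_def)
    qed (simp add: interleave_def f_def)
  qed
  moreover have "(\<lambda>i. interleave e (interleave c d) (g i)) = interleave e d" for e
  proof
    fix i show "interleave e (interleave c d) (g i) = interleave e d i"
    proof (cases "even i")
      case False
      then obtain k where "i = Suc (2 * k)" by (auto elim: oddE)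
      then have "odd i" "g i = Suc (2 * Suc (2 * k))" by (auto simp: g_def)
      with \<open>i = _\<close> show ?thesis by (simp add: interleave_def)
    qed (simp add: interleave_def g_def)
  qed
  ultimately have "\<forall>e. \<not> (P e \<and> Q e) \<longleftrightarrow>
      sat (interleave e (interleave c d)) (Nand (rename_vars f p) (rename_vars g q))"
    by (simp add: P Q sat_rename_vars)
  moreover have "range (interleave c d) \<subseteq> A"
    using P(1) Q(1) by (auto simp: interleave_def)
  ultimately show "\<exists>p c. range c \<subseteq> A \<and> (\<forall>e. (\<not> (P e \<and> Q e)) = sat (interleave e c) p)"
    by blast
qed

text \<open>
  The bound variable must leave the environment: variable \<open>0\<close> moves to the new parameter
  position \<open>1\<close>, over which the formula quantifies, and everything else closes up. The shape of the
  premise lets resolution strip quantifiers from a goal without ever naming a formula.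
\<close>

lemma definable_all:
  assumes "definable A (\<lambda>e. Q (\<lambda>i. e (Suc i)) (e 0))"
  shows "definable A (\<lambda>e. \<forall>x. Q e x)"
  unfolding definable_def
proof
  assume "A \<noteq> {}"
  with assms obtain p c where
    P: "range c \<subseteq> A" "\<And>e. Q (\<lambda>i. e (Suc i)) (e 0) \<longleftrightarrow> sat (interleave e c) p"
    unfolding definable_def by metis
  define f where "f n = (if n = 0 then 1 else if even n then n - 2 else n + 2)" for n :: nat
  define d where "d = case_nat (c 0) c"
  have "inj f"
    unfolding inj_def f_def by (auto split: if_splits) presburger+
  have "(\<lambda>i. ((interleave e d)(1 := x)) (f i)) = interleave (case_nat x e) c" for e x
  proof
    fix i show "((interleave e d)(1 := x)) (f i) = interleave (case_nat x e) c i"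
      by (cases "even i")
        (auto simp: interleave_def f_def d_def elim!: oddE evenE split: nat.splits)
  qed
  with P(2)[of "case_nat _ _"]
  have "\<forall>e. (\<forall>x. Q e x) \<longleftrightarrow> sat (interleave e d) (Forall 1 (rename_vars f p))"
    by (simp add: sat_rename_vars[OF \<open>inj f\<close>])
  moreover have "range d \<subseteq> A"
    using P(1) by (auto simp: d_def split: nat.splits)
  ultimately show "\<exists>p c. range c \<subseteq> A \<and> (\<forall>e. (\<forall>x. Q e x) = sat (interleave e c) p)"
    by blast
qed

lemma definable_atom:
  "definable A (\<lambda>e. e i \<epsilon> e j)" "definable A (\<lambda>e. e i = e j)"
proof -
  have "\<exists>p c. range c \<subseteq> A \<and> (\<forall>e. P e = sat (interleave e c) p)"
    if "a \<in> A" "\<forall>e. P e = sat (interleave e (\<lambda>_. a)) p" for a P p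
    using that by (intro exI[of _ p] exI[of _ "\<lambda>_. a"]) auto
  from this[of _ "\<lambda>e. e i \<epsilon> e j" "Mem (2*i) (2*j)"] this[of _ "\<lambda>e. e i = e j" "Eq (2*i) (2*j)"]
  show "definable A (\<lambda>e. e i \<epsilon> e j)" "definable A (\<lambda>e. e i = e j)"
    unfolding definable_def by (auto simp: interleave_def)
qed

lemma definable_rename:
  assumes "definable A P" "inj f"
  shows "definable A (\<lambda>e. P (\<lambda>i. e (f i)))"
  unfolding definable_def
proof
  assume "A \<noteq> {}"
  with assms obtain p c where
    P: "range c \<subseteq> A" "\<And>e. P e \<longleftrightarrow> sat (interleave e c) p"
    unfolding definable_def by metis
  define g where "g n = (if even n then 2 * f (n div 2) else n)" for n
  have "inj g"
  proof (rule injI)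
    fix m n assume "g m = g n"
    then show "m = n"
      using assms(2) by (cases "even m"; cases "even n") (auto simp: g_def inj_eq elim!: evenE)
  qed
  have "(\<lambda>i. interleave e c (g i)) = interleave (\<lambda>i. e (f i)) c" for e
  proof
    fix i show "interleave e c (g i) = interleave (\<lambda>i. e (f i)) c i"
      by (cases "even i") (auto simp: interleave_def g_def)
  qed
  then have "\<forall>e. P (\<lambda>i. e (f i)) \<longleftrightarrow> sat (interleave e c) (rename_vars g p)"
    by (simp add: P(2) sat_rename_vars[OF \<open>inj g\<close>])
  with P(1) show "\<exists>p c. range c \<subseteq> A \<and> (\<forall>e. P (\<lambda>i. e (f i)) = sat (interleave e c) p)"
    by blast
qed

lemma definable_cong: "definable A P \<Longrightarrow> (\<And>e. P e \<longleftrightarrow> Q e) \<Longrightarrow> definable A Q"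
  by (simp add: definable_def)

lemma definable_not: "definable A P \<Longrightarrow> definable A (\<lambda>e. \<not> P e)"
  by (rule definable_cong[OF definable_nand]) auto

lemma definable_conj: "definable A P \<Longrightarrow> definable A Q \<Longrightarrow> definable A (\<lambda>e. P e \<and> Q e)"
  by (rule definable_cong[OF definable_not[OF definable_nand]]) auto

lemma definable_disj: "definable A P \<Longrightarrow> definable A Q \<Longrightarrow> definable A (\<lambda>e. P e \<or> Q e)"
  by (rule definable_cong[OF definable_nand[OF definable_not definable_not]]) auto

lemma definable_imp: "definable A P \<Longrightarrow> definable A Q \<Longrightarrow> definable A (\<lambda>e. P e \<longrightarrow> Q e)"
  by (rule definable_cong[OF definable_disj[OF definable_not[of A P], of Q]]) auto

lemma definable_iff: "definable A P \<Longrightarrow> definable A Q \<Longrightarrow> definable A (\<lambda>e. P e = Q e)"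
  by (rule definable_cong[OF definable_conj[OF definable_imp[of A P Q] definable_imp[of A Q P]]]) auto

lemma definable_if:
  "definable A P \<Longrightarrow> definable A Q \<Longrightarrow> definable A R \<Longrightarrow>
   definable A (\<lambda>e. if P e then Q e else R e)"
  by (rule definable_cong[OF definable_conj[OF definable_imp[of A P Q] definable_disj[of A P R]]]) auto

lemma definable_ex:
  "definable A (\<lambda>e. Q (\<lambda>i. e (Suc i)) (e 0)) \<Longrightarrow> definable A (\<lambda>e. \<exists>x. Q e x)"
  by (rule definable_cong[OF definable_not[OF definable_all[OF definable_not]]]) auto

lemma definable_bool: "definable A (\<lambda>e. b)"
proof -
  have "definable A (\<lambda>e. e 0 = e 0)" by (rule definable_atom)
  then have "definable A (\<lambda>e. True)" "definable A (\<lambda>e. \<not> True)"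
    by (simp, intro definable_not, simp)
  then show ?thesis by (cases b) auto
qed

lemma defterm_shift2:
  assumes "defterm A t"
  shows "definable A (\<lambda>e. e 0 = t (\<lambda>i. e (Suc (Suc i))))"
proof -
  have "inj (case_nat 0 (\<lambda>i. Suc (Suc i)))"
    by (auto simp: inj_def split: nat.splits)
  from definable_rename[OF assms[unfolded defterm_def] this] show ?thesis by simp
qed

lemma defterm_shift: "defterm A t \<Longrightarrow> defterm A (\<lambda>e. t (\<lambda>i. e (Suc i)))"
  unfolding defterm_def by (rule defterm_shift2[unfolded defterm_def])

lemma defterm_var: "defterm A (\<lambda>e. e i)"
  unfolding defterm_def by (rule definable_atom)

lemma defterm_const: "c \<in> A \<Longrightarrow> defterm A (\<lambda>e. c)"
  unfolding defterm_def definable_def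
  by (auto simp: interleave_def intro!: exI[of _ "Eq 0 1"] exI[of _ "\<lambda>_. c"])

lemma definable_atom_terms:
  assumes "defterm A t" "defterm A u"
  shows "definable A (\<lambda>e. t e \<epsilon> u e)" "definable A (\<lambda>e. t e = u e)"
proof -
  have *: "definable A (\<lambda>e. \<exists>x. x = t e \<and> (\<exists>y. y = u e \<and> R x y))"
    if "definable A (\<lambda>e. R (e (Suc 0)) (e 0))" for R
    by (intro definable_ex definable_conj that defterm_shift2[OF assms(2)]
        assms(1)[unfolded defterm_def])
  show "definable A (\<lambda>e. t e \<epsilon> u e)"
    using *[of "\<lambda>x y. x \<epsilon> y", OF definable_atom(1)] by simp
  show "definable A (\<lambda>e. t e = u e)"
    using *[of "\<lambda>x y. x = y", OF definable_atom(2)] by simp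
qed

text \<open>
  Simultaneous substitution of terms for variables, by induction on the formula. Substituting on
  the semantic side avoids any capture problem.
\<close>

lemma definable_sat:
  assumes "\<And>k. defterm A (u k)"
  shows "definable A (\<lambda>e. sat (\<lambda>k. u k e) p)"
  using assms
proof (induction p arbitrary: u)
  case (Forall i p)
  define u' where "u' k = (if k = i then (\<lambda>e. e 0) else (\<lambda>e. u k (\<lambda>i. e (Suc i))))"
    for k and e :: "nat \<Rightarrow> 'v"
  have "definable A (\<lambda>e. sat (\<lambda>k. u' k e) p)"
    by (rule Forall.IH) (simp add: u'_def defterm_var defterm_shift Forall.prems)
  moreover have "(\<lambda>k. u' k e) = (\<lambda>k. u k (\<lambda>i. e (Suc i)))(i := e 0)" for e
    by (auto simp: u'_def)
  ultimately have
    "definable A (\<lambda>e. sat ((\<lambda>k. u k (\<lambda>i. e (Suc i)))(i := e 0)) p)"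
    by simp
  with definable_all[where Q = "\<lambda>e x. sat ((\<lambda>k. u k e)(i := x)) p"] show ?case by simp
next
  case (Nand p q)
  then have "definable A (\<lambda>e. sat (\<lambda>k. u k e) p)" "definable A (\<lambda>e. sat (\<lambda>k. u k e) q)"
    by blast+
  then show ?case by (simp only: sat.simps) (rule definable_nand)
qed (auto intro: definable_atom_terms)

lemma definable_subst:
  assumes "definable A P" "\<And>i. defterm A (t i)"
  shows "definable A (\<lambda>e. P (\<lambda>i. t i e))"
proof (cases "A = {}")
  case False
  with assms obtain p c where
    P: "range c \<subseteq> A" "\<And>e. P e \<longleftrightarrow> sat (interleave e c) p"
    unfolding definable_def by metis
  have "definable A (\<lambda>e. sat (\<lambda>k. interleave (\<lambda>i. t i e) c k) p)"
  proof (rule definable_sat)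
    fix k show "defterm A (\<lambda>e. interleave (\<lambda>i. t i e) c k)"
      using P(1) by (cases "even k") (auto simp: interleave_def intro: assms defterm_const)
  qed
  then show ?thesis by (simp add: P(2))
qed (simp add: definable_def)

lemma definable_pred1:
  assumes "definable A (\<lambda>e. R (e 0))" "defterm A t"
  shows "definable A (\<lambda>e. R (t e))"
  using definable_subst[OF assms(1), of "\<lambda>i. t"] assms(2) by simp

lemma definable_pred2:
  assumes "definable A (\<lambda>e. R (e 0) (e 1))" "defterm A t" "defterm A u"
  shows "definable A (\<lambda>e. R (t e) (u e))"
  using definable_subst[OF assms(1), of "\<lambda>i. if i = 0 then t else u"] assms(2-) by simp

lemma definable_pred3:
  assumes "definable A (\<lambda>e. R (e 0) (e 1) (e 2))" "defterm A t" "defterm A u" "defterm A v"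
  shows "definable A (\<lambda>e. R (t e) (u e) (v e))"
  using definable_subst[OF assms(1), of "\<lambda>i. if i = 0 then t else if i = 1 then u else v"]
    assms(2-) by simp

lemma definable_pred4:
  assumes "definable A (\<lambda>e. R (e 0) (e 1) (e 2) (e 3))"
    "defterm A t" "defterm A u" "defterm A v" "defterm A w"
  shows "definable A (\<lambda>e. R (t e) (u e) (v e) (w e))"
  using definable_subst[OF assms(1),
      of "\<lambda>i. if i = 0 then t else if i = 1 then u else if i = 2 then v else w"]
    assms(2-) by simp

lemma definable_pred5:
  assumes "definable A (\<lambda>e. R (e 0) (e 1) (e 2) (e 3) (e 4))"
    "defterm A t" "defterm A u" "defterm A v" "defterm A w" "defterm A x"
  shows "definable A (\<lambda>e. R (t e) (u e) (v e) (w e) (x e))"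
  using definable_subst[OF assms(1), of "\<lambda>i. if i = 0 then t else if i = 1 then u
      else if i = 2 then v else if i = 3 then w else x"]
    assms(2-) by simp

lemma defterm_subst:
  assumes "defterm A f" "\<And>i. defterm A (t i)"
  shows "defterm A (\<lambda>e. f (\<lambda>i. t i e))"
proof -
  have "defterm A (case i of 0 \<Rightarrow> (\<lambda>e. e 0) | Suc j \<Rightarrow> (\<lambda>e. t j (\<lambda>i. e (Suc i))))" for i
    by (cases i) (auto intro: defterm_var defterm_shift assms)
  from definable_subst[OF assms(1)[unfolded defterm_def],
      of "\<lambda>i. case i of 0 \<Rightarrow> (\<lambda>e. e 0) | Suc j \<Rightarrow> (\<lambda>e. t j (\<lambda>i. e (Suc i)))", OF this]
  show ?thesis unfolding defterm_def by simp
qed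

lemma defterm_fun1:
  assumes "defterm A (\<lambda>e. F (e 0))" "defterm A t"
  shows "defterm A (\<lambda>e. F (t e))"
  using defterm_subst[OF assms(1), of "\<lambda>i. t"] assms(2) by simp

lemma defterm_fun2:
  assumes "defterm A (\<lambda>e. F (e 0) (e 1))" "defterm A t" "defterm A u"
  shows "defterm A (\<lambda>e. F (t e) (u e))"
  using defterm_subst[OF assms(1), of "\<lambda>i. if i = 0 then t else u"] assms(2-) by simp

lemma defterm_fun3:
  assumes "defterm A (\<lambda>e. F (e 0) (e 1) (e 2))" "defterm A t" "defterm A u" "defterm A v"
  shows "defterm A (\<lambda>e. F (t e) (u e) (v e))"
  using defterm_subst[OF assms(1), of "\<lambda>i. if i = 0 then t else if i = 1 then u else v"]
    assms(2-) by simp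

lemma definable_ex1:
  assumes "definable A (\<lambda>e. Q (\<lambda>i. e (Suc i)) (e 0))"
  shows "definable A (\<lambda>e. \<exists>!x. Q e x)"
proof -
  have "definable A (\<lambda>e. Q (\<lambda>i. e (Suc (Suc i))) (e 0))"
  proof -
    have "inj (case_nat 0 (\<lambda>i. Suc (Suc i)))"
      by (auto simp: inj_def split: nat.splits)
    from definable_rename[OF assms this] show ?thesis by simp
  qed
  then have "definable A (\<lambda>e. \<exists>x. \<forall>y. Q e y \<longleftrightarrow> y = x)"
    by (intro definable_ex definable_all definable_iff definable_atom)
  then show ?thesis by (rule definable_cong) (auto)
qed

lemma definable_shift: "definable A P \<Longrightarrow> definable A (\<lambda>e. P (\<lambda>i. e (Suc i)))"
  by (rule definable_rename) simp_all

lemma defterm_if: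
  assumes "definable A P" "defterm A t" "defterm A u"
  shows "defterm A (\<lambda>e. if P e then t e else u e)"
proof -
  have "definable A (\<lambda>e. (P (\<lambda>i. e (Suc i)) \<and> e 0 = t (\<lambda>i. e (Suc i))) \<or>
      (\<not> P (\<lambda>i. e (Suc i)) \<and> e 0 = u (\<lambda>i. e (Suc i))))"
    by (intro definable_disj definable_conj definable_not definable_atom_terms(2) defterm_var
        definable_shift[OF assms(1)] defterm_shift[OF assms(2)] defterm_shift[OF assms(3)])
  then show ?thesis unfolding defterm_def by (rule definable_cong) auto
qed

text \<open>
  The form in which the axiom schemes and \<open>definable_class\<close> ask for a formula.
\<close>

lemma definable_as_formula:
  assumes "definable UNIV (\<lambda>e. P (e 0))"
  shows "\<exists>p e. \<forall>x. P x \<longleftrightarrow> sat (e(0 := x)) p"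
proof -
  from assms obtain p c where p: "\<And>e. P (e 0) \<longleftrightarrow> sat (interleave e c) p"
    unfolding definable_def by auto
  define d :: "nat \<Rightarrow> 'v" where "d = (\<lambda>_. undefined)"
  have "(interleave d c)(0 := x) = interleave (case_nat x d) c" for x
    by (auto simp: fun_eq_iff interleave_def d_def elim!: evenE split: nat.splits)
  then have "P x \<longleftrightarrow> sat ((interleave d c)(0 := x)) p" for x
    using p[of "case_nat x d"] by simp
  then show ?thesis by blast
qed

section \<open>Definability of the set-theoretic notions\<close>

named_theorems dfn "closure rules for definability"

lemmas [dfn] =
  definable_atom_terms definable_not definable_conj definable_disj definable_imp
  definable_iff definable_if definable_all definable_ex definable_ex1 defterm_var defterm_if
  defterm_const[OF UNIV_I] definable_bool

lemma definable_empty [dfn]: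
  "defterm A t \<Longrightarrow> definable A (\<lambda>e. empty (t e))"
  by (rule definable_pred1[where R = empty, rotated])
    (assumption+, unfold empty_def, intro dfn)

lemma definable_sub [dfn]:
  "defterm A t \<Longrightarrow> defterm A u \<Longrightarrow> definable A (\<lambda>e. sub (t e) (u e))"
  by (rule definable_pred2[where R = sub, rotated])
    (assumption+, unfold sub_def, intro dfn)

lemma definable_is_succ [dfn]:
  "defterm A t \<Longrightarrow> defterm A u \<Longrightarrow> definable A (\<lambda>e. is_succ (t e) (u e))"
  by (rule definable_pred2[where R = is_succ, rotated])
    (assumption+, unfold is_succ_def, intro dfn)

lemma definable_is_upair [dfn]:
  "defterm A t \<Longrightarrow> defterm A u \<Longrightarrow> defterm A v \<Longrightarrow> definable A (\<lambda>e. is_upair (t e) (u e) (v e))"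
  by (rule definable_pred3[where R = is_upair, rotated])
    (assumption+, unfold is_upair_def, intro dfn)

lemma definable_is_pair [dfn]:
  "defterm A t \<Longrightarrow> defterm A u \<Longrightarrow> defterm A v \<Longrightarrow> definable A (\<lambda>e. is_pair (t e) (u e) (v e))"
  by (rule definable_pred3[where R = is_pair, rotated])
    (assumption+, unfold is_pair_def, intro dfn)

lemma definable_rel [dfn]:
  "defterm A t \<Longrightarrow> defterm A u \<Longrightarrow> defterm A v \<Longrightarrow> definable A (\<lambda>e. rel (t e) (u e) (v e))"
  by (rule definable_pred3[where R = rel, rotated])
    (assumption+, unfold rel_def, intro dfn)

lemma definable_is_function [dfn]:
  "defterm A t \<Longrightarrow> defterm A u \<Longrightarrow> defterm A v \<Longrightarrow> definable A (\<lambda>e. is_function (t e) (u e) (v e))"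
  by (rule definable_pred3[where R = is_function, rotated])
    (assumption+, unfold is_function_def, intro dfn)

lemma definable_is_bijection [dfn]:
  "defterm A t \<Longrightarrow> defterm A u \<Longrightarrow> defterm A v \<Longrightarrow> definable A (\<lambda>e. is_bijection (t e) (u e) (v e))"
  by (rule definable_pred3[where R = is_bijection, rotated])
    (assumption+, unfold is_bijection_def, intro dfn)

lemma definable_transitive [dfn]:
  "defterm A t \<Longrightarrow> definable A (\<lambda>e. transitive (t e))"
  by (rule definable_pred1[where R = transitive, rotated])
    (assumption+, unfold transitive_def, intro dfn)

lemma definable_ordinal [dfn]:
  "defterm A t \<Longrightarrow> definable A (\<lambda>e. ordinal (t e))"
  by (rule definable_pred1[where R = ordinal, rotated])
    (assumption+, unfold ordinal_def, intro dfn)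

lemma definable_limit_ordinal [dfn]:
  "defterm A t \<Longrightarrow> definable A (\<lambda>e. limit_ordinal (t e))"
  by (rule definable_pred1[where R = limit_ordinal, rotated])
    (assumption+, unfold limit_ordinal_def, intro dfn)

lemma definable_is_omega [dfn]:
  "defterm A t \<Longrightarrow> definable A (\<lambda>e. is_omega (t e))"
  by (rule definable_pred1[where R = is_omega, rotated])
    (assumption+, unfold is_omega_def, intro dfn)

lemma definable_cardinal [dfn]:
  "defterm A t \<Longrightarrow> definable A (\<lambda>e. cardinal (t e))"
  by (rule definable_pred1[where R = cardinal, rotated])
    (assumption+, unfold cardinal_def, intro dfn)

lemma definable_has_cardinality [dfn]:
  "defterm A t \<Longrightarrow> defterm A u \<Longrightarrow> definable A (\<lambda>e. has_cardinality (t e) (u e))"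
  by (rule definable_pred2[where R = has_cardinality, rotated])
    (assumption+, unfold has_cardinality_def, intro dfn)

lemma definable_is_V [dfn]:
  "defterm A t \<Longrightarrow> defterm A u \<Longrightarrow> definable A (\<lambda>e. is_V (t e) (u e))"
  by (rule definable_pred2[where R = is_V, rotated])
    (assumption+, unfold is_V_def, intro dfn)

lemma definable_natural [dfn]:
  "defterm A t \<Longrightarrow> definable A (\<lambda>e. natural (t e))"
  by (rule definable_pred1[where R = natural, rotated])
    (assumption+, unfold natural_def, intro dfn)

lemma definable_is_num [dfn]: "defterm A t \<Longrightarrow> definable A (\<lambda>e. is_num k (t e))"
proof (rule definable_pred1[where R = "is_num k", rotated], assumption)
  show "definable A (\<lambda>e. is_num k (e 0))"
  proof (induction k)
    case (Suc k)
    have *: "definable A (\<lambda>e. is_num k (t e))" if "defterm A t" for t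
      by (rule definable_pred1[where R = "is_num k"]) (rule Suc that)+
    show ?case unfolding is_num.simps by (intro dfn *)
  qed (unfold is_num.simps, intro dfn)
qed

lemma definable_is_node [dfn]:
  "defterm A t \<Longrightarrow> defterm A u \<Longrightarrow> defterm A v \<Longrightarrow> definable A (\<lambda>e. is_node k (t e) (u e) (v e))"
  by (rule definable_pred3[where R = "is_node k", rotated])
    (assumption+, unfold is_node_def, intro dfn)

lemma definable_formula_closed [dfn]:
  "defterm A t \<Longrightarrow> definable A (\<lambda>e. formula_closed (t e))"
  by (rule definable_pred1[where R = formula_closed, rotated])
    (assumption+, unfold formula_closed_def, intro dfn)

lemma definable_formula [dfn]:
  "defterm A t \<Longrightarrow> definable A (\<lambda>e. formula (t e))"
  by (rule definable_pred1[where R = formula, rotated])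
    (assumption+, unfold formula_def, intro dfn)

lemma definable_assignment [dfn]:
  "defterm A t \<Longrightarrow> defterm A u \<Longrightarrow> definable A (\<lambda>e. assignment (t e) (u e))"
  by (rule definable_pred2[where R = assignment, rotated])
    (assumption+, unfold assignment_def, intro dfn)

lemma definable_is_update [dfn]:
  "defterm A t \<Longrightarrow> defterm A u \<Longrightarrow> defterm A v \<Longrightarrow> defterm A w \<Longrightarrow> definable A (\<lambda>e. is_update (t e) (u e) (v e) (w e))"
  by (rule definable_pred4[where R = is_update, rotated])
    (assumption+, unfold is_update_def, intro dfn)

lemma definable_satisfaction_relation [dfn]:
  "defterm A t \<Longrightarrow> defterm A u \<Longrightarrow> definable A (\<lambda>e. satisfaction_relation (t e) (u e))"
  by (rule definable_pred2[where R = satisfaction_relation, rotated])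
    (assumption+, unfold satisfaction_relation_def, intro dfn)

lemma definable_satisfies [dfn]:
  "defterm A t \<Longrightarrow> defterm A u \<Longrightarrow> defterm A v \<Longrightarrow> definable A (\<lambda>e. satisfies (t e) (u e) (v e))"
  by (rule definable_pred3[where R = satisfies, rotated])
    (assumption+, unfold satisfies_def, intro dfn)

lemma definable_elementary_substructure [dfn]:
  "defterm A t \<Longrightarrow> defterm A u \<Longrightarrow> definable A (\<lambda>e. elementary_substructure (t e) (u e))"
  by (rule definable_pred2[where R = elementary_substructure, rotated])
    (assumption+, unfold elementary_substructure_def, intro dfn)

lemma definable_elementary_embedding [dfn]:
  "defterm A t \<Longrightarrow> defterm A u \<Longrightarrow> defterm A v \<Longrightarrow> definable A (\<lambda>e. elementary_embedding (t e) (u e) (v e))"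
  by (rule definable_pred3[where R = elementary_embedding, rotated])
    (assumption+, unfold elementary_embedding_def, intro dfn)

lemma definable_is_crit [dfn]:
  "defterm A t \<Longrightarrow> defterm A u \<Longrightarrow> definable A (\<lambda>e. is_crit (t e) (u e))"
  by (rule definable_pred2[where R = is_crit, rotated])
    (assumption+, unfold is_crit_def, intro dfn)

lemma definable_is_base [dfn]:
  "defterm A t \<Longrightarrow> defterm A u \<Longrightarrow> definable A (\<lambda>e. is_base (t e) (u e))"
  by (rule definable_pred2[where R = is_base, rotated])
    (assumption+, unfold is_base_def, intro dfn)

lemma definable_exacting_domain [dfn]:
  "defterm A t \<Longrightarrow> defterm A u \<Longrightarrow> defterm A v \<Longrightarrow> definable A (\<lambda>e. exacting_domain (t e) (u e) (v e))"
  by (rule definable_pred3[where R = exacting_domain, rotated])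
    (assumption+, unfold exacting_domain_def, intro dfn)

lemma definable_exacting_embedding [dfn]:
  "
   defterm A t \<Longrightarrow> defterm A u \<Longrightarrow> defterm A v \<Longrightarrow> defterm A w \<Longrightarrow> defterm A x
   \<Longrightarrow> definable A (\<lambda>e. exacting_embedding (t e) (u e) (v e) (w e) (x e))"
  by (rule definable_pred5[where R = exacting_embedding, rotated])
    (assumption+, unfold exacting_embedding_def, intro dfn)

lemma definable_critical_at [dfn]:
  "defterm A t \<Longrightarrow> defterm A u \<Longrightarrow> defterm A v \<Longrightarrow> definable A (\<lambda>e. critical_at (t e) (u e) (v e))"
  by (rule definable_pred3[where R = critical_at, rotated])
    (assumption+, unfold critical_at_def, intro dfn)

end

context ZFC_model
begin

section \<open>Sets, pairs and functions\<close>

text \<open>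
  The conjunct \<open>\<exists>c\<close> makes this the empty set when the class is proper. Thus \<open>setof P\<close> is
  characterised by a formula in all cases, and terms built from it are definable with no side
  condition on existence.
\<close>

definition setof :: "('v \<Rightarrow> bool) \<Rightarrow> 'v" where
  "setof P = (THE b. \<forall>x. x \<epsilon> b \<longleftrightarrow> P x \<and> (\<exists>c. \<forall>x. x \<epsilon> c \<longleftrightarrow> P x))"

lemma set_eqI: "(\<And>x. x \<epsilon> a \<longleftrightarrow> x \<epsilon> b) \<Longrightarrow> a = b"
  using extensionality by blast

lemma sep_ex:
  assumes "definable UNIV (\<lambda>e. P (e 0))"
  shows "\<exists>b. \<forall>x. x \<epsilon> b \<longleftrightarrow> x \<epsilon> a \<and> P x"
proof -
  obtain p e where "\<And>x. P x \<longleftrightarrow> sat (e(0 := x)) p"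
    using definable_as_formula[OF assms] by blast
  then show ?thesis using separation[of a e p] by simp
qed

lemma repl_ex:
  assumes "definable UNIV (\<lambda>e. R (e 0) (e 1))" "\<And>x. x \<epsilon> a \<Longrightarrow> \<exists>!y. R x y"
  shows "\<exists>b. \<forall>y. y \<epsilon> b \<longleftrightarrow> (\<exists>x. x \<epsilon> a \<and> R x y)"
proof -
  from assms obtain p c where p: "\<And>e. R (e 0) (e 1) \<longleftrightarrow> sat (interleave e c) p"
    unfolding definable_def by auto
  define f :: "nat \<Rightarrow> nat" where "f i = (if i = 1 then 2 else if i = 2 then 1 else i)" for i
  have "inj f" by (auto simp: inj_def f_def)
  define e where "e i = interleave (\<lambda>_. a) c (f i)" for i
  have "(\<lambda>i. (e(0 := x, 1 := y)) (f i)) = interleave (case_nat x (case_nat y (\<lambda>_. a))) c" for x y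
  proof
    fix i show "(e(0 := x, 1 := y)) (f i) = interleave (case_nat x (case_nat y (\<lambda>_. a))) c i"
    proof (cases "even i")
      case True
      then obtain k where i: "i = 2 * k" by (auto elim: evenE)
      consider "k = 0" | "k = 1" | m where "k = Suc (Suc m)" by (metis One_nat_def not0_implies_Suc)
      then show ?thesis by cases (auto simp: i f_def e_def interleave_def)
    qed (auto simp: f_def e_def interleave_def)
  qed
  then have R: "R x y \<longleftrightarrow> sat (e(0 := x, 1 := y)) (rename_vars f p)" for x y
    using p[of "case_nat x (case_nat y (\<lambda>_. a))"] by (simp add: sat_rename_vars[OF \<open>inj f\<close>])
  show ?thesis using replacement[of a e "rename_vars f p"] assms(2) unfolding R by blast
qed

lemma setof_eqI:
  assumes "\<And>x. x \<epsilon> b \<longleftrightarrow> P x"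
  shows "setof P = b"
  unfolding setof_def by (rule the_equality) (use assms set_eqI in blast)+

lemma mem_setof:
  assumes "\<exists>b. \<forall>x. x \<epsilon> b \<longleftrightarrow> P x"
  shows "x \<epsilon> setof P \<longleftrightarrow> P x"
  using assms setof_eqI[of _ P] by metis

lemma defterm_setof [dfn]:
  assumes "definable A (\<lambda>e. P (\<lambda>i. e (Suc i)) (e 0))"
  shows "defterm A (\<lambda>e. setof (P e))"
proof -
  have E: "\<exists>z. \<forall>x. \<not> x \<epsilon> z" using sep_ex[of "\<lambda>x. False"] definable_bool by blast
  have eq: "z = setof P \<longleftrightarrow> (\<forall>x. x \<epsilon> z \<longleftrightarrow> P x \<and> (\<exists>c. \<forall>x. x \<epsilon> c \<longleftrightarrow> P x))" for z P
  proof (cases "\<exists>c. \<forall>x. x \<epsilon> c \<longleftrightarrow> P x")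
    case True
    then show ?thesis using setof_eqI[of _ P] mem_setof[of P] by auto
  next
    case False
    from E obtain o' where "\<forall>x. \<not> x \<epsilon> o'" by blast
    then have "(THE b. \<forall>x. \<not> x \<epsilon> b) = o'"
      by (intro the_equality) (auto intro: set_eqI)
    moreover have *: "(P x \<and> (\<exists>c. \<forall>x. x \<epsilon> c \<longleftrightarrow> P x)) = False" for x using False by blast
    ultimately have "setof P = o'" unfolding setof_def * by simp
    with \<open>\<forall>x. \<not> x \<epsilon> o'\<close> show ?thesis
      unfolding * by (auto intro: set_eqI)
  qed
  have P2: "definable A (\<lambda>e. P (\<lambda>i. e (Suc (Suc i))) (e 0))"
    using definable_rename[OF assms, of "case_nat 0 (\<lambda>i. Suc (Suc i))"]
    by (simp add: inj_def split: nat.splits)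
  have P3: "definable A (\<lambda>e. P (\<lambda>i. e (Suc (Suc (Suc (Suc i))))) (e 0))"
    using definable_rename[OF assms, of "case_nat 0 (\<lambda>i. Suc (Suc (Suc (Suc i))))"]
    by (simp add: inj_def split: nat.splits)
  show ?thesis unfolding defterm_def eq
    by (intro dfn P2 P3)
qed

lemma defterm_shift1: "defterm A (\<lambda>e. F (\<lambda>i. e (Suc i)) (e 0)) \<Longrightarrow>
    defterm A (\<lambda>e. F (\<lambda>i. e (Suc (Suc i))) (e 0))"
  using defterm_subst[of A "\<lambda>e. F (\<lambda>i. e (Suc i)) (e 0)"
    "case_nat (\<lambda>e. e 0) (\<lambda>i e. e (Suc (Suc i)))"]
  by (auto simp: defterm_var split: nat.splits)

definition vempty :: 'v where "vempty = setof (\<lambda>x. False)"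
definition vpair :: "'v \<Rightarrow> 'v \<Rightarrow> 'v" where "vpair a b = setof (\<lambda>x. x = a \<or> x = b)"
definition vUnion :: "'v \<Rightarrow> 'v" where "vUnion a = setof (\<lambda>x. \<exists>y. y \<epsilon> a \<and> x \<epsilon> y)"
definition vPow :: "'v \<Rightarrow> 'v" where "vPow a = setof (\<lambda>x. sub x a)"
definition sep :: "'v \<Rightarrow> ('v \<Rightarrow> bool) \<Rightarrow> 'v" where "sep a P = setof (\<lambda>x. x \<epsilon> a \<and> P x)"
definition vimg :: "'v \<Rightarrow> ('v \<Rightarrow> 'v) \<Rightarrow> 'v" where "vimg a F = setof (\<lambda>y. \<exists>x. x \<epsilon> a \<and> y = F x)"
definition vunion :: "'v \<Rightarrow> 'v \<Rightarrow> 'v" where "vunion a b = vUnion (vpair a b)"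
definition vsucc :: "'v \<Rightarrow> 'v" where "vsucc a = vunion a (vpair a a)"
definition opair :: "'v \<Rightarrow> 'v \<Rightarrow> 'v" where "opair a b = vpair (vpair a a) (vpair a b)"
definition vlam :: "'v \<Rightarrow> ('v \<Rightarrow> 'v) \<Rightarrow> 'v" where "vlam a F = vimg a (\<lambda>x. opair x (F x))"
definition vapp :: "'v \<Rightarrow> 'v \<Rightarrow> 'v" where "vapp f x = setof (\<lambda>z. \<exists>y. rel f x y \<and> z \<epsilon> y)"

lemma defterm_vempty [dfn]: "defterm A (\<lambda>e. vempty)"
  unfolding vempty_def by (intro dfn)
lemma defterm_vpair [dfn]: "defterm A t \<Longrightarrow> defterm A u \<Longrightarrow> defterm A (\<lambda>e. vpair (t e) (u e))"
  by (rule defterm_fun2[where F = vpair, rotated]) (assumption+, unfold vpair_def, intro dfn)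
lemma defterm_vUnion [dfn]: "defterm A t \<Longrightarrow> defterm A (\<lambda>e. vUnion (t e))"
  by (rule defterm_fun1[where F = vUnion, rotated]) (assumption+, unfold vUnion_def, intro dfn)
lemma defterm_vPow [dfn]: "defterm A t \<Longrightarrow> defterm A (\<lambda>e. vPow (t e))"
  by (rule defterm_fun1[where F = vPow, rotated]) (assumption+, unfold vPow_def, intro dfn)
lemma defterm_vunion [dfn]: "defterm A t \<Longrightarrow> defterm A u \<Longrightarrow> defterm A (\<lambda>e. vunion (t e) (u e))"
  by (rule defterm_fun2[where F = vunion, rotated]) (assumption+, unfold vunion_def, intro dfn)
lemma defterm_vsucc [dfn]: "defterm A t \<Longrightarrow> defterm A (\<lambda>e. vsucc (t e))"
  by (rule defterm_fun1[where F = vsucc, rotated]) (assumption+, unfold vsucc_def, intro dfn)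
lemma defterm_opair [dfn]: "defterm A t \<Longrightarrow> defterm A u \<Longrightarrow> defterm A (\<lambda>e. opair (t e) (u e))"
  by (rule defterm_fun2[where F = opair, rotated]) (assumption+, unfold opair_def, intro dfn)
lemma defterm_vapp [dfn]: "defterm A t \<Longrightarrow> defterm A u \<Longrightarrow> defterm A (\<lambda>e. vapp (t e) (u e))"
  by (rule defterm_fun2[where F = vapp, rotated]) (assumption+, unfold vapp_def, intro dfn)
lemma defterm_sep [dfn]:
  assumes "defterm A t" "definable A (\<lambda>e. P (\<lambda>i. e (Suc i)) (e 0))"
  shows "defterm A (\<lambda>e. sep (t e) (P e))"
  unfolding sep_def by (intro dfn defterm_shift[OF assms(1)] assms(2))
lemma defterm_vimg [dfn]:
  assumes "defterm A t" "defterm A (\<lambda>e. F (\<lambda>i. e (Suc i)) (e 0))"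
  shows "defterm A (\<lambda>e. vimg (t e) (F e))"
  unfolding vimg_def
  by (intro dfn defterm_shift[OF defterm_shift[OF assms(1)]] defterm_shift1[OF assms(2)])
lemma defterm_vlam [dfn]:
  assumes "defterm A t" "defterm A (\<lambda>e. F (\<lambda>i. e (Suc i)) (e 0))"
  shows "defterm A (\<lambda>e. vlam (t e) (F e))"
  unfolding vlam_def by (intro dfn assms)

lemma mem_vempty [simp]: "\<not> x \<epsilon> vempty"
  unfolding vempty_def using sep_ex[of "\<lambda>x. False"] by (subst mem_setof) (auto intro: dfn)

lemma mem_vpair [simp]: "x \<epsilon> vpair a b \<longleftrightarrow> x = a \<or> x = b"
  unfolding vpair_def by (rule mem_setof[OF pairing])

lemma mem_vUnion [simp]: "x \<epsilon> vUnion a \<longleftrightarrow> (\<exists>y. y \<epsilon> a \<and> x \<epsilon> y)"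
  unfolding vUnion_def by (rule mem_setof[OF union])

lemma mem_vPow [simp]: "x \<epsilon> vPow a \<longleftrightarrow> sub x a"
  unfolding vPow_def by (rule mem_setof[OF power_set])

lemma mem_sep: "definable UNIV (\<lambda>e. P (e 0)) \<Longrightarrow> x \<epsilon> sep a P \<longleftrightarrow> x \<epsilon> a \<and> P x"
  unfolding sep_def by (rule mem_setof[OF sep_ex])

lemma mem_vimg:
  assumes "defterm UNIV (\<lambda>e. F (e 0))"
  shows "y \<epsilon> vimg a F \<longleftrightarrow> (\<exists>x. x \<epsilon> a \<and> y = F x)"
  unfolding vimg_def
proof (rule mem_setof, rule repl_ex)
  show "definable UNIV (\<lambda>e. e 1 = F (e 0))"
    by (intro dfn defterm_fun1[OF assms])
qed auto

lemma mem_vunion [simp]: "x \<epsilon> vunion a b \<longleftrightarrow> x \<epsilon> a \<or> x \<epsilon> b"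
  by (auto simp: vunion_def)

lemma mem_vsucc [simp]: "x \<epsilon> vsucc a \<longleftrightarrow> x \<epsilon> a \<or> x = a"
  by (auto simp: vsucc_def)

lemma empty_iff [simp]: "empty a \<longleftrightarrow> a = vempty"
  unfolding empty_def by (auto intro: set_eqI)

lemma is_succ_iff [simp]: "is_succ b a \<longleftrightarrow> b = vsucc a"
  unfolding is_succ_def by (auto intro: set_eqI)

lemma is_upair_iff [simp]: "is_upair c a b \<longleftrightarrow> c = vpair a b"
  unfolding is_upair_def by (auto intro: set_eqI)

lemma is_pair_iff [simp]: "is_pair c a b \<longleftrightarrow> c = opair a b"
  unfolding is_pair_def opair_def by (auto intro: set_eqI)

lemma vpair_eq: "vpair a b = vpair c d \<longleftrightarrow> a = c \<and> b = d \<or> a = d \<and> b = c"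
proof
  assume "vpair a b = vpair c d"
  then have "x = a \<or> x = b \<longleftrightarrow> x = c \<or> x = d" for x by (metis mem_vpair)
  then show "a = c \<and> b = d \<or> a = d \<and> b = c" by metis
qed (auto intro: set_eqI)

lemma opair_eq [simp]: "opair a b = opair c d \<longleftrightarrow> a = c \<and> b = d"
  unfolding opair_def by (auto simp: vpair_eq)

lemma rel_iff [simp]: "rel r x y \<longleftrightarrow> opair x y \<epsilon> r"
  unfolding rel_def by simp

lemma mem_vlam:
  assumes "defterm UNIV (\<lambda>e. F (e 0))"
  shows "z \<epsilon> vlam a F \<longleftrightarrow> (\<exists>x. x \<epsilon> a \<and> z = opair x (F x))"
  unfolding vlam_def by (rule mem_vimg) (intro dfn assms)

lemma opair_mem_vlam:
  assumes "defterm UNIV (\<lambda>e. F (e 0))"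
  shows "opair x y \<epsilon> vlam a F \<longleftrightarrow> x \<epsilon> a \<and> y = F x"
  by (auto simp: mem_vlam[OF assms])

lemma vapp_eqI:
  assumes "\<And>z. opair x z \<epsilon> f \<longleftrightarrow> z = y"
  shows "vapp f x = y"
  unfolding vapp_def by (rule setof_eqI) (simp add: assms)

lemma vapp_vlam:
  assumes "defterm UNIV (\<lambda>e. F (e 0))" "x \<epsilon> a"
  shows "vapp (vlam a F) x = F x"
  by (rule vapp_eqI) (auto simp: opair_mem_vlam[OF assms(1)] assms(2))

lemma fun_vapp:
  assumes "is_function f a b" "x \<epsilon> a"
  shows "vapp f x \<epsilon> b" "opair x y \<epsilon> f \<longleftrightarrow> y = vapp f x"
proof -
  from assms obtain y0 where "\<And>z. opair x z \<epsilon> f \<longleftrightarrow> z = y0"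
    unfolding is_function_def by (metis rel_iff)
  with vapp_eqI[of x f y0] have *: "\<And>z. opair x z \<epsilon> f \<longleftrightarrow> z = vapp f x" by simp
  then show "opair x y \<epsilon> f \<longleftrightarrow> y = vapp f x" by simp
  from * have "opair x (vapp f x) \<epsilon> f" by simp
  with assms show "vapp f x \<epsilon> b" unfolding is_function_def by fastforce
qed

lemma fun_opair: "is_function f a b \<Longrightarrow> opair x y \<epsilon> f \<longleftrightarrow> x \<epsilon> a \<and> y = vapp f x"
  using fun_vapp(2)[of f a b x y] unfolding is_function_def by fastforce

lemma fun_mem: "is_function f a b \<Longrightarrow> p \<epsilon> f \<longleftrightarrow> (\<exists>x. x \<epsilon> a \<and> p = opair x (vapp f x))"
  using fun_opair[of f a b] unfolding is_function_def by (metis is_pair_iff)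

lemma is_functionI:
  assumes "\<And>p. p \<epsilon> f \<longleftrightarrow> (\<exists>x. x \<epsilon> a \<and> p = opair x (F x))" "\<And>x. x \<epsilon> a \<Longrightarrow> F x \<epsilon> b"
  shows "is_function f a b"
  using assms unfolding is_function_def by auto

lemma is_function_vlam:
  assumes "defterm UNIV (\<lambda>e. F (e 0))" "\<And>x. x \<epsilon> a \<Longrightarrow> F x \<epsilon> b"
  shows "is_function (vlam a F) a b"
  by (rule is_functionI[OF mem_vlam[OF assms(1)] assms(2)])

lemma is_function_mono: "is_function f a b \<Longrightarrow> sub b c \<Longrightarrow> is_function f a c"
  by (rule is_functionI[OF fun_mem]) (auto simp: sub_def dest: fun_vapp(1))

lemma sub_refl [simp]: "sub a a" by (simp add: sub_def)
lemma subD: "sub a b \<Longrightarrow> x \<epsilon> a \<Longrightarrow> x \<epsilon> b" by (simp add: sub_def)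

lemma mem_irrefl [simp]: "\<not> x \<epsilon> x"
  using foundation[of x "vpair x x"] by auto

lemma mem_asym: "x \<epsilon> y \<Longrightarrow> \<not> y \<epsilon> x"
  using foundation[of x "vpair x y"] by auto

lemma vsucc_neq [simp]: "vsucc a \<noteq> vempty" "a \<noteq> vsucc a" "vsucc a \<noteq> a"
  by (metis mem_vsucc mem_vempty, (metis mem_vsucc mem_irrefl)+)

lemma vsucc_inj [simp]: "vsucc a = vsucc b \<longleftrightarrow> a = b"
  by (metis mem_vsucc mem_asym)

section \<open>Ordinals\<close>

lemma ordinal_mem: "ordinal a \<Longrightarrow> x \<epsilon> a \<Longrightarrow> ordinal x"
  unfolding ordinal_def transitive_def sub_def by blast

lemma ordinal_trans: "ordinal a \<Longrightarrow> x \<epsilon> y \<Longrightarrow> y \<epsilon> a \<Longrightarrow> x \<epsilon> a"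
  unfolding ordinal_def transitive_def sub_def by blast

text \<open>
  Foundation is an axiom about sets, so the counterexamples below \<open>a\<close> have to form one; this is why
  \<open>P\<close> must be definable.
\<close>

lemma ordinal_induct [consumes 1, case_names def step]:
  assumes "ordinal a" "definable UNIV (\<lambda>e. P (e 0))"
    "\<And>a. ordinal a \<Longrightarrow> (\<And>b. b \<epsilon> a \<Longrightarrow> P b) \<Longrightarrow> P a"
  shows "P a"
proof (rule ccontr)
  assume "\<not> P a"
  let ?B = "sep (vsucc a) (\<lambda>x. \<not> P x)"
  have B: "x \<epsilon> ?B \<longleftrightarrow> (x \<epsilon> a \<or> x = a) \<and> \<not> P x" for x
    by (subst mem_sep) (intro dfn assms(2), simp)
  from \<open>\<not> P a\<close> have "a \<epsilon> ?B" by (simp add: B)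
  from foundation[OF this] obtain b where b: "b \<epsilon> ?B" "\<And>z. z \<epsilon> b \<Longrightarrow> \<not> z \<epsilon> ?B" by blast
  then have "ordinal b" using assms(1) ordinal_mem by (auto simp: B)
  moreover have "P z" if "z \<epsilon> b" for z
    using b that assms(1) ordinal_trans by (auto simp: B)
  ultimately have "P b" by (rule assms(3))
  with b(1) show False by (simp add: B)
qed

lemma ordinal_linear: "ordinal a \<Longrightarrow> ordinal b \<Longrightarrow> a \<epsilon> b \<or> a = b \<or> b \<epsilon> a"
proof -
  have "\<forall>b. ordinal b \<longrightarrow> a \<epsilon> b \<or> a = b \<or> b \<epsilon> a" if "ordinal a" for a
    using that
  proof (induction a rule: ordinal_induct)
    case (step a)
    note IH = step(2)
    have "a \<epsilon> b \<or> a = b \<or> b \<epsilon> a" if "ordinal b" for b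
      using that
    proof (induction b rule: ordinal_induct)
      case (step b)
      show ?case
      proof (rule ccontr)
        assume n: "\<not> (a \<epsilon> b \<or> a = b \<or> b \<epsilon> a)"
        have "x \<epsilon> b" if x: "x \<epsilon> a" for x
        proof -
          from IH[OF x] \<open>ordinal b\<close> have "x \<epsilon> b \<or> x = b \<or> b \<epsilon> x" by blast
          with n x ordinal_trans[OF \<open>ordinal a\<close> _ x] show ?thesis by blast
        qed
        moreover have "y \<epsilon> a" if y: "y \<epsilon> b" for y
          using step(2)[OF y] n y ordinal_trans[OF \<open>ordinal b\<close> _ y] by blast
        ultimately have "a = b" by (blast intro: set_eqI)
        with n show False by blast
      qed
    qed (intro dfn)
    then show ?case by blast
  qed (intro dfn)
  then show "ordinal a \<Longrightarrow> ordinal b \<Longrightarrow> a \<epsilon> b \<or> a = b \<or> b \<epsilon> a" by blast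
qed

lemma ordinal_sub: "ordinal a \<Longrightarrow> ordinal b \<Longrightarrow> sub a b \<longleftrightarrow> a \<epsilon> b \<or> a = b"
  unfolding sub_def using ordinal_linear ordinal_trans mem_irrefl by metis

lemma ordinal_least:
  assumes "definable UNIV (\<lambda>e. P (e 0))" "ordinal a" "P a"
  obtains b where "ordinal b" "P b" "\<And>c. c \<epsilon> b \<Longrightarrow> \<not> P c"
proof -
  have "\<exists>b. ordinal b \<and> P b \<and> (\<forall>c. c \<epsilon> b \<longrightarrow> \<not> P c)"
  proof (rule ccontr)
    assume n: "\<not> ?thesis"
    have "\<not> P a" using assms(2)
    proof (induction a rule: ordinal_induct)
      case (step a) with n show ?case by blast
    qed (intro dfn assms(1))
    with assms(3) show False by blast
  qed
  with that show thesis by blast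
qed

lemma ordinal_vempty [simp]: "ordinal vempty"
  unfolding ordinal_def transitive_def by simp

lemma ordinal_vsucc [simp]: "ordinal (vsucc a) \<longleftrightarrow> ordinal a"
proof
  assume "ordinal (vsucc a)" then show "ordinal a" by (rule ordinal_mem) simp
next
  assume "ordinal a" then show "ordinal (vsucc a)"
    unfolding ordinal_def transitive_def sub_def mem_vsucc by blast
qed

lemma ordinal_vUnion: "(\<And>x. x \<epsilon> a \<Longrightarrow> ordinal x) \<Longrightarrow> ordinal (vUnion a)"
  unfolding ordinal_def transitive_def sub_def mem_vUnion by blast

lemma ordinal_vsucc_mono: "ordinal b \<Longrightarrow> a \<epsilon> b \<Longrightarrow> vsucc a \<epsilon> vsucc b"
proof -
  assume b: "ordinal b" "a \<epsilon> b"
  then have "ordinal a" by (rule ordinal_mem)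
  have "\<not> b \<epsilon> vsucc a" using b mem_asym by auto
  with ordinal_linear[of "vsucc a" b] b \<open>ordinal a\<close> show "vsucc a \<epsilon> vsucc b" by auto
qed

lemma limit_ordinal_iff:
  "limit_ordinal d \<longleftrightarrow> ordinal d \<and> d \<noteq> vempty \<and> (\<forall>a. a \<epsilon> d \<longrightarrow> vsucc a \<epsilon> d)"
proof -
  have "(\<exists>b. b \<epsilon> d \<and> a \<epsilon> b) \<longleftrightarrow> vsucc a \<epsilon> d" if d: "ordinal d" "a \<epsilon> d" for a
  proof
    assume "\<exists>b. b \<epsilon> d \<and> a \<epsilon> b"
    then obtain b where "b \<epsilon> d" "a \<epsilon> b" by blast
    then have "vsucc a \<epsilon> vsucc b" using d ordinal_mem ordinal_vsucc_mono by blast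
    then show "vsucc a \<epsilon> d" using \<open>b \<epsilon> d\<close> d ordinal_trans by auto
  qed (intro exI[of _ "vsucc a"], simp)
  then show ?thesis unfolding limit_ordinal_def by auto
qed

lemma successor_cases:
  assumes "ordinal d" "d \<noteq> vempty" "\<not> limit_ordinal d"
  obtains a where "ordinal a" "d = vsucc a"
proof -
  from assms obtain a where a: "a \<epsilon> d" "\<not> vsucc a \<epsilon> d" unfolding limit_ordinal_iff by blast
  with assms have "ordinal a" "vsucc a = d \<or> d \<epsilon> vsucc a"
    using ordinal_linear[of "vsucc a" d] ordinal_mem by auto
  moreover have "\<not> d \<epsilon> vsucc a" using a mem_asym mem_irrefl by auto
  ultimately show thesis using that by blast
qed

section \<open>The natural numbers\<close>

text \<open>
  The inductive set given by the axiom of infinity may contain anything; the ordinals in it that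
  are neither limits nor above a limit form the least limit ordinal.
\<close>

lemma omega_exists: "\<exists>w. is_omega w"
proof -
  obtain w where w: "vempty \<epsilon> w" "\<And>x. x \<epsilon> w \<Longrightarrow> vsucc x \<epsilon> w"
    using infinity by auto
  define N where "N n \<longleftrightarrow> ordinal n \<and> (\<forall>m. m \<epsilon> vsucc n \<longrightarrow> \<not> limit_ordinal m)" for n
  have dN: "definable UNIV (\<lambda>e. N (e 0))" unfolding N_def by (intro dfn)
  have N_mem: "N m" if "N n" "m \<epsilon> n" for m n
    using that ordinal_mem ordinal_trans unfolding N_def by auto
  have Nw: "n \<epsilon> w" if "N n" for n
  proof -
    have "ordinal n" using that N_def by simp
    then have "N n \<longrightarrow> n \<epsilon> w"
    proof (induction n rule: ordinal_induct)
      case (step n)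
      show ?case
      proof
        assume "N n"
        then have "\<not> limit_ordinal n" by (simp add: N_def)
        show "n \<epsilon> w"
        proof (cases "n = vempty")
          case False
          then obtain k where k: "n = vsucc k"
            using successor_cases[OF step(1)] \<open>\<not> limit_ordinal n\<close> by metis
          with step(2)[of k] N_mem[OF \<open>N n\<close>, of k] w(2) show ?thesis by simp
        qed (simp add: w)
      qed
    qed (intro dfn dN)
    with that show ?thesis by blast
  qed
  define o' where "o' = sep w N"
  have o': "n \<epsilon> o' \<longleftrightarrow> N n" for n
    unfolding o'_def by (subst mem_sep[OF dN]) (use Nw in blast)
  have "ordinal o'"
    unfolding ordinal_def
  proof (intro conjI allI impI)
    show "transitive o'" unfolding transitive_def sub_def o' using N_mem by blast
    show "transitive x" if "x \<epsilon> o'" for x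
      using that unfolding o' N_def ordinal_def by blast
  qed
  moreover have "N vempty" by (auto simp: N_def limit_ordinal_iff)
  moreover have "N (vsucc n)" if "N n" for n
  proof -
    have "\<not> limit_ordinal (vsucc n)"
    proof
      assume "limit_ordinal (vsucc n)"
      then have "vsucc n \<epsilon> vsucc n" unfolding limit_ordinal_iff using mem_vsucc by blast
      then show False by simp
    qed
    with that show ?thesis unfolding N_def ordinal_vsucc mem_vsucc by blast
  qed
  ultimately have "limit_ordinal o'" unfolding limit_ordinal_iff using o' mem_vempty by metis
  moreover have "\<not> limit_ordinal n" if "n \<epsilon> o'" for n
    using that unfolding o' N_def by simp
  ultimately show ?thesis unfolding is_omega_def by blast
qed

definition omega :: 'v where "omega = (SOME w. is_omega w)"

lemma is_omega_omega: "is_omega omega"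
  unfolding omega_def by (rule someI_ex[OF omega_exists])

lemma is_omega_iff [simp]: "is_omega w \<longleftrightarrow> w = omega"
proof
  assume "is_omega w"
  with is_omega_omega ordinal_linear[of w omega] show "w = omega"
    unfolding is_omega_def limit_ordinal_def by blast
qed (simp add: is_omega_omega)

lemma limit_omega: "limit_ordinal omega" and ordinal_omega [simp]: "ordinal omega"
  using is_omega_omega unfolding is_omega_def limit_ordinal_def by auto

lemma natural_iff [simp]: "natural n \<longleftrightarrow> n \<epsilon> omega"
  unfolding natural_def by simp

lemma omega_vempty [simp]: "vempty \<epsilon> omega"
proof -
  obtain x where "x \<epsilon> omega" using limit_omega unfolding limit_ordinal_iff by (metis mem_vempty set_eqI)
  then show ?thesis using ordinal_linear[of vempty omega] by (metis mem_vempty ordinal_omega ordinal_vempty)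
qed

lemma omega_vsucc [simp]: "vsucc n \<epsilon> omega \<longleftrightarrow> n \<epsilon> omega"
  using limit_omega ordinal_trans[of omega n "vsucc n"] unfolding limit_ordinal_iff by auto

lemma omega_ordinal: "n \<epsilon> omega \<Longrightarrow> ordinal n"
  by (rule ordinal_mem[OF ordinal_omega])

lemma omega_cases:
  assumes "n \<epsilon> omega" obtains "n = vempty" | k where "k \<epsilon> omega" "n = vsucc k"
  using successor_cases[of n] assms is_omega_omega ordinal_omega omega_ordinal omega_vsucc
  unfolding is_omega_def by metis

lemma omega_induct [consumes 1, case_names def vempty vsucc]:
  assumes "n \<epsilon> omega" "definable UNIV (\<lambda>e. P (e 0))" "P vempty" "\<And>n. n \<epsilon> omega \<Longrightarrow> P n \<Longrightarrow> P (vsucc n)"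
  shows "P n"
proof -
  have "ordinal n" using assms(1) by (rule omega_ordinal)
  then have "n \<epsilon> omega \<longrightarrow> P n"
  proof (induction n rule: ordinal_induct)
    case (step n)
    then show ?case using assms(3,4) omega_cases[of n] by (metis mem_vsucc)
  qed (intro dfn assms(2))
  with assms(1) show ?thesis by blast
qed

section \<open>Recursion along definable relations\<close>

lemma setof_cong: "(\<And>x. P x \<longleftrightarrow> Q x) \<Longrightarrow> setof P = setof Q"
  by presburger

lemma vlam_cong: "(\<And>x. x \<epsilon> a \<Longrightarrow> F x = G x) \<Longrightarrow> vlam a F = vlam a G"
  unfolding vlam_def vimg_def by (rule setof_cong) metis

lemma vimg_cong: "(\<And>x. x \<epsilon> a \<Longrightarrow> F x = G x) \<Longrightarrow> vimg a F = vimg a G"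
  unfolding vimg_def by (rule setof_cong) metis

text \<open>
  Here \<open>ext x\<close> is the set of predecessors of \<open>x\<close> in a transitive, definably well-founded relation, and
  the recursion hands \<open>G\<close> the set function \<open>H \<restriction> ext x\<close>. As \<open>H\<close> has to be definable, it is defined from
  the unique set-sized attempt on \<open>ext x\<close>; any two attempts agree where both are defined, and the
  attempts below \<open>x\<close> glue to one on \<open>ext x\<close>.
\<close>

lemma wf_recursion:
  assumes ext: "defterm UNIV (\<lambda>e. ext (e 0))"
    and G: "defterm UNIV (\<lambda>e. G (e 0) (e 1))"
    and trans: "\<And>x y z. y \<epsilon> ext x \<Longrightarrow> z \<epsilon> ext y \<Longrightarrow> z \<epsilon> ext x"
    and ind: "\<And>P x. definable UNIV (\<lambda>e. P (e 0)) \<Longrightarrow>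
      (\<And>x. (\<And>y. y \<epsilon> ext x \<Longrightarrow> P y) \<Longrightarrow> P x) \<Longrightarrow> P x"
  obtains H where "defterm UNIV (\<lambda>e. H (e 0))" "\<And>x. H x = G x (vlam (ext x) H)"
proof -
  note ext' = defterm_fun1[where F = ext, OF ext]
  note G' = defterm_fun2[where F = G, OF G]
  define att where "att f x \<longleftrightarrow> f = vlam (ext x) (\<lambda>y. vapp f y) \<and>
    (\<forall>y. y \<epsilon> ext x \<longrightarrow> vapp f y = G y (vlam (ext y) (\<lambda>z. vapp f z)))" for f x
  have att: "definable UNIV (\<lambda>e. att (e 0) (e 1))"
    unfolding att_def by (intro dfn ext' G')
  note att' = definable_pred2[where R = att, OF att]
  have uniq: "y \<epsilon> ext x \<longrightarrow> y \<epsilon> ext x' \<longrightarrow> vapp f y = vapp g y" if "att f x" "att g x'" for f g x x' y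
  proof (rule ind[where P = "\<lambda>y. y \<epsilon> ext x \<longrightarrow> y \<epsilon> ext x' \<longrightarrow> vapp f y = vapp g y"])
    show "definable UNIV (\<lambda>e. e 0 \<epsilon> ext x \<longrightarrow> e 0 \<epsilon> ext x' \<longrightarrow> vapp f (e 0) = vapp g (e 0))"
      by (intro dfn)
    fix y assume IH: "\<And>z. z \<epsilon> ext y \<Longrightarrow> z \<epsilon> ext x \<longrightarrow> z \<epsilon> ext x' \<longrightarrow> vapp f z = vapp g z"
    show "y \<epsilon> ext x \<longrightarrow> y \<epsilon> ext x' \<longrightarrow> vapp f y = vapp g y"
    proof (intro impI)
      assume y: "y \<epsilon> ext x" "y \<epsilon> ext x'"
      have "vlam (ext y) (\<lambda>z. vapp f z) = vlam (ext y) (\<lambda>z. vapp g z)"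
        by (rule vlam_cong) (use IH y trans in blast)
      with that y show "vapp f y = vapp g y" unfolding att_def by metis
    qed
  qed
  define H where "H x = G x (vUnion (setof (\<lambda>f. att f x)))" for x
  have H: "defterm UNIV (\<lambda>e. H (e 0))"
    unfolding H_def by (intro dfn G' att')
  note H' = defterm_fun1[where F = H, OF H]
  have H_att: "H x = G x f" if "att f x" for f x
  proof -
    have "g = f" if "att g x" for g
    proof -
      have "vlam (ext x) (\<lambda>y. vapp g y) = vlam (ext x) (\<lambda>y. vapp f y)"
        by (rule vlam_cong) (use uniq[OF that \<open>att f x\<close>] in blast)
      with that \<open>att f x\<close> show ?thesis unfolding att_def by metis
    qed
    with that have "\<And>g. g \<epsilon> vpair f f \<longleftrightarrow> att g x" by (metis mem_vpair)
    then have "setof (\<lambda>f. att f x) = vpair f f" by (rule setof_eqI)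
    then have "vUnion (setof (\<lambda>f. att f x)) = f" by (auto intro: set_eqI)
    then show ?thesis by (simp add: H_def)
  qed
  have ex: "att (vlam (ext x) H) x" for x
  proof (rule ind[where P = "\<lambda>x. att (vlam (ext x) H) x"])
    show "definable UNIV (\<lambda>e. att (vlam (ext (e 0)) H) (e 0))"
      by (intro dfn att' ext' H')
    fix x assume IH: "\<And>y. y \<epsilon> ext x \<Longrightarrow> att (vlam (ext y) H) y"
    have a: "vapp (vlam (ext x) H) y = H y" if "y \<epsilon> ext x" for y
      by (rule vapp_vlam[OF H that])
    have eq: "vlam (ext y) (\<lambda>z. vapp (vlam (ext x) H) z) = vlam (ext y) H" if "y \<epsilon> ext x" for y
      by (rule vlam_cong) (use a trans that in blast)
    have "H y = G y (vlam (ext y) H)" if "y \<epsilon> ext x" for y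
      by (rule H_att[OF IH[OF that]])
    then have G_eq: "vapp (vlam (ext x) H) y = G y (vlam (ext y) (\<lambda>z. vapp (vlam (ext x) H) z))"
      if "y \<epsilon> ext x" for y
      using a[OF that] eq[OF that] that by metis
    have "vlam (ext x) H = vlam (ext x) (\<lambda>y. vapp (vlam (ext x) H) y)"
      by (rule vlam_cong) (rule a[symmetric])
    with G_eq show "att (vlam (ext x) H) x" unfolding att_def by blast
  qed
  show thesis by (rule that[OF H]) (rule H_att[OF ex])
qed

lemma ordinal_recursion:
  assumes G: "defterm UNIV (\<lambda>e. G (e 0) (e 1))"
  obtains H where "defterm UNIV (\<lambda>e. H (e 0))" "\<And>a. ordinal a \<Longrightarrow> H a = G a (vlam a H)"
proof -
  define ext where "ext a = sep a (\<lambda>x. ordinal a)" for a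
  have mem: "y \<epsilon> ext a \<longleftrightarrow> y \<epsilon> a \<and> ordinal a" for y a
    unfolding ext_def by (subst mem_sep) (intro dfn, simp)
  have ex: "\<exists>H. defterm UNIV (\<lambda>e. H (e 0)) \<and> (\<forall>x. H x = G x (vlam (ext x) H))"
  proof (rule wf_recursion[where ext = ext and G = G])
    show "defterm UNIV (\<lambda>e. ext (e 0))" unfolding ext_def by (intro dfn)
    show "y \<epsilon> ext x \<Longrightarrow> z \<epsilon> ext y \<Longrightarrow> z \<epsilon> ext x" for x y z
      using ordinal_trans mem by blast
    fix P x assume P: "definable UNIV (\<lambda>e. P (e 0))"
      and step: "\<And>x. (\<And>y. y \<epsilon> ext x \<Longrightarrow> P y) \<Longrightarrow> P x"
    show "P x"
    proof (cases "ordinal x")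
      case True
      then show ?thesis
        by (induction x rule: ordinal_induct) (rule P, rule step, simp add: mem)
    qed (rule step, simp add: mem)
  qed (use G in blast)+
  then obtain H where H: "defterm UNIV (\<lambda>e. H (e 0))" "\<And>x. H x = G x (vlam (ext x) H)"
    by blast
  have "ext a = a" if "ordinal a" for a
    using that by (auto simp: mem intro: set_eqI)
  with H(2) have "\<And>a. ordinal a \<Longrightarrow> H a = G a (vlam a H)" by metis
  with H(1) show thesis by (rule that)
qed

text \<open>
  The union of \<open>x\<close>, \<open>\<Union>x\<close>, \<open>\<Union>\<Union>x\<close> and so on, computed by recursion along \<open>\<omega>\<close>.
\<close>

lemma transitive_superset: "\<exists>t. x \<epsilon> t \<and> transitive t"
proof -
  have "defterm UNIV (\<lambda>e. vunion x (vUnion (vUnion (vimg (e 0) (\<lambda>n. vapp (e 1) n)))))"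
    by (intro dfn)
  from ordinal_recursion[OF this] obtain H where
    H: "defterm UNIV (\<lambda>e. H (e 0))"
    "\<And>a. ordinal a \<Longrightarrow> H a = vunion x (vUnion (vUnion (vimg a (\<lambda>n. vapp (vlam a H) n))))" by blast
  have "vimg a (\<lambda>n. vapp (vlam a H) n) = vimg a H" for a
    by (rule vimg_cong) (rule vapp_vlam[OF H(1)])
  then have mem: "y \<epsilon> H a \<longleftrightarrow> y \<epsilon> x \<or> (\<exists>z n. n \<epsilon> a \<and> z \<epsilon> H n \<and> y \<epsilon> z)" if "ordinal a" for a y
    using H(2)[OF that] by (auto simp: mem_vimg[OF H(1)])
  define t where "t = vunion (vpair x x) (vUnion (vimg omega H))"
  have t: "y \<epsilon> t \<longleftrightarrow> y = x \<or> (\<exists>n. n \<epsilon> omega \<and> y \<epsilon> H n)" for y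
    by (auto simp: t_def mem_vimg[OF H(1)])
  have "y \<epsilon> t" if zy: "y \<epsilon> z" "z \<epsilon> t" for y z
  proof (cases "z = x")
    case True
    with zy mem[of vempty y] have "y \<epsilon> H vempty" by simp
    then show ?thesis using t omega_vempty by blast
  next
    case False
    with zy t obtain n where n: "n \<epsilon> omega" "z \<epsilon> H n" by blast
    then have "y \<epsilon> H (vsucc n)"
      using mem[of "vsucc n" y] zy omega_ordinal by auto
    with n show ?thesis using t omega_vsucc by blast
  qed
  then have "transitive t" unfolding transitive_def sub_def by blast
  with t show ?thesis by blast
qed

text \<open>
  Foundation is applied inside a transitive set around \<open>x\<close>, where the counterexamples form a
  set.
\<close>

lemma mem_induct:
  assumes P: "definable UNIV (\<lambda>e. P (e 0))" and step: "\<And>x. (\<And>y. y \<epsilon> x \<Longrightarrow> P y) \<Longrightarrow> P x"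
  shows "P x"
proof (rule ccontr)
  assume "\<not> P x"
  obtain t where t: "x \<epsilon> t" "transitive t" using transitive_superset by blast
  let ?B = "sep t (\<lambda>x. \<not> P x)"
  have B: "x \<epsilon> ?B \<longleftrightarrow> x \<epsilon> t \<and> \<not> P x" for x
    by (rule mem_sep) (intro dfn P)
  with t \<open>\<not> P x\<close> have "x \<epsilon> ?B" by blast
  from foundation[OF this] obtain y where "y \<epsilon> ?B" "\<And>z. z \<epsilon> y \<Longrightarrow> \<not> z \<epsilon> ?B" by blast
  with B t have "\<not> P y" "\<And>z. z \<epsilon> y \<Longrightarrow> P z"
    unfolding transitive_def sub_def by blast+
  with step show False by blast
qed

section \<open>The cumulative hierarchy\<close>

text \<open>
  An ordinal is the set of smaller ones, so the least solution consists of the ordinals below every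
  solution. Unlike a choice operator, this is a definable term.
\<close>

definition least_ord :: "('v \<Rightarrow> bool) \<Rightarrow> 'v" where
  "least_ord P = setof (\<lambda>b. ordinal b \<and> (\<forall>a. ordinal a \<and> P a \<longrightarrow> b \<epsilon> a))"

lemma defterm_least_ord [dfn]:
  assumes "definable A (\<lambda>e. P (\<lambda>i. e (Suc i)) (e 0))"
  shows "defterm A (\<lambda>e. least_ord (P e))"
proof -
  have "definable A (\<lambda>e. P (\<lambda>i. e (Suc (Suc i))) (e 0))"
    using definable_rename[OF assms, of "case_nat 0 (\<lambda>i. Suc (Suc i))"]
    by (simp add: inj_def split: nat.splits)
  then show ?thesis unfolding least_ord_def by (intro dfn)
qed

lemma least_ord:
  assumes "definable UNIV (\<lambda>e. P (e 0))" "ordinal a" "P a"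
  shows "ordinal (least_ord P)" "P (least_ord P)" "\<And>b. ordinal b \<Longrightarrow> P b \<Longrightarrow> \<not> b \<epsilon> least_ord P"
    "sub (least_ord P) a"
proof -
  obtain b where b: "ordinal b" "P b" "\<And>c. c \<epsilon> b \<Longrightarrow> \<not> P c"
    using ordinal_least[where P = P, OF assms] by blast
  have "x \<epsilon> b \<longleftrightarrow> ordinal x \<and> (\<forall>a. ordinal a \<and> P a \<longrightarrow> x \<epsilon> a)" for x
  proof
    assume x: "x \<epsilon> b"
    have "x \<epsilon> a" if "ordinal a" "P a" for a
      using ordinal_linear[of a b] b that x ordinal_trans by blast
    with x b show "ordinal x \<and> (\<forall>a. ordinal a \<and> P a \<longrightarrow> x \<epsilon> a)"
      using ordinal_mem by blast
  qed (use b in blast)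
  then have eq: "least_ord P = b" unfolding least_ord_def by (rule setof_eqI)
  with b show "ordinal (least_ord P)" "P (least_ord P)" "\<And>b. ordinal b \<Longrightarrow> P b \<Longrightarrow> \<not> b \<epsilon> least_ord P" by blast+
  show "sub (least_ord P) a"
    using ordinal_linear[of a b] b assms eq ordinal_sub by blast
qed

definition Vset :: "'v \<Rightarrow> 'v" where
  "Vset = (SOME H. defterm UNIV (\<lambda>e. H (e 0)) \<and>
     (\<forall>a x. ordinal a \<longrightarrow> (x \<epsilon> H a \<longleftrightarrow> (\<exists>b. b \<epsilon> a \<and> sub x (H b)))))"

lemma Vset_spec: "defterm UNIV (\<lambda>e. Vset (e 0)) \<and>
  (\<forall>a x. ordinal a \<longrightarrow> (x \<epsilon> Vset a \<longleftrightarrow> (\<exists>b. b \<epsilon> a \<and> sub x (Vset b))))"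
proof -
  have "defterm UNIV (\<lambda>e. vUnion (vimg (e 0) (\<lambda>b. vPow (vapp (e 1) b))))"
    by (intro dfn)
  from ordinal_recursion[OF this] obtain H where
    H: "defterm UNIV (\<lambda>e. H (e 0))"
    "\<And>a. ordinal a \<Longrightarrow> H a = vUnion (vimg a (\<lambda>b. vPow (vapp (vlam a H) b)))" by blast
  have "vimg a (\<lambda>b. vPow (vapp (vlam a H) b)) = vimg a (\<lambda>b. vPow (H b))" for a
    by (rule vimg_cong) (simp add: vapp_vlam[OF H(1)])
  moreover have "defterm UNIV (\<lambda>e. vPow (H (e 0)))" by (intro dfn H(1))
  ultimately have "x \<epsilon> H a \<longleftrightarrow> (\<exists>b. b \<epsilon> a \<and> sub x (H b))" if "ordinal a" for a x
    using H(2)[OF that] by (auto simp: mem_vimg)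
  with H(1) have "\<exists>H. defterm UNIV (\<lambda>e. H (e 0)) \<and>
     (\<forall>a x. ordinal a \<longrightarrow> (x \<epsilon> H a \<longleftrightarrow> (\<exists>b. b \<epsilon> a \<and> sub x (H b))))"
    by blast
  then show ?thesis unfolding Vset_def by (rule someI_ex)
qed

lemma defterm_Vset [dfn]: "defterm UNIV t \<Longrightarrow> defterm UNIV (\<lambda>e. Vset (t e))"
  by (rule defterm_fun1) (use Vset_spec in blast)

lemma mem_Vset: "ordinal a \<Longrightarrow> x \<epsilon> Vset a \<longleftrightarrow> (\<exists>b. b \<epsilon> a \<and> sub x (Vset b))"
  using Vset_spec by blast

lemma Vset_mono: "ordinal b \<Longrightarrow> a \<epsilon> b \<or> a = b \<Longrightarrow> sub (Vset a) (Vset b)"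
  unfolding sub_def by (metis mem_Vset ordinal_mem ordinal_trans)

definition rank :: "'v \<Rightarrow> 'v" where "rank x = least_ord (\<lambda>a. sub x (Vset a))"

lemma defterm_rank [dfn]: "defterm UNIV t \<Longrightarrow> defterm UNIV (\<lambda>e. rank (t e))"
  by (rule defterm_fun1[where F = rank, rotated]) (assumption, unfold rank_def, intro dfn)

text \<open>
  Replacement bounds the ranks of the elements of \<open>x\<close>.
\<close>

lemma in_some_Vset: "\<exists>a. ordinal a \<and> sub x (Vset a)"
proof (rule mem_induct[where P = "\<lambda>x. \<exists>a. ordinal a \<and> sub x (Vset a)"])
  show "definable UNIV (\<lambda>e. \<exists>a. ordinal a \<and> sub (e 0) (Vset a))" by (intro dfn)
  fix x assume IH: "\<And>y. y \<epsilon> x \<Longrightarrow> \<exists>a. ordinal a \<and> sub y (Vset a)"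
  have rank: "ordinal (rank y)" "sub y (Vset (rank y))" if "y \<epsilon> x" for y
  proof -
    have d: "definable UNIV (\<lambda>e. sub y (Vset (e 0)))" by (intro dfn)
    from IH[OF that] obtain a where "ordinal a" "sub y (Vset a)" by blast
    from least_ord[where P = "\<lambda>a. sub y (Vset a)", OF d this]
    show "ordinal (rank y)" "sub y (Vset (rank y))" unfolding rank_def by blast+
  qed
  define a where "a = vUnion (vimg x (\<lambda>y. vsucc (vsucc (rank y))))"
  have d: "defterm UNIV (\<lambda>e. vsucc (vsucc (rank (e 0))))" by (intro dfn)
  have a: "ordinal a" unfolding a_def
    by (rule ordinal_vUnion) (use rank in \<open>auto simp: mem_vimg[OF d]\<close>)
  have "y \<epsilon> Vset a" if "y \<epsilon> x" for y
  proof -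
    have "rank y \<epsilon> a" unfolding a_def using that by (auto simp: mem_vimg[OF d])
    with rank(2)[OF that] a show ?thesis using mem_Vset by blast
  qed
  with a show "\<exists>a. ordinal a \<and> sub x (Vset a)" unfolding sub_def by blast
qed

lemma rank: "ordinal (rank x)" "sub x (Vset (rank x))"
  and rank_le: "ordinal a \<Longrightarrow> sub x (Vset a) \<Longrightarrow> rank x \<epsilon> a \<or> rank x = a"
proof -
  have d: "definable UNIV (\<lambda>e. sub x (Vset (e 0)))" by (intro dfn)
  from in_some_Vset obtain b where b: "ordinal b" "sub x (Vset b)" by blast
  from least_ord[where P = "\<lambda>a. sub x (Vset a)", OF d b]
  show r: "ordinal (rank x)" "sub x (Vset (rank x))" unfolding rank_def by blast+
  show "rank x \<epsilon> a \<or> rank x = a" if a: "ordinal a" "sub x (Vset a)"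
    using least_ord(4)[where P = "\<lambda>a. sub x (Vset a)", OF d a] r(1) a(1)
    by (simp add: ordinal_sub flip: rank_def)
qed

lemma mem_Vset_rank: "ordinal a \<Longrightarrow> x \<epsilon> Vset a \<longleftrightarrow> rank x \<epsilon> a"
  using mem_Vset rank rank_le ordinal_mem ordinal_trans by metis

lemma rank_mem: "y \<epsilon> x \<Longrightarrow> rank y \<epsilon> rank x"
  using rank[of x] mem_Vset_rank sub_def by blast

lemma rank_less: "ordinal a \<Longrightarrow> (\<And>y. y \<epsilon> x \<Longrightarrow> rank y \<epsilon> a) \<Longrightarrow> rank x \<epsilon> a \<or> rank x = a"
  by (rule rank_le) (auto simp: sub_def mem_Vset_rank)

lemma rank_ordinal: "ordinal a \<Longrightarrow> rank a = a"
proof (induction a rule: ordinal_induct)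
  case (step a)
  have "rank a \<epsilon> a \<or> rank a = a" by (rule rank_less) (use step in auto)
  moreover have "\<not> rank a \<epsilon> a"
    using step(2)[of "rank a"] rank_mem[of "rank a" a] by force
  ultimately show ?case by blast
qed (intro dfn)

lemma ordinal_mem_Vset: "ordinal a \<Longrightarrow> ordinal b \<Longrightarrow> b \<epsilon> Vset a \<longleftrightarrow> b \<epsilon> a"
  by (simp add: mem_Vset_rank rank_ordinal)

lemma rank_induct:
  assumes "definable UNIV (\<lambda>e. P (e 0))" "\<And>x. (\<And>y. y \<epsilon> Vset (rank x) \<Longrightarrow> P y) \<Longrightarrow> P x"
  shows "P x"
proof -
  have "\<forall>x. rank x = r \<longrightarrow> P x" if "ordinal r" for r
    using that
  proof (induction r rule: ordinal_induct)
    case (step r)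
    have "P x" if "rank x = r" for x
      by (rule assms(2)) (use step that in \<open>auto simp: mem_Vset_rank\<close>)
    then show ?case by blast
  qed (intro dfn definable_pred1[where R = P, OF assms(1)])
  with rank(1) show ?thesis by blast
qed

text \<open>
  Recursion along rank rather than membership gives access to all sets of smaller rank, in
  particular to the components of pairs, which lie several memberships deep.
\<close>

lemma rank_recursion:
  assumes G: "defterm UNIV (\<lambda>e. G (e 0) (e 1))"
  obtains H where "defterm UNIV (\<lambda>e. H (e 0))" "\<And>x. H x = G x (vlam (Vset (rank x)) H)"
proof -
  note * = that
  show thesis
  proof (rule wf_recursion[where ext = "\<lambda>x. Vset (rank x)" and G = G])
  show "defterm UNIV (\<lambda>e. Vset (rank (e 0)))" by (intro dfn)
  show "y \<epsilon> Vset (rank x) \<Longrightarrow> z \<epsilon> Vset (rank y) \<Longrightarrow> z \<epsilon> Vset (rank x)" for x y z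
    by (metis mem_Vset_rank rank(1) ordinal_trans)
  show "defterm UNIV (\<lambda>e. G (e 0) (e 1))" by (rule G)
  show "P x" if "definable UNIV (\<lambda>e. P (e 0))" "\<And>x. (\<And>y. y \<epsilon> Vset (rank x) \<Longrightarrow> P y) \<Longrightarrow> P x" for P x
    using that by (rule rank_induct)
  show thesis if "defterm UNIV (\<lambda>e. H (e 0))" "\<And>x. H x = G x (vlam (Vset (rank x)) H)" for H
    by (rule *[OF that])
  qed
qed

end

section \<open>Reflection\<close>

primrec var_bound :: "fm \<Rightarrow> nat" where
  "var_bound (Mem i j) = Suc (max i j)"
| "var_bound (Eq i j) = Suc (max i j)"
| "var_bound (Nand p q) = max (var_bound p) (var_bound q)"
| "var_bound (Forall i p) = var_bound p"

context set_structure
begin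

text \<open>
  Satisfaction in the substructure \<open>M\<close> of a formula of the metatheory.
\<close>

primrec sat_in :: "'v \<Rightarrow> (nat \<Rightarrow> 'v) \<Rightarrow> fm \<Rightarrow> bool" where
  "sat_in M e (Mem i j) \<longleftrightarrow> e i \<epsilon> e j"
| "sat_in M e (Eq i j) \<longleftrightarrow> e i = e j"
| "sat_in M e (Nand p q) \<longleftrightarrow> \<not> (sat_in M e p \<and> sat_in M e q)"
| "sat_in M e (Forall i p) \<longleftrightarrow> (\<forall>x. x \<epsilon> M \<longrightarrow> sat_in M (e(i := x)) p)"

lemma sat_cong_below:
  "(\<And>k. k < var_bound p \<Longrightarrow> e k = e' k) \<Longrightarrow> sat e p \<longleftrightarrow> sat e' p"
proof (induction p arbitrary: e e')
  case (Forall i p)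
  have "sat (e(i := x)) p \<longleftrightarrow> sat (e'(i := x)) p" for x
    by (rule Forall.IH) (use Forall.prems in auto)
  then show ?case by simp
next
  case (Nand p q)
  from Nand.IH[of e e'] Nand.prems show ?case by simp
qed auto

end

context ZFC_model
begin

lemma limit_ordinal: "limit_ordinal d \<Longrightarrow> ordinal d" "limit_ordinal d \<Longrightarrow> a \<epsilon> d \<Longrightarrow> vsucc a \<epsilon> d"
  unfolding limit_ordinal_iff by blast+

lemma limit_vempty: "limit_ordinal d \<Longrightarrow> vempty \<epsilon> d"
  unfolding limit_ordinal_iff by (metis mem_vempty ordinal_linear ordinal_vempty)

lemma ordinal_upper:
  assumes "ordinal d" "a \<epsilon> d" "b \<epsilon> d"
  obtains c where "c \<epsilon> d" "a \<epsilon> c \<or> a = c" "b \<epsilon> c \<or> b = c"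
  using assms ordinal_linear[of a b] ordinal_mem by metis

lemma Vset_vpair:
  assumes d: "limit_ordinal d" and "x \<epsilon> Vset d" "y \<epsilon> Vset d"
  shows "vpair x y \<epsilon> Vset d"
proof -
  from assms have xy: "rank x \<epsilon> d" "rank y \<epsilon> d" by (simp_all add: mem_Vset_rank limit_ordinal)
  then obtain c where c: "c \<epsilon> d" "rank x \<epsilon> c \<or> rank x = c" "rank y \<epsilon> c \<or> rank y = c"
    using ordinal_upper[OF limit_ordinal(1)[OF d]] by metis
  then have "ordinal (vsucc c)" using d limit_ordinal ordinal_mem ordinal_vsucc by blast
  then have "sub (vpair x y) (Vset (vsucc c))"
    using c unfolding sub_def by (auto simp: mem_Vset_rank)
  moreover have "vsucc c \<epsilon> d" using d c limit_ordinal by blast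
  ultimately show ?thesis using d limit_ordinal mem_Vset by blast
qed

lemma Vset_opair: "limit_ordinal d \<Longrightarrow> x \<epsilon> Vset d \<Longrightarrow> y \<epsilon> Vset d \<Longrightarrow> opair x y \<epsilon> Vset d"
  unfolding opair_def by (intro Vset_vpair)

lemma Vset_vempty: "limit_ordinal d \<Longrightarrow> vempty \<epsilon> Vset d"
  by (simp add: ordinal_mem_Vset limit_ordinal limit_vempty)

text \<open>
  Any witness function obeys the recursion equation of \<open>Vset\<close> on all of \<open>\<zeta> + 1\<close>, hence agrees
  with it by induction.
\<close>

lemma is_V_iff: "is_V \<zeta> v \<longleftrightarrow> ordinal \<zeta> \<and> v = Vset \<zeta>"
proof
  assume "is_V \<zeta> v"
  then obtain f r where z: "ordinal \<zeta>" and f: "is_function f (vsucc \<zeta>) r"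
    and rec: "\<And>a y x. opair a y \<epsilon> f \<Longrightarrow> x \<epsilon> y \<longleftrightarrow> (\<exists>b z. b \<epsilon> a \<and> opair b z \<epsilon> f \<and> sub x z)"
    and v: "opair \<zeta> v \<epsilon> f"
    unfolding is_V_def is_succ_iff rel_iff by blast
  have "\<forall>y. opair a y \<epsilon> f \<longrightarrow> y = Vset a" if "ordinal a" for a
    using that
  proof (induction a rule: ordinal_induct)
    case (step a)
    have "y = Vset a" if y: "opair a y \<epsilon> f" for y
    proof (rule set_eqI)
      fix x
      have a: "a \<epsilon> vsucc \<zeta>" using y f fun_opair by blast
      have "opair b (Vset b) \<epsilon> f" if "b \<epsilon> a" for b
      proof -
        have "b \<epsilon> vsucc \<zeta>" using a that z ordinal_trans ordinal_vsucc by blast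
        then have "opair b (vapp f b) \<epsilon> f" using f fun_opair by blast
        with step(2)[OF that] show ?thesis by simp
      qed
      then show "x \<epsilon> y \<longleftrightarrow> x \<epsilon> Vset a"
        unfolding rec[OF y] mem_Vset[OF step(1)] using step(2) by metis
    qed
    then show ?case by blast
  qed (intro dfn)
  with z v show "ordinal \<zeta> \<and> v = Vset \<zeta>" by blast
next
  assume z: "ordinal \<zeta> \<and> v = Vset \<zeta>"
  have d: "defterm UNIV (\<lambda>e. Vset (e 0))" by (intro dfn)
  have "is_function (vlam (vsucc \<zeta>) Vset) (vsucc \<zeta>) (vimg (vsucc \<zeta>) Vset)"
    by (rule is_function_vlam[OF d]) (use mem_vimg[OF d] in blast)
  moreover have "x \<epsilon> y \<longleftrightarrow> (\<exists>b z. b \<epsilon> a \<and> opair b z \<epsilon> vlam (vsucc \<zeta>) Vset \<and> sub x z)"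
    if "opair a y \<epsilon> vlam (vsucc \<zeta>) Vset" for a y x
  proof -
    from that have a: "a \<epsilon> vsucc \<zeta>" "y = Vset a" unfolding opair_mem_vlam[OF d] by blast+
    with z have "ordinal a" using ordinal_mem ordinal_vsucc by blast
    moreover have "b \<epsilon> vsucc \<zeta>" if "b \<epsilon> a" for b using that a(1) z ordinal_trans ordinal_vsucc by blast
    ultimately show ?thesis unfolding a(2) opair_mem_vlam[OF d] using mem_Vset by metis
  qed
  moreover have "opair \<zeta> v \<epsilon> vlam (vsucc \<zeta>) Vset" using z by (simp add: opair_mem_vlam[OF d])
  ultimately show "is_V \<zeta> v" unfolding is_V_def is_succ_iff rel_iff using z by blast
qed

definition vfst :: "'v \<Rightarrow> 'v" where "vfst z = setof (\<lambda>x. \<exists>a b. z = opair a b \<and> x \<epsilon> a)"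
definition vsnd :: "'v \<Rightarrow> 'v" where "vsnd z = setof (\<lambda>x. \<exists>a b. z = opair a b \<and> x \<epsilon> b)"

lemma defterm_vfst [dfn]: "defterm A t \<Longrightarrow> defterm A (\<lambda>e. vfst (t e))"
  by (rule defterm_fun1[where F = vfst, rotated]) (assumption+, unfold vfst_def, intro dfn)
lemma defterm_vsnd [dfn]: "defterm A t \<Longrightarrow> defterm A (\<lambda>e. vsnd (t e))"
  by (rule defterm_fun1[where F = vsnd, rotated]) (assumption+, unfold vsnd_def, intro dfn)

lemma vfst_opair [simp]: "vfst (opair a b) = a" unfolding vfst_def by (rule setof_eqI) auto
lemma vsnd_opair [simp]: "vsnd (opair a b) = b" unfolding vsnd_def by (rule setof_eqI) auto

text \<open>
  A finite environment is coded by one set, so that a quantifier over the parameters of a formula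
  is a single quantifier of the model.
\<close>

primrec encode_env :: "nat \<Rightarrow> (nat \<Rightarrow> 'v) \<Rightarrow> 'v" where
  "encode_env 0 e = vempty"
| "encode_env (Suc n) e = opair (e 0) (encode_env n (\<lambda>i. e (Suc i)))"

primrec decode_env :: "nat \<Rightarrow> 'v \<Rightarrow> nat \<Rightarrow> 'v" where
  "decode_env 0 z = (\<lambda>_. vempty)"
| "decode_env (Suc n) z = case_nat (vfst z) (decode_env n (vsnd z))"

lemma decode_env_encode_env: "k < n \<Longrightarrow> decode_env n (encode_env n e) k = e k"
  by (induction n arbitrary: e k) (auto split: nat.splits)

lemma defterm_decode_env [dfn]: "defterm A t \<Longrightarrow> defterm A (\<lambda>e. decode_env n (t e) k)"
proof (induction n arbitrary: t k)
  case (Suc n)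
  have "defterm A (\<lambda>e. vfst (t e))" "defterm A (\<lambda>e. decode_env n (vsnd (t e)) k)" for k
    by (intro dfn Suc)+
  then show ?case by (cases k) auto
qed (auto intro: dfn)

lemma encode_env_mem_Vset: "limit_ordinal d \<Longrightarrow> (\<And>i. e i \<epsilon> Vset d) \<Longrightarrow> encode_env n e \<epsilon> Vset d"
  by (induction n arbitrary: e) (auto intro: Vset_opair Vset_vempty)

text \<open>
  For each \<open>z\<close> only the least level of the hierarchy that contains a witness is used, so that
  replacement bounds these levels.
\<close>

lemma collection:
  assumes "definable UNIV (\<lambda>e. R (e 0) (e 1))"
  shows "\<exists>c. ordinal c \<and> (\<forall>z. z \<epsilon> a \<longrightarrow> (\<exists>x. R z x) \<longrightarrow> (\<exists>x. x \<epsilon> Vset c \<and> R z x))"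
proof -
  note R = definable_pred2[where R = R, OF assms]
  define F where "F z = least_ord (\<lambda>b. \<exists>x. x \<epsilon> Vset b \<and> R z x)" for z
  have F: "ordinal (F z)" "\<exists>x. x \<epsilon> Vset (F z) \<and> R z x" if "R z x" for z x
  proof -
    have "x \<epsilon> Vset (vsucc (rank x))" "ordinal (vsucc (rank x))" by (simp_all add: mem_Vset_rank rank)
    moreover have "definable UNIV (\<lambda>e. \<exists>x. x \<epsilon> Vset (e 0) \<and> R z x)" by (intro dfn R)
    ultimately show "ordinal (F z)" "\<exists>x. x \<epsilon> Vset (F z) \<and> R z x"
      unfolding F_def using that least_ord[where P = "\<lambda>b. \<exists>x. x \<epsilon> Vset b \<and> R z x"] by blast+
  qed
  define a' where "a' = sep a (\<lambda>z. \<exists>x. R z x)"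
  have a': "z \<epsilon> a' \<longleftrightarrow> z \<epsilon> a \<and> (\<exists>x. R z x)" for z
    unfolding a'_def by (rule mem_sep) (intro dfn R)
  have d: "defterm UNIV (\<lambda>e. vsucc (F (e 0)))" unfolding F_def by (intro dfn R)
  define c where "c = vUnion (vimg a' (\<lambda>z. vsucc (F z)))"
  have c: "b \<epsilon> c \<longleftrightarrow> (\<exists>z. z \<epsilon> a' \<and> b \<epsilon> vsucc (F z))" for b
    unfolding c_def mem_vUnion mem_vimg[OF d] by blast
  have oc: "ordinal c" unfolding c_def
    by (rule ordinal_vUnion) (use F a' mem_vimg[OF d] ordinal_vsucc in metis)
  moreover have "\<exists>x. x \<epsilon> Vset c \<and> R z x" if "z \<epsilon> a" "R z x" for z x
  proof -
    have "z \<epsilon> a'" using that a' by blast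
    then have "F z \<epsilon> c" unfolding c by auto
    then show ?thesis using F(2)[OF that(2)] Vset_mono[OF oc, of "F z"] subD by blast
  qed
  ultimately show ?thesis by blast
qed

text \<open>
  A relational version of a class function on the ordinals: \<open>B a b\<close> says that \<open>b\<close> bounds the value
  at \<open>a\<close>. The monotonicity makes bounding relations closed under conjunction, so that closing off
  under several requirements is a single iteration.
\<close>

definition bounding :: "('v \<Rightarrow> 'v \<Rightarrow> bool) \<Rightarrow> bool" where
  "bounding B \<longleftrightarrow> definable UNIV (\<lambda>e. B (e 0) (e 1)) \<and>
     (\<forall>a a' b b'. ordinal a \<and> ordinal a' \<and> ordinal b \<and> ordinal b' \<and>
        B a b \<and> sub a' a \<and> sub b b' \<longrightarrow> B a' b') \<and>
     (\<forall>a. ordinal a \<longrightarrow> (\<exists>b. ordinal b \<and> B a b))"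

definition closed_under :: "('v \<Rightarrow> 'v \<Rightarrow> bool) \<Rightarrow> 'v \<Rightarrow> bool" where
  "closed_under B d \<longleftrightarrow> (\<forall>a. a \<epsilon> d \<longrightarrow> (\<exists>b. b \<epsilon> d \<and> B a b))"

lemma bounding_conj:
  assumes "bounding B" "bounding B'"
  shows "bounding (\<lambda>a b. B a b \<and> B' a b)"
  unfolding bounding_def
proof (intro conjI allI impI)
  show "definable UNIV (\<lambda>e. B (e 0) (e 1) \<and> B' (e 0) (e 1))"
    using assms unfolding bounding_def by (intro definable_conj) blast+
  fix a assume a: "ordinal a"
  obtain b where b: "ordinal b" "B a b" using assms(1) a unfolding bounding_def by blast
  obtain b' where b': "ordinal b'" "B' a b'" using assms(2) a unfolding bounding_def by blast
  have "sub b b' \<or> sub b' b" using b b' ordinal_linear ordinal_sub by blast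
  then show "\<exists>b. ordinal b \<and> B a b \<and> B' a b"
  proof
    assume "sub b b'"
    with assms(1) a b b' have "B a b'" unfolding bounding_def using sub_refl by blast
    with b' show ?thesis by blast
  next
    assume "sub b' b"
    with assms(2) a b b' have "B' a b" unfolding bounding_def using sub_refl by blast
    with b show ?thesis by blast
  qed
next
  fix a a' b b'
  assume *: "ordinal a \<and> ordinal a' \<and> ordinal b \<and> ordinal b' \<and>
    (B a b \<and> B' a b) \<and> sub a' a \<and> sub b b'"
  then show "B a' b'" using assms(1) unfolding bounding_def by blast
  from * show "B' a' b'" using assms(2) unfolding bounding_def by blast
qed

text \<open>
  Iterate \<open>a \<mapsto>\<close> least strict bound \<open>\<omega>\<close> times and take the supremum.
\<close>

lemma closed_limit_exists:
  assumes B: "bounding B" and a: "ordinal a"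
  shows "\<exists>d. limit_ordinal d \<and> a \<epsilon> d \<and> closed_under B d"
proof -
  have dB: "definable UNIV (\<lambda>e. B (e 0) (e 1))"
    and mono: "\<And>a a' b b'. ordinal a \<Longrightarrow> ordinal a' \<Longrightarrow> ordinal b \<Longrightarrow> ordinal b' \<Longrightarrow>
      B a b \<Longrightarrow> sub a' a \<Longrightarrow> sub b b' \<Longrightarrow> B a' b'"
    and ex: "\<And>a. ordinal a \<Longrightarrow> \<exists>b. ordinal b \<and> B a b"
    using B unfolding bounding_def by blast+
  note dB' = definable_pred2[where R = B, OF dB]
  \<comment> \<open>The strict inequality makes the supremum a limit.\<close>
  define nx where "nx b = least_ord (\<lambda>c. b \<epsilon> c \<and> B b c)" for b
  have nx: "ordinal (nx b)" "b \<epsilon> nx b" "B b (nx b)" if b: "ordinal b" for b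
  proof -
    from ex[OF b] obtain c where c: "ordinal c" "B b c" by blast
    have "\<exists>c. ordinal c \<and> b \<epsilon> c \<and> B b c"
    proof (cases "b \<epsilon> c")
      case False
      then have "sub c (vsucc b)"
        using b c ordinal_linear[of b c] ordinal_sub[of c "vsucc b"] by auto
      with b c mono[of b b c "vsucc b"] show ?thesis by (intro exI[of _ "vsucc b"]) simp
    qed (use c in blast)
    then obtain c where "ordinal c" "b \<epsilon> c \<and> B b c" by blast
    moreover have "definable UNIV (\<lambda>e. b \<epsilon> e 0 \<and> B b (e 0))" by (intro dfn dB')
    ultimately show "ordinal (nx b)" "b \<epsilon> nx b" "B b (nx b)"
      unfolding nx_def using least_ord[where P = "\<lambda>c. b \<epsilon> c \<and> B b c"] by blast+
  qed
  have dnx: "defterm UNIV (\<lambda>e. nx (e 0))" unfolding nx_def by (intro dfn dB')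
  note dnx' = defterm_fun1[where F = nx, OF dnx]
  have "defterm UNIV (\<lambda>e. vunion a (vUnion (vimg (e 0) (\<lambda>n. nx (vapp (e 1) n)))))"
    by (intro dfn dnx')
  from ordinal_recursion[OF this] obtain H where
    H: "defterm UNIV (\<lambda>e. H (e 0))"
    "\<And>b. ordinal b \<Longrightarrow> H b = vunion a (vUnion (vimg b (\<lambda>n. nx (vapp (vlam b H) n))))" by blast
  have dH: "defterm UNIV (\<lambda>e. nx (H (e 0)))" by (intro dnx' H(1))
  have "vimg b (\<lambda>n. nx (vapp (vlam b H) n)) = vimg b (\<lambda>n. nx (H n))" for b
    by (rule vimg_cong) (simp add: vapp_vlam[OF H(1)])
  with H(2) have Heq: "H b = vunion a (vUnion (vimg b (\<lambda>n. nx (H n))))" if "ordinal b" for b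
    using that by metis
  have mem: "y \<epsilon> H b \<longleftrightarrow> y \<epsilon> a \<or> (\<exists>n. n \<epsilon> b \<and> y \<epsilon> nx (H n))" if "ordinal b" for b y
    unfolding Heq[OF that] mem_vunion mem_vUnion mem_vimg[OF dH] by blast
  have oH: "ordinal (H b)" if "ordinal b" for b
    using that
  proof (induction b rule: ordinal_induct)
    case (step b)
    have "H b = vUnion (vunion (vpair a a) (vimg b (\<lambda>n. nx (H n))))"
      by (rule set_eqI) (unfold mem[OF step(1)] mem_vUnion mem_vunion mem_vpair mem_vimg[OF dH], blast)
    also have "ordinal \<dots>"
      by (rule ordinal_vUnion) (unfold mem_vunion mem_vpair mem_vimg[OF dH], use a step nx in blast)
    finally show ?case .
  qed (intro dfn definable_pred1[where R = ordinal] H(1))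
  define d where "d = vUnion (vimg omega H)"
  have d: "y \<epsilon> d \<longleftrightarrow> (\<exists>n. n \<epsilon> omega \<and> y \<epsilon> H n)" for y
    unfolding d_def mem_vUnion mem_vimg[OF H(1)] by blast
  have od: "ordinal d" unfolding d_def
    by (rule ordinal_vUnion) (use oH omega_ordinal mem_vimg[OF H(1)] in metis)
  have Hd: "H n \<epsilon> d" "B (H n) (nx (H n))" "nx (H n) \<epsilon> d" if n: "n \<epsilon> omega" for n
  proof -
    have o: "ordinal (H n)" "ordinal (H (vsucc n))" using oH omega_ordinal n omega_vsucc by blast+
    have s: "sub (nx (H n)) (H (vsucc n))"
      unfolding sub_def using mem[of "vsucc n"] omega_ordinal n omega_vsucc mem_vsucc by blast
    from o nx show "B (H n) (nx (H n))" by blast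
    have HS: "H m \<epsilon> d" if "m \<epsilon> omega" for m
    proof -
      have "H m \<epsilon> nx (H m)" using oH omega_ordinal that nx by blast
      then have "H m \<epsilon> H (vsucc m)" using mem[of "vsucc m"] omega_ordinal that omega_vsucc mem_vsucc by blast
      with that show ?thesis unfolding d using omega_vsucc by blast
    qed
    show "H n \<epsilon> d" using HS n .
    have "nx (H n) \<epsilon> H (vsucc n) \<or> nx (H n) = H (vsucc n)"
      using s o nx ordinal_sub by blast
    with HS[of "vsucc n"] n od show "nx (H n) \<epsilon> d" using omega_vsucc ordinal_trans by metis
  qed
  have "vsucc x \<epsilon> d" if x: "x \<epsilon> d" for x
  proof -
    from x d obtain n where n: "n \<epsilon> omega" "x \<epsilon> H n" by blast
    have "vsucc x \<epsilon> vsucc (H n)" using n oH omega_ordinal ordinal_vsucc_mono by blast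
    then have "vsucc x \<epsilon> H n \<or> vsucc x = H n" unfolding mem_vsucc .
    then show ?thesis using Hd(1)[OF n(1)] od ordinal_trans by metis
  qed
  moreover have "a \<epsilon> d"
  proof -
    have "H vempty = a" by (rule set_eqI) (simp add: mem)
    with Hd(1)[OF omega_vempty] show ?thesis by simp
  qed
  moreover have "closed_under B d" unfolding closed_under_def
  proof (intro allI impI)
    fix x assume x: "x \<epsilon> d"
    then obtain n where n: "n \<epsilon> omega" "x \<epsilon> H n" using d by blast
    have o: "ordinal (H n)" "ordinal x" "ordinal (nx (H n))"
      using n oH omega_ordinal x od ordinal_mem nx by blast+
    then have "sub x (H n)" using n ordinal_sub by blast
    with o Hd(2)[OF n(1)] mono sub_refl have "B x (nx (H n))" by blast
    with Hd(3)[OF n(1)] show "\<exists>b. b \<epsilon> d \<and> B x b" by blast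
  qed
  ultimately show ?thesis using od unfolding limit_ordinal_iff by (metis mem_vempty)
qed

text \<open>
  Levy's reflection theorem. By induction on the formula; only a quantifier asks for something new,
  namely that \<open>d\<close> is closed under bounds for the least ranks of counterexamples, over all coded
  parameters.
\<close>

theorem reflection:
  "\<exists>B. bounding B \<and> (\<forall>d e. limit_ordinal d \<and> closed_under B d \<and> (\<forall>i. e i \<epsilon> Vset d) \<longrightarrow>
     (sat_in (Vset d) e p \<longleftrightarrow> sat e p))"
proof (induction p)
  case (Nand p q)
  then obtain B B' where B: "bounding B" "bounding B'"
    "\<And>d e. limit_ordinal d \<Longrightarrow> closed_under B d \<Longrightarrow> (\<forall>i. e i \<epsilon> Vset d) \<Longrightarrow>
      sat_in (Vset d) e p \<longleftrightarrow> sat e p"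
    "\<And>d e. limit_ordinal d \<Longrightarrow> closed_under B' d \<Longrightarrow> (\<forall>i. e i \<epsilon> Vset d) \<Longrightarrow>
      sat_in (Vset d) e q \<longleftrightarrow> sat e q"
    by blast
  have "closed_under B d \<and> closed_under B' d" if "closed_under (\<lambda>a b. B a b \<and> B' a b) d" for d
    using that unfolding closed_under_def by blast
  with B(3,4) have "sat_in (Vset d) e (Nand p q) \<longleftrightarrow> sat e (Nand p q)"
    if "limit_ordinal d" "closed_under (\<lambda>a b. B a b \<and> B' a b) d" "\<forall>i. e i \<epsilon> Vset d" for d e
    using that by simp
  with bounding_conj[OF B(1,2)] show ?case by blast
next
  case (Forall i p)
  then obtain B where B: "bounding B"
    "\<And>d e. limit_ordinal d \<Longrightarrow> closed_under B d \<Longrightarrow> (\<forall>i. e i \<epsilon> Vset d) \<Longrightarrow>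
      sat_in (Vset d) e p \<longleftrightarrow> sat e p"
    by blast
  define n where "n = var_bound p"
  define R where "R z x \<longleftrightarrow> \<not> sat (\<lambda>k. if k = i then x else decode_env n z k) p" for z x
  have dR: "definable UNIV (\<lambda>e. R (e 0) (e 1))" unfolding R_def
  proof (intro definable_not definable_sat)
    show "defterm UNIV (\<lambda>e. if k = i then e 1 else decode_env n (e 0) k)" for k
      by (cases "k = i") (auto intro: dfn)
  qed
  note dR' = definable_pred2[where R = R, OF dR]
  have R_encode_env: "R (encode_env n e) x \<longleftrightarrow> \<not> sat (e(i := x)) p" for e x
  proof -
    have "sat (\<lambda>k. if k = i then x else decode_env n (encode_env n e) k) p \<longleftrightarrow> sat (e(i := x)) p"
      by (rule sat_cong_below) (simp add: decode_env_encode_env n_def)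
    then show ?thesis by (simp add: R_def)
  qed
  define W where "W a b \<longleftrightarrow> (\<forall>z. z \<epsilon> Vset a \<longrightarrow> (\<exists>x. R z x) \<longrightarrow> (\<exists>x. x \<epsilon> Vset b \<and> R z x))" for a b
  have "bounding W"
    unfolding bounding_def
  proof (intro conjI allI impI)
    show "definable UNIV (\<lambda>e. W (e 0) (e 1))" unfolding W_def by (intro dfn dR')
    show "\<exists>b. ordinal b \<and> W a b" for a unfolding W_def by (rule collection[OF dR])
    fix a a' b b'
    assume *: "ordinal a \<and> ordinal a' \<and> ordinal b \<and> ordinal b' \<and> W a b \<and> sub a' a \<and> sub b b'"
    then have "sub (Vset a') (Vset a)" "sub (Vset b) (Vset b')"
      using Vset_mono ordinal_sub by blast+
    with * show "W a' b'" unfolding W_def sub_def by blast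
  qed
  note bB = bounding_conj[OF B(1) this]
  have "sat_in (Vset d) e (Forall i p) \<longleftrightarrow> sat e (Forall i p)"
    if d: "limit_ordinal d" "closed_under (\<lambda>a b. B a b \<and> W a b) d" and e: "\<forall>i. e i \<epsilon> Vset d" for d e
  proof -
    from d have cB: "closed_under B d" and cW: "closed_under W d" unfolding closed_under_def by blast+
    have "sat_in (Vset d) (e(i := x)) p \<longleftrightarrow> sat (e(i := x)) p" if "x \<epsilon> Vset d" for x
      by (rule B(2)[OF d(1) cB]) (use e that in simp)
    moreover have "\<exists>x. x \<epsilon> Vset d \<and> \<not> sat (e(i := x)) p" if x: "\<not> sat (e(i := x)) p" for x
    proof -
      have "encode_env n e \<epsilon> Vset d" using d(1) e by (intro encode_env_mem_Vset) auto
      then have "rank (encode_env n e) \<epsilon> d" using d(1) limit_ordinal mem_Vset_rank by blast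
      then have s: "vsucc (rank (encode_env n e)) \<epsilon> d" using d(1) limit_ordinal by blast
      with cW obtain b where b: "b \<epsilon> d" "W (vsucc (rank (encode_env n e))) b"
        unfolding closed_under_def by blast
      have "encode_env n e \<epsilon> Vset (vsucc (rank (encode_env n e)))" by (simp add: mem_Vset_rank rank)
      with b(2) x obtain y where "y \<epsilon> Vset b" "R (encode_env n e) y"
        unfolding W_def using R_encode_env by blast
      moreover have "sub (Vset b) (Vset d)" using b(1) d(1) limit_ordinal Vset_mono by blast
      ultimately show ?thesis using R_encode_env subD by blast
    qed
    ultimately show ?thesis by auto
  qed
  with bB show ?case by blast
qed (rule exI[of _ "\<lambda>_ _. True"], auto simp: bounding_def intro!: dfn ordinal_vempty)+

section \<open>Formulas inside the model\<close>

primrec vnum :: "nat \<Rightarrow> 'v" where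
  "vnum 0 = vempty"
| "vnum (Suc k) = vsucc (vnum k)"

lemma is_num_iff [simp]: "is_num k x \<longleftrightarrow> x = vnum k"
  by (induction k arbitrary: x) simp_all

lemma vnum_omega [simp]: "vnum k \<epsilon> omega"
  by (induction k) simp_all

lemma vnum_eq [simp]: "vnum i = vnum j \<longleftrightarrow> i = j"
proof (induction i arbitrary: j)
  case 0 then show ?case by (cases j) (simp_all add: vsucc_neq(1)[symmetric])
next
  case (Suc i) then show ?case by (cases j) simp_all
qed

definition fnode :: "nat \<Rightarrow> 'v \<Rightarrow> 'v \<Rightarrow> 'v" where
  "fnode k a b = opair (vnum k) (opair a b)"

lemma is_node_iff [simp]: "is_node k a b c \<longleftrightarrow> c = fnode k a b"
  unfolding is_node_def fnode_def by simp

lemma fnode_eq [simp]: "fnode k a b = fnode l c d \<longleftrightarrow> k = l \<and> a = c \<and> b = d"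
  unfolding fnode_def by simp

lemma defterm_fnode [dfn]: "defterm UNIV t \<Longrightarrow> defterm UNIV u \<Longrightarrow> defterm UNIV (\<lambda>e. fnode k (t e) (u e))"
  by (rule defterm_fun2[where F = "fnode k", rotated]) (assumption+, unfold fnode_def, intro dfn)

lemma rank_opair: "rank a \<epsilon> rank (opair a b)" "rank b \<epsilon> rank (opair a b)"
proof -
  have "vpair a b \<epsilon> opair a b" "a \<epsilon> vpair a b" "b \<epsilon> vpair a b" by (simp_all add: opair_def)
  then show "rank a \<epsilon> rank (opair a b)" "rank b \<epsilon> rank (opair a b)"
    using rank_mem rank(1) ordinal_trans by metis+
qed

lemma rank_fnode: "rank a \<epsilon> rank (fnode k a b)" "rank b \<epsilon> rank (fnode k a b)"
  unfolding fnode_def using rank_opair ordinal_trans rank(1) by metis+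

lemma formula_closed_iff: "formula_closed S \<longleftrightarrow>
   (\<forall>a b. a \<epsilon> omega \<and> b \<epsilon> omega \<longrightarrow> fnode 0 a b \<epsilon> S \<and> fnode 1 a b \<epsilon> S) \<and>
   (\<forall>a b. a \<epsilon> S \<and> b \<epsilon> S \<longrightarrow> fnode 2 a b \<epsilon> S) \<and> (\<forall>a b. a \<epsilon> omega \<and> b \<epsilon> S \<longrightarrow> fnode 3 a b \<epsilon> S)"
  unfolding formula_closed_def is_node_iff natural_iff by blast

lemma omega_mem_Vset: "n \<epsilon> omega \<Longrightarrow> limit_ordinal d \<Longrightarrow> n \<epsilon> Vset d"
proof -
  assume n: "n \<epsilon> omega" and d: "limit_ordinal d"
  have "n \<epsilon> d" using n
  proof (induction n rule: omega_induct)
    case vempty show ?case by (rule limit_vempty[OF d])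
  next
    case (vsucc n) then show ?case using d limit_ordinal by blast
  qed (intro dfn)
  then show ?thesis using d limit_ordinal ordinal_mem_Vset ordinal_mem by blast
qed

lemma fnode_mem_Vset: "limit_ordinal d \<Longrightarrow> a \<epsilon> Vset d \<Longrightarrow> b \<epsilon> Vset d \<Longrightarrow> fnode k a b \<epsilon> Vset d"
  unfolding fnode_def by (intro Vset_opair omega_mem_Vset[OF vnum_omega])

text \<open>
  Level \<open>V\<^sub>d\<close> is closed under the formation of formulas, so \<open>formula\<close> describes a set.
\<close>

lemma formula_mem_Vset: "limit_ordinal d \<Longrightarrow> formula c \<Longrightarrow> c \<epsilon> Vset d"
proof -
  assume d: "limit_ordinal d" and c: "formula c"
  have "formula_closed (Vset d)"
    unfolding formula_closed_iff using fnode_mem_Vset[OF d] omega_mem_Vset[OF _ d] by blast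
  with c show "c \<epsilon> Vset d" unfolding formula_def by blast
qed

lemma formula_intros:
  "a \<epsilon> omega \<Longrightarrow> b \<epsilon> omega \<Longrightarrow> formula (fnode 0 a b)"
  "a \<epsilon> omega \<Longrightarrow> b \<epsilon> omega \<Longrightarrow> formula (fnode 1 a b)"
  "formula a \<Longrightarrow> formula b \<Longrightarrow> formula (fnode 2 a b)"
  "a \<epsilon> omega \<Longrightarrow> formula b \<Longrightarrow> formula (fnode 3 a b)"
  unfolding formula_def formula_closed_iff by blast+

definition formulas :: 'v where "formulas = sep (Vset omega) formula"

lemma mem_formulas [simp]: "c \<epsilon> formulas \<longleftrightarrow> formula c"
  unfolding formulas_def by (subst mem_sep) (intro dfn, use formula_mem_Vset[OF limit_omega] in blast)

text \<open>
  Separation turns the predicate into a set closed under the formation of formulas.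
\<close>

lemma formula_induct [consumes 1, case_names def mem eq nand all]:
  assumes c: "formula c" and P: "definable UNIV (\<lambda>e. P (e 0))"
    and "\<And>a b. a \<epsilon> omega \<Longrightarrow> b \<epsilon> omega \<Longrightarrow> P (fnode 0 a b)"
    and "\<And>a b. a \<epsilon> omega \<Longrightarrow> b \<epsilon> omega \<Longrightarrow> P (fnode 1 a b)"
    and "\<And>a b. formula a \<Longrightarrow> formula b \<Longrightarrow> P a \<Longrightarrow> P b \<Longrightarrow> P (fnode 2 a b)"
    and "\<And>a b. a \<epsilon> omega \<Longrightarrow> formula b \<Longrightarrow> P b \<Longrightarrow> P (fnode 3 a b)"
  shows "P c"
proof -
  have S: "x \<epsilon> sep formulas P \<longleftrightarrow> formula x \<and> P x" for x
    by (subst mem_sep[OF P]) simp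
  have "formula_closed (sep formulas P)"
    unfolding formula_closed_iff S
    by (intro conjI allI impI; elim conjE; rule formula_intros assms(3-6); assumption)
  with c S show ?thesis unfolding formula_def by blast
qed

primrec code :: "fm \<Rightarrow> 'v" where
  "code (Mem i j) = fnode 0 (vnum i) (vnum j)"
| "code (Eq i j) = fnode 1 (vnum i) (vnum j)"
| "code (Nand p q) = fnode 2 (code p) (code q)"
| "code (Forall i p) = fnode 3 (vnum i) (code p)"

lemma formula_code: "formula (code p)"
  by (induction p) (auto intro: formula_intros simp del: One_nat_def)

section \<open>Satisfaction inside the model\<close>

lemma assignment_iff [simp]: "assignment s X \<longleftrightarrow> is_function s omega X"
  unfolding assignment_def by simp

definition update :: "'v \<Rightarrow> 'v \<Rightarrow> 'v \<Rightarrow> 'v" where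
  "update s i x = vlam omega (\<lambda>k. if k = i then x else vapp s k)"

lemma defterm_update [dfn]:
  "defterm UNIV t \<Longrightarrow> defterm UNIV u \<Longrightarrow> defterm UNIV v \<Longrightarrow> defterm UNIV (\<lambda>e. update (t e) (u e) (v e))"
  by (rule defterm_fun3[where F = update, rotated]) (assumption+, unfold update_def, intro dfn)

lemma update_aux: "defterm UNIV (\<lambda>e. if e 0 = i then x else vapp s (e 0))"
  by (intro dfn)

lemma vapp_update: "k \<epsilon> omega \<Longrightarrow> vapp (update s i x) k = (if k = i then x else vapp s k)"
  unfolding update_def by (rule vapp_vlam[OF update_aux])

lemma update_fun: "is_function s omega X \<Longrightarrow> x \<epsilon> X \<Longrightarrow> is_function (update s i x) omega X"
  unfolding update_def by (rule is_function_vlam[OF update_aux]) (auto intro: fun_vapp)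

lemma is_update_iff:
  assumes s: "is_function s omega X" and t: "is_function t omega Y"
  shows "is_update t s i x \<longleftrightarrow> t = update s i x"
proof -
  have "is_update t s i x \<longleftrightarrow> (\<forall>k. k \<epsilon> omega \<longrightarrow> vapp t k = (if k = i then x else vapp s k))"
    unfolding is_update_def natural_iff rel_iff
    using fun_vapp(2)[OF s] fun_vapp(2)[OF t] by metis
  also have "\<dots> \<longleftrightarrow> t = update s i x"
  proof
    assume *: "\<forall>k. k \<epsilon> omega \<longrightarrow> vapp t k = (if k = i then x else vapp s k)"
    have "vlam omega (\<lambda>k. vapp t k) = update s i x"
      unfolding update_def by (rule vlam_cong) (use * in blast)
    moreover have "vlam omega (\<lambda>k. vapp t k) = t"
    proof (rule set_eqI)
      have d: "defterm UNIV (\<lambda>e. vapp t (e 0))" by (intro dfn)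
      show "z \<epsilon> vlam omega (\<lambda>k. vapp t k) \<longleftrightarrow> z \<epsilon> t" for z
        by (simp only: mem_vlam[OF d] fun_mem[OF t])
    qed
    ultimately show "t = update s i x" by simp
  qed (simp add: vapp_update)
  finally show ?thesis .
qed

text \<open>
  The Tarski clauses in functional form. An assignment is a total function on \<open>\<omega>\<close>, so its value
  at a variable and its update are unique.
\<close>

lemma satisfaction_relation_iff: "satisfaction_relation X T \<longleftrightarrow>
  (\<forall>s. is_function s omega X \<longrightarrow>
    (\<forall>a b. a \<epsilon> omega \<and> b \<epsilon> omega \<longrightarrow> (opair (fnode 0 a b) s \<epsilon> T \<longleftrightarrow> vapp s a \<epsilon> vapp s b)) \<and>
    (\<forall>a b. a \<epsilon> omega \<and> b \<epsilon> omega \<longrightarrow> (opair (fnode 1 a b) s \<epsilon> T \<longleftrightarrow> vapp s a = vapp s b)) \<and>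
    (\<forall>a b. formula a \<and> formula b \<longrightarrow>
      (opair (fnode 2 a b) s \<epsilon> T \<longleftrightarrow> \<not> (opair a s \<epsilon> T \<and> opair b s \<epsilon> T))) \<and>
    (\<forall>a b. a \<epsilon> omega \<and> formula b \<longrightarrow>
      (opair (fnode 3 a b) s \<epsilon> T \<longleftrightarrow> (\<forall>x. x \<epsilon> X \<longrightarrow> opair b (update s a x) \<epsilon> T))))"
proof -
  have 1: "(\<exists>x. opair a x \<epsilon> s \<and> (\<exists>y. opair b y \<epsilon> s \<and> x \<epsilon> y)) \<longleftrightarrow> vapp s a \<epsilon> vapp s b"
    and eq: "(\<exists>x. opair a x \<epsilon> s \<and> opair b x \<epsilon> s) \<longleftrightarrow> vapp s a = vapp s b"
    if "is_function s omega X" "a \<epsilon> omega" "b \<epsilon> omega" for s a b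
    using fun_vapp(2)[OF that(1)] that by metis+
  have 2: "(\<forall>x t. x \<epsilon> X \<and> is_function t omega X \<and> is_update t s a x \<longrightarrow> opair b t \<epsilon> T) \<longleftrightarrow>
      (\<forall>x. x \<epsilon> X \<longrightarrow> opair b (update s a x) \<epsilon> T)"
    if s: "is_function s omega X" for s a b
    using is_update_iff[OF s] update_fun[OF s] by metis
  have 3: "(\<forall>s a b c. is_function s omega X \<longrightarrow> Q s a b c) \<longleftrightarrow> (\<forall>s. is_function s omega X \<longrightarrow> (\<forall>a b c. Q s a b c))" for Q
    by blast
  show ?thesis
    unfolding satisfaction_relation_def assignment_iff natural_iff rel_iff is_node_iff 3
    by (rule all_cong) (simp add: 1 eq 2 all_conj_distrib del: One_nat_def)
qed

lemma satisfaction_clauses: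
  assumes "satisfaction_relation X T" "is_function s omega X"
  shows "a \<epsilon> omega \<Longrightarrow> b \<epsilon> omega \<Longrightarrow> opair (fnode 0 a b) s \<epsilon> T \<longleftrightarrow> vapp s a \<epsilon> vapp s b"
    "a \<epsilon> omega \<Longrightarrow> b \<epsilon> omega \<Longrightarrow> opair (fnode 1 a b) s \<epsilon> T \<longleftrightarrow> vapp s a = vapp s b"
    "formula a \<Longrightarrow> formula b \<Longrightarrow>
      opair (fnode 2 a b) s \<epsilon> T \<longleftrightarrow> \<not> (opair a s \<epsilon> T \<and> opair b s \<epsilon> T)"
    "a \<epsilon> omega \<Longrightarrow> formula b \<Longrightarrow>
      opair (fnode 3 a b) s \<epsilon> T \<longleftrightarrow> (\<forall>x. x \<epsilon> X \<longrightarrow> opair b (update s a x) \<epsilon> T)"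
  using assms unfolding satisfaction_relation_iff by blast+

definition assignments :: "'v \<Rightarrow> 'v" where
  "assignments X = sep (vPow (vUnion (vimg omega (\<lambda>k. vimg X (\<lambda>y. opair k y))))) (\<lambda>s. is_function s omega X)"

lemma mem_assignments [simp]: "s \<epsilon> assignments X \<longleftrightarrow> is_function s omega X"
proof -
  have d: "defterm UNIV (\<lambda>e. vimg X (\<lambda>y. opair (e 0) y))" by (intro dfn)
  have d': "defterm UNIV (\<lambda>e. opair k (e 0))" for k by (intro dfn)
  have "sub s (vUnion (vimg omega (\<lambda>k. vimg X (\<lambda>y. opair k y))))" if s: "is_function s omega X"
    unfolding sub_def mem_vUnion mem_vimg[OF d]
    using fun_mem[OF s] fun_vapp(1)[OF s] mem_vimg[OF d'] by metis
  moreover have "definable UNIV (\<lambda>e. is_function (e 0) omega X)" by (intro dfn)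
  ultimately show ?thesis unfolding assignments_def by (subst mem_sep) auto
qed

text \<open>
  Truth is defined by recursion on rank: \<open>H c\<close> is the set of assignments that satisfy \<open>c\<close>. A
  recursion in the metatheory would only reach standard formulas.
\<close>

lemma satisfaction_relation_exists: "\<exists>T. satisfaction_relation X T"
proof -
  define Cl where "Cl c f s \<longleftrightarrow>
      (\<exists>a b. a \<epsilon> omega \<and> b \<epsilon> omega \<and> c = fnode 0 a b \<and> vapp s a \<epsilon> vapp s b) \<or>
      (\<exists>a b. a \<epsilon> omega \<and> b \<epsilon> omega \<and> c = fnode 1 a b \<and> vapp s a = vapp s b) \<or>
      (\<exists>a b. c = fnode 2 a b \<and> \<not> (s \<epsilon> vapp f a \<and> s \<epsilon> vapp f b)) \<or>
      (\<exists>a b. c = fnode 3 a b \<and> (\<forall>x. x \<epsilon> X \<longrightarrow> update s a x \<epsilon> vapp f b))" for c f s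
  have dCl: "definable UNIV (\<lambda>e. Cl (e 0) (e 1) (e 2))"
    unfolding Cl_def by (intro dfn)
  note dCl' = definable_pred3[where R = Cl, OF dCl]
  have "defterm UNIV (\<lambda>e. sep (assignments X) (\<lambda>s. Cl (e 0) (e 1) s))"
    by (intro dfn dCl')
  from rank_recursion[OF this] obtain H where
    H: "defterm UNIV (\<lambda>e. H (e 0))"
    "\<And>c. H c = sep (assignments X) (\<lambda>s. Cl c (vlam (Vset (rank c)) H) s)" by blast
  have memH: "s \<epsilon> H c \<longleftrightarrow> is_function s omega X \<and> Cl c (vlam (Vset (rank c)) H) s" for s c
  proof -
    have "definable UNIV (\<lambda>e. Cl c (vlam (Vset (rank c)) H) (e 0))" by (intro dCl' dfn)
    then show ?thesis by (subst H(2)) (simp add: mem_sep)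
  qed
  have H_fnode: "vapp (vlam (Vset (rank (fnode k a b))) H) a = H a" "vapp (vlam (Vset (rank (fnode k a b))) H) b = H b"
    for k a b
    by (intro vapp_vlam[OF H(1)]; simp add: mem_Vset_rank rank rank_fnode)+
  have cl: "s \<epsilon> H (fnode 0 a b) \<longleftrightarrow> is_function s omega X \<and> a \<epsilon> omega \<and> b \<epsilon> omega \<and> vapp s a \<epsilon> vapp s b"
    "s \<epsilon> H (fnode 1 a b) \<longleftrightarrow> is_function s omega X \<and> a \<epsilon> omega \<and> b \<epsilon> omega \<and> vapp s a = vapp s b"
    "s \<epsilon> H (fnode 2 a b) \<longleftrightarrow> is_function s omega X \<and> \<not> (s \<epsilon> H a \<and> s \<epsilon> H b)"
    "s \<epsilon> H (fnode 3 a b) \<longleftrightarrow> is_function s omega X \<and> (\<forall>x. x \<epsilon> X \<longrightarrow> update s a x \<epsilon> H b)" for s a b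
    unfolding memH[of s "fnode _ a b"] Cl_def fnode_eq by (simp_all add: H_fnode)
  note dH = defterm_fun1[where F = H, OF H(1)]
  define T where "T = vUnion (vimg formulas (\<lambda>c. vimg (H c) (\<lambda>s. opair c s)))"
  have d: "defterm UNIV (\<lambda>e. vimg (H (e 0)) (\<lambda>s. opair (e 0) s))" by (intro dfn dH)
  have d': "defterm UNIV (\<lambda>e. opair c (e 0))" for c by (intro dfn)
  have T: "opair c s \<epsilon> T \<longleftrightarrow> formula c \<and> s \<epsilon> H c" for c s
    unfolding T_def mem_vUnion mem_vimg[OF d] mem_formulas
    using mem_vimg[OF d'] opair_eq by metis
  have "satisfaction_relation X T"
    unfolding satisfaction_relation_iff T
    by (intro allI impI conjI)
      (simp_all add: formula_intros cl update_fun del: One_nat_def)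
  then show ?thesis by blast
qed

text \<open>
  The Tarski-Vaught test, stated for counterexamples since formulas are built from \<open>\<forall>\<close>.
\<close>

definition tarski_vaught :: "'v \<Rightarrow> 'v \<Rightarrow> 'v \<Rightarrow> bool" where
  "tarski_vaught Y X T \<longleftrightarrow> sub Y X \<and>
     (\<forall>b a s x. formula b \<and> a \<epsilon> omega \<and> is_function s omega Y \<and> x \<epsilon> X \<and> \<not> opair b (update s a x) \<epsilon> T \<longrightarrow>
        (\<exists>y. y \<epsilon> Y \<and> \<not> opair b (update s a y) \<epsilon> T))"

text \<open>
  With \<open>Y = X\<close> this is the uniqueness of truth on formulas; for general \<open>Y\<close> it is the Tarski-Vaught
  criterion for elementary substructures.
\<close>

lemma tarski_vaught_agree:
  assumes X: "satisfaction_relation X T" and Y: "satisfaction_relation Y U"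
    and tv: "tarski_vaught Y X T" and c: "formula c" and s: "is_function s omega Y"
  shows "opair c s \<epsilon> U \<longleftrightarrow> opair c s \<epsilon> T"
proof -
  have sub: "is_function s omega X" if "is_function s omega Y" for s
    using is_function_mono that tv unfolding tarski_vaught_def by blast
  note cX = satisfaction_clauses[OF X]
  note cY = satisfaction_clauses[OF Y]
  have "\<forall>s. is_function s omega Y \<longrightarrow> (opair c s \<epsilon> U \<longleftrightarrow> opair c s \<epsilon> T)"
    using c
  proof (induction c rule: formula_induct)
    case (all a b)
    have "opair (fnode 3 a b) s \<epsilon> U \<longleftrightarrow> opair (fnode 3 a b) s \<epsilon> T" if s: "is_function s omega Y" for s
    proof -
      have "opair (fnode 3 a b) s \<epsilon> U \<longleftrightarrow> (\<forall>x. x \<epsilon> Y \<longrightarrow> opair b (update s a x) \<epsilon> U)"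
        using cY(4)[OF s] all by blast
      also have "\<dots> \<longleftrightarrow> (\<forall>x. x \<epsilon> Y \<longrightarrow> opair b (update s a x) \<epsilon> T)"
        using all(3) update_fun[OF s] by blast
      also have "\<dots> \<longleftrightarrow> (\<forall>x. x \<epsilon> X \<longrightarrow> opair b (update s a x) \<epsilon> T)"
        using tv s all unfolding tarski_vaught_def sub_def by blast
      also have "\<dots> \<longleftrightarrow> opair (fnode 3 a b) s \<epsilon> T"
        using cX(4)[OF sub[OF s]] all by blast
      finally show ?thesis .
    qed
    then show ?case by blast
  next
    case def show ?case by (intro dfn)
  next
    case (mem a b)
    have "opair (fnode 0 a b) s \<epsilon> U \<longleftrightarrow> opair (fnode 0 a b) s \<epsilon> T" if s: "is_function s omega Y" for s
      by (simp add: mem cX(1)[OF sub[OF s]] cY(1)[OF s])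
    then show ?case by blast
  next
    case (eq a b)
    have "opair (fnode 1 a b) s \<epsilon> U \<longleftrightarrow> opair (fnode 1 a b) s \<epsilon> T" if s: "is_function s omega Y" for s
      by (simp add: eq cX(2)[OF sub[OF s]] cY(2)[OF s] del: One_nat_def)
    then show ?case by blast
  next
    case (nand a b)
    have "opair (fnode 2 a b) s \<epsilon> U \<longleftrightarrow> opair (fnode 2 a b) s \<epsilon> T" if s: "is_function s omega Y" for s
      by (simp add: nand s cX(3)[OF sub[OF s]] cY(3)[OF s])
    then show ?case by blast
  qed
  with s show ?thesis by blast
qed

lemma tarski_vaught_refl: "tarski_vaught X X T"
  unfolding tarski_vaught_def by auto

lemma satisfies_iff:
  assumes "satisfaction_relation X T" "formula c" "is_function s omega X"
  shows "satisfies X c s \<longleftrightarrow> opair c s \<epsilon> T"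
  unfolding satisfies_def rel_iff
  using tarski_vaught_agree[OF assms(1) _ tarski_vaught_refl assms(2,3)] assms(1) by blast

lemma elementary_substructureI:
  assumes "satisfaction_relation X T" "tarski_vaught Y X T" "Y \<noteq> vempty"
  shows "elementary_substructure Y X"
  unfolding elementary_substructure_def assignment_iff
proof (intro conjI allI impI)
  show "\<not> empty Y" using assms(3) by simp
  show s: "sub Y X" using assms(2) unfolding tarski_vaught_def by blast
  fix c s assume c: "formula c \<and> is_function s omega Y"
  obtain U where U: "satisfaction_relation Y U" using satisfaction_relation_exists by blast
  have "is_function s omega X" using c s is_function_mono by blast
  with c U assms show "satisfies Y c s \<longleftrightarrow> satisfies X c s"
    using satisfies_iff tarski_vaught_agree by metis
qed

text \<open>
  For standard formulas, truth inside the model and truth in the metatheory coincide.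
\<close>

lemma satisfies_code:
  assumes "is_function s omega X"
  shows "satisfies X (code p) s \<longleftrightarrow> sat_in X (\<lambda>i. vapp s (vnum i)) p"
proof -
  obtain T where T: "satisfaction_relation X T" using satisfaction_relation_exists by blast
  note cl = satisfaction_clauses[OF T]
  have "opair (code p) s \<epsilon> T \<longleftrightarrow> sat_in X (\<lambda>i. vapp s (vnum i)) p" using assms
  proof (induction p arbitrary: s)
    case (Nand p q)
    then show ?case using cl[OF Nand.prems] formula_code by simp
  next
    case (Forall i p)
    have "(\<lambda>k. vapp (update s (vnum i) x) (vnum k)) = (\<lambda>k. vapp s (vnum k))(i := x)" for x
      by (auto simp: vapp_update)
    with Forall.IH[OF update_fun[OF Forall.prems]] cl[OF Forall.prems] show ?case
      by (simp add: formula_code)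
  qed (use cl in simp_all)
  with satisfies_iff[OF T formula_code assms] show ?thesis by simp
qed

section \<open>Bijections and cardinality\<close>

text \<open>
  Let \<open>C\<close> be the closure of \<open>A - B\<close> under \<open>F\<close>. The map that is \<open>F\<close> on \<open>C\<close> and the identity elsewhere is a
  bijection: a point of \<open>B\<close> in \<open>C\<close> is a value of \<open>F\<close> on \<open>C\<close>, since it could otherwise be left out.
\<close>

lemma schroeder_bernstein:
  assumes dF: "defterm UNIV (\<lambda>e. F (e 0))" and BA: "sub B A"
    and F: "\<And>x. x \<epsilon> A \<Longrightarrow> F x \<epsilon> B"
    and inj: "\<And>x y. x \<epsilon> A \<Longrightarrow> y \<epsilon> A \<Longrightarrow> F x = F y \<Longrightarrow> x = y"
  shows "\<exists>h. is_bijection h A B"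
proof -
  note dF' = defterm_fun1[where F = F, OF dF]
  define Q where "Q S \<longleftrightarrow> (\<forall>y. y \<epsilon> A \<and> \<not> y \<epsilon> B \<longrightarrow> y \<epsilon> S) \<and> (\<forall>y. y \<epsilon> A \<and> y \<epsilon> S \<longrightarrow> F y \<epsilon> S)" for S
  define C where "C x \<longleftrightarrow> (\<forall>S. Q S \<longrightarrow> x \<epsilon> S)" for x
  have dC: "definable UNIV (\<lambda>e. C (e 0))" unfolding C_def Q_def by (intro dfn dF')
  note dC' = definable_pred1[where R = C, OF dC]
  have C1: "C y" if "y \<epsilon> A" "\<not> y \<epsilon> B" for y using that unfolding C_def Q_def by blast
  have C2: "C (F y)" if "y \<epsilon> A" "C y" for y using that unfolding C_def Q_def by blast
  have C3: "\<exists>x. x \<epsilon> A \<and> C x \<and> y = F x" if y: "y \<epsilon> B" "C y" for y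
  proof (rule ccontr)
    assume n: "\<not> ?thesis"
    define S where "S = sep A (\<lambda>x. C x \<and> x \<noteq> y)"
    have S: "x \<epsilon> S \<longleftrightarrow> x \<epsilon> A \<and> C x \<and> x \<noteq> y" for x
      unfolding S_def by (rule mem_sep) (intro dfn dC')
    have "Q S" unfolding Q_def S
    proof (intro conjI allI impI)
      fix z assume z: "z \<epsilon> A \<and> z \<epsilon> A \<and> C z \<and> z \<noteq> y"
      then show "F z \<epsilon> A" using F BA subD by blast
      from z show "C (F z)" using C2 by blast
      from z n show "F z \<noteq> y" by blast
    qed (use C1 y in blast)+
    with y have "y \<epsilon> S" unfolding C_def by blast
    then show False by (simp add: S)
  qed
  define h where "h x = (if C x then F x else x)" for x
  have dh: "defterm UNIV (\<lambda>e. h (e 0))" unfolding h_def by (intro dfn dC' dF')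
  have hB: "h x \<epsilon> B" if "x \<epsilon> A" for x using that F C1 by (auto simp: h_def)
  have inj': "x = y" if "x \<epsilon> A" "y \<epsilon> A" "h x = h y" for x y
    using that inj C2 by (metis h_def)
  have surj: "\<exists>x. x \<epsilon> A \<and> y = h x" if "y \<epsilon> B" for y
  proof (cases "C y")
    case True then show ?thesis using C3[OF that] by (metis h_def)
  next
    case False then show ?thesis using that BA subD by (metis h_def)
  qed
  have "is_bijection (vlam A h) A B"
    unfolding is_bijection_def rel_iff opair_mem_vlam[OF dh]
    using is_function_vlam[OF dh hB] surj inj' by metis
  then show ?thesis by blast
qed

lemma bijection_inverse:
  assumes "is_bijection f a b"
  shows "\<exists>g. is_bijection g b a"
proof -
  have d: "defterm UNIV (\<lambda>e. opair (vsnd (e 0)) (vfst (e 0)))" by (intro dfn)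
  define g where "g = vimg f (\<lambda>p. opair (vsnd p) (vfst p))"
  have g: "p \<epsilon> g \<longleftrightarrow> (\<exists>x y. opair x y \<epsilon> f \<and> p = opair y x)" for p
  proof
    assume "p \<epsilon> g"
    then obtain q where "q \<epsilon> f" "p = opair (vsnd q) (vfst q)" unfolding g_def mem_vimg[OF d] by blast
    moreover from \<open>q \<epsilon> f\<close> assms obtain x y where "q = opair x y"
      unfolding is_bijection_def is_function_def is_pair_iff by blast
    ultimately show "\<exists>x y. opair x y \<epsilon> f \<and> p = opair y x" by auto
  next
    assume "\<exists>x y. opair x y \<epsilon> f \<and> p = opair y x"
    then show "p \<epsilon> g" unfolding g_def mem_vimg[OF d] by (metis vfst_opair vsnd_opair)
  qed
  have gf: "opair y x \<epsilon> g \<longleftrightarrow> opair x y \<epsilon> f" for x y unfolding g by auto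
  have fn: "is_function f a b" using assms unfolding is_bijection_def by blast
  have "\<exists>y x. y \<epsilon> b \<and> x \<epsilon> a \<and> p = opair y x" if p: "p \<epsilon> g" for p
  proof -
    from p obtain x y where "opair x y \<epsilon> f" "p = opair y x" unfolding g by blast
    moreover from this have "x \<epsilon> a" "y \<epsilon> b" using fun_opair[OF fn] fun_vapp(1)[OF fn] by metis+
    ultimately show ?thesis by blast
  qed
  then have "\<forall>p. p \<epsilon> g \<longrightarrow> (\<exists>y x. y \<epsilon> b \<and> x \<epsilon> a \<and> p = opair y x)" by (intro allI impI)
  moreover have "\<forall>x. x \<epsilon> a \<longrightarrow> (\<exists>!y. opair x y \<epsilon> f)"
    using assms unfolding is_bijection_def is_function_def rel_iff by (elim conjE)
  moreover have "\<forall>y. y \<epsilon> b \<longrightarrow> (\<exists>!x. opair x y \<epsilon> f)"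
    using assms unfolding is_bijection_def is_function_def rel_iff by (elim conjE)
  ultimately have "is_bijection g b a"
    unfolding is_bijection_def is_function_def is_pair_iff rel_iff gf by (intro conjI)
  then show ?thesis by blast
qed

lemma bijection_inj: "is_bijection f a b \<Longrightarrow> x \<epsilon> a \<Longrightarrow> y \<epsilon> a \<Longrightarrow> vapp f x = vapp f y \<Longrightarrow> x = y"
  unfolding is_bijection_def rel_iff using fun_vapp[of f a b] by metis

lemma is_base_iff: "is_base l b \<longleftrightarrow> ordinal l \<and> (\<forall>x. x \<epsilon> b \<longleftrightarrow> x \<epsilon> Vset l \<or> x = l)"
  unfolding is_base_def is_V_iff by blast

lemma cardinal_ordinal: "cardinal l \<Longrightarrow> ordinal l"
  unfolding cardinal_def by blast

text \<open>
  If \<open>l = k + 1\<close>, then \<open>l + 1 \<subseteq> V\<^sub>l \<union> {l}\<close> injects into \<open>k + 1\<close>. Dropping one point on each side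
  yields an injection of \<open>l\<close> into \<open>k\<close>, so \<open>l\<close> is not a cardinal. This covers finite and infinite
  successors alike.
\<close>

lemma admits_domains_limit:
  assumes adm: "admits_domains l" and ne: "m \<epsilon> l"
  shows "limit_ordinal l"
proof (rule ccontr)
  assume nl: "\<not> limit_ordinal l"
  from adm obtain b f where b: "\<And>x. x \<epsilon> b \<longleftrightarrow> x \<epsilon> Vset l \<or> x = l" and l: "cardinal l"
    and f: "is_bijection f b l"
    unfolding admits_domains_def has_cardinality_def is_base_iff by blast
  have ol: "ordinal l" using l by (rule cardinal_ordinal)
  obtain k where k: "ordinal k" "l = vsucc k"
    using successor_cases[OF ol _ nl] ne mem_vempty by metis
  have fn: "is_function f b l" using f unfolding is_bijection_def by blast
  have lb: "x \<epsilon> b" if "x \<epsilon> l \<or> x = l" for x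
    unfolding b using that ol ordinal_mem_Vset ordinal_mem by blast
  define F where "F x = (if vapp f x = k then vapp f l else vapp f x)" for x
  have dF: "defterm UNIV (\<lambda>e. F (e 0))" unfolding F_def by (intro dfn)
  have fk: "vapp f x \<epsilon> k \<or> vapp f x = k" if "x \<epsilon> l \<or> x = l" for x
    using fun_vapp(1)[OF fn lb[OF that]] k mem_vsucc by metis
  have finj: "x = y" if "x \<epsilon> l \<or> x = l" "y \<epsilon> l \<or> y = l" "vapp f x = vapp f y" for x y
    using bijection_inj[OF f] lb that by blast
  have "F x \<epsilon> k" if x: "x \<epsilon> l" for x
    unfolding F_def using fk[of x] fk[of l] finj[of x l] x mem_irrefl by metis
  moreover have "x = y" if "x \<epsilon> l" "y \<epsilon> l" "F x = F y" for x y
    using that finj[of x y] finj[of x l] finj[of y l] mem_irrefl unfolding F_def by metis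
  moreover have "sub k l" using k by (simp add: sub_def)
  ultimately obtain h where "is_bijection h l k" using schroeder_bernstein[OF dF] by blast
  then obtain g where "is_bijection g k l" using bijection_inverse by blast
  moreover have "k \<epsilon> l" using k by simp
  ultimately show False using l unfolding cardinal_def by blast
qed

section \<open>Skolem hulls\<close>

text \<open>
  The axiom of choice is about disjoint families; pairing each element with the set it comes from
  makes the family of all nonempty subsets of \<open>V\<close> disjoint.
\<close>

lemma choice_function:
  obtains ch where "defterm UNIV (\<lambda>e. ch (e 0))" "\<And>x. sub x V \<Longrightarrow> x \<noteq> vempty \<Longrightarrow> ch x \<epsilon> x"
proof -
  define P where "P = sep (vPow V) (\<lambda>x. x \<noteq> vempty)"
  have P: "x \<epsilon> P \<longleftrightarrow> sub x V \<and> x \<noteq> vempty" for x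
    unfolding P_def by (subst mem_sep) (intro dfn, simp)
  define tag where "tag x = vimg x (\<lambda>y. opair x y)" for x
  have dp: "defterm UNIV (\<lambda>e. opair x (e 0))" for x by (intro dfn)
  have dt: "defterm UNIV (\<lambda>e. tag (e 0))" unfolding tag_def by (intro dfn)
  have tag: "z \<epsilon> tag x \<longleftrightarrow> (\<exists>y. y \<epsilon> x \<and> z = opair x y)" for z x
    unfolding tag_def by (rule mem_vimg[OF dp])
  have "\<exists>c. \<forall>x. x \<epsilon> vimg P tag \<longrightarrow> (\<exists>!z. z \<epsilon> c \<and> z \<epsilon> x)"
  proof (rule choice)
    show "\<forall>x. x \<epsilon> vimg P tag \<longrightarrow> \<not> empty x"
    proof (intro allI impI)
      fix t assume "t \<epsilon> vimg P tag"
      then obtain x where x: "x \<epsilon> P" "t = tag x" unfolding mem_vimg[OF dt] by blast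
      then obtain y where "y \<epsilon> x" using P by (metis set_eqI mem_vempty)
      then have "opair x y \<epsilon> t" using x tag by blast
      then show "\<not> empty t" unfolding empty_def by blast
    qed
    show "\<forall>x y z. x \<epsilon> vimg P tag \<and> y \<epsilon> vimg P tag \<and> z \<epsilon> x \<and> z \<epsilon> y \<longrightarrow> x = y"
      unfolding mem_vimg[OF dt] using tag opair_eq by metis
  qed
  then obtain c where c: "\<And>x. x \<epsilon> P \<Longrightarrow> \<exists>!z. z \<epsilon> c \<and> z \<epsilon> tag x"
    unfolding mem_vimg[OF dt] by metis
  define ch where "ch x = vUnion (setof (\<lambda>y. y \<epsilon> x \<and> opair x y \<epsilon> c))" for x
  have "defterm UNIV (\<lambda>e. ch (e 0))" unfolding ch_def by (intro dfn)
  moreover have "ch x \<epsilon> x" if "sub x V" "x \<noteq> vempty" for x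
  proof -
    from that have "x \<epsilon> P" by (simp add: P)
    from c[OF this] obtain y where y: "\<And>y'. y' \<epsilon> x \<and> opair x y' \<epsilon> c \<longleftrightarrow> y' = y"
      unfolding tag using opair_eq by metis
    have "setof (\<lambda>y'. y' \<epsilon> x \<and> opair x y' \<epsilon> c) = vpair y y"
      by (rule setof_eqI) (simp add: y)
    then have "ch x = y" unfolding ch_def by (auto intro: set_eqI)
    with y show ?thesis by blast
  qed
  ultimately show thesis by (rule that)
qed

lemma omega_upper:
  assumes "a \<epsilon> omega" "b \<epsilon> omega"
  obtains n where "n \<epsilon> omega" "sub a n" "sub b n"
proof -
  obtain n where "n \<epsilon> omega" "a \<epsilon> n \<or> a = n" "b \<epsilon> n \<or> b = n"
    using ordinal_upper[OF ordinal_omega assms] by metis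
  with that assms show thesis using ordinal_sub omega_ordinal by metis
qed

text \<open>
  Assignments are infinite sequences, and \<open>l\<close> may have more than \<open>l\<close> of them. Skolem functions can only
  be indexed by \<open>V\<^sub>l\<close> because the truth of a formula depends on finitely many values.
\<close>

lemma finite_support:
  assumes T: "satisfaction_relation V T" and c: "formula c"
  obtains n where "n \<epsilon> omega"
    "\<And>s s'. is_function s omega V \<Longrightarrow> is_function s' omega V \<Longrightarrow>
       (\<And>i. i \<epsilon> n \<Longrightarrow> vapp s i = vapp s' i) \<Longrightarrow> opair c s \<epsilon> T \<longleftrightarrow> opair c s' \<epsilon> T"
proof -
  note cl = satisfaction_clauses[OF T]
  define S where "S c n \<longleftrightarrow> (\<forall>s s'. is_function s omega V \<and> is_function s' omega V \<and>
      (\<forall>i. i \<epsilon> n \<longrightarrow> vapp s i = vapp s' i) \<longrightarrow> (opair c s \<epsilon> T \<longleftrightarrow> opair c s' \<epsilon> T))" for c n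
  have dS: "definable UNIV (\<lambda>e. S (e 0) (e 1))" unfolding S_def by (intro dfn)
  note dS' = definable_pred2[where R = S, OF dS]
  have S_mono: "S c n'" if "S c n" "sub n n'" for c n n'
    using that unfolding S_def sub_def by blast
  have "\<exists>n. n \<epsilon> omega \<and> S c n" using c
  proof (induction c rule: formula_induct)
    case def show ?case by (intro dfn dS')
  next
    case (mem a b)
    then obtain n where n: "n \<epsilon> omega" "sub (vsucc a) n" "sub (vsucc b) n"
      using omega_upper[of "vsucc a" "vsucc b"] by (metis omega_vsucc)
    then have "a \<epsilon> n" "b \<epsilon> n" by (auto simp: sub_def)
    then have "S (fnode 0 a b) n" unfolding S_def by (simp add: cl(1) mem)
    with n show ?case by blast
  next
    case (eq a b)
    then obtain n where n: "n \<epsilon> omega" "sub (vsucc a) n" "sub (vsucc b) n"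
      using omega_upper[of "vsucc a" "vsucc b"] by (metis omega_vsucc)
    then have "a \<epsilon> n" "b \<epsilon> n" by (auto simp: sub_def)
    then have "S (fnode 1 a b) n" unfolding S_def by (simp add: cl(2) eq del: One_nat_def)
    with n show ?case by blast
  next
    case (nand a b)
    then obtain n1 n2 where "n1 \<epsilon> omega" "n2 \<epsilon> omega" "S a n1" "S b n2" by blast
    then obtain n where n: "n \<epsilon> omega" "S a n" "S b n" using omega_upper[of n1 n2] S_mono by metis
    have "opair (fnode 2 a b) s \<epsilon> T \<longleftrightarrow> opair (fnode 2 a b) s' \<epsilon> T"
      if s: "is_function s omega V" "is_function s' omega V" "\<forall>i. i \<epsilon> n \<longrightarrow> vapp s i = vapp s' i" for s s'
    proof -
      have "opair a s \<epsilon> T \<longleftrightarrow> opair a s' \<epsilon> T" "opair b s \<epsilon> T \<longleftrightarrow> opair b s' \<epsilon> T"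
        using n s unfolding S_def by blast+
      then show ?thesis by (simp add: cl(3) s nand)
    qed
    with n show ?case unfolding S_def by blast
  next
    case (all a b)
    then obtain n where n: "n \<epsilon> omega" "S b n" by blast
    have "opair (fnode 3 a b) s \<epsilon> T \<longleftrightarrow> opair (fnode 3 a b) s' \<epsilon> T"
      if s: "is_function s omega V" "is_function s' omega V" "\<forall>i. i \<epsilon> n \<longrightarrow> vapp s i = vapp s' i" for s s'
    proof -
      have "opair b (update s a x) \<epsilon> T \<longleftrightarrow> opair b (update s' a x) \<epsilon> T" if x: "x \<epsilon> V" for x
      proof -
        have "vapp (update s a x) i = vapp (update s' a x) i" if "i \<epsilon> n" for i
          using that s(3) n(1) vapp_update ordinal_trans[OF ordinal_omega] by metis
        then show ?thesis using n(2) update_fun[OF s(1) x] update_fun[OF s(2) x] unfolding S_def by blast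
      qed
      then show ?thesis by (simp add: cl(4) s all)
    qed
    with n show ?case unfolding S_def by blast
  qed
  with that show thesis unfolding S_def by blast
qed

lemma Vset_insert:
  assumes d: "limit_ordinal d" and "x \<epsilon> Vset d" "z \<epsilon> Vset d"
  shows "vunion z (vpair x x) \<epsilon> Vset d"
proof -
  from assms have xz: "rank x \<epsilon> d" "rank z \<epsilon> d" by (simp_all add: mem_Vset_rank limit_ordinal)
  then obtain c where c: "c \<epsilon> d" "rank x \<epsilon> c \<or> rank x = c" "rank z \<epsilon> c \<or> rank z = c"
    using ordinal_upper[OF limit_ordinal(1)[OF d]] by metis
  have oc: "ordinal c" "ordinal (vsucc c)" using d c limit_ordinal ordinal_mem ordinal_vsucc by blast+
  have "rank y \<epsilon> vsucc c" if "y \<epsilon> vunion z (vpair x x)" for y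
  proof -
    from that have "rank y \<epsilon> rank z \<or> y = x" using rank_mem by auto
    then show ?thesis using c ordinal_trans[OF oc(1)] by auto
  qed
  then have "sub (vunion z (vpair x x)) (Vset (vsucc c))"
    unfolding sub_def using mem_Vset_rank[OF oc(2)] by blast
  moreover have "vsucc c \<epsilon> d" using d c limit_ordinal by blast
  ultimately show ?thesis using d limit_ordinal mem_Vset by blast
qed

lemma opair_neq_vempty [simp]: "opair a b \<noteq> vempty" "fnode k a b \<noteq> vempty"
  unfolding fnode_def by (metis opair_def mem_vpair mem_vempty)+

text \<open>
  The Loewenheim-Skolem theorem. The hull is the set of values of Skolem terms, and the terms
  themselves are coded as elements of \<open>V\<^sub>l\<close>: constants for the elements of \<open>V\<^sub>l\<close> and for \<open>l\<close>, and
  applications of a Skolem function to finitely many terms. As \<open>l\<close> is a limit, \<open>V\<^sub>l\<close> is closed under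
  forming such terms, and as \<open>V\<^sub>l\<close> has size \<open>l\<close>, so does the hull.
\<close>

theorem exacting_domain_exists:
  assumes l: "cardinal l" and adm: "admits_domains l" and ne: "m \<epsilon> l"
    and z: "ordinal \<zeta>" "l \<epsilon> \<zeta>"
  shows "\<exists>X. exacting_domain l \<zeta> X"
proof -
  define V where "V = Vset \<zeta>"
  have ll: "limit_ordinal l" by (rule admits_domains_limit[OF adm ne])
  have ol: "ordinal l" by (rule cardinal_ordinal[OF l])
  have lV: "l \<epsilon> V" and VlV: "sub (Vset l) V"
    using z ol ordinal_mem_Vset Vset_mono unfolding V_def by blast+
  have zV: "vempty \<epsilon> V" using VlV Vset_vempty[OF ll] subD by blast
  obtain T where T: "satisfaction_relation V T" using satisfaction_relation_exists by blast
  obtain base g where base: "is_base l base" and g: "is_bijection g base l"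
    using adm unfolding admits_domains_def has_cardinality_def by blast
  have b0m: "x \<epsilon> base \<longleftrightarrow> x \<epsilon> Vset l \<or> x = l" for x using base unfolding is_base_iff by blast
  obtain ch where dch: "defterm UNIV (\<lambda>e. ch (e 0))"
    and ch: "\<And>x. sub x V \<Longrightarrow> x \<noteq> vempty \<Longrightarrow> ch x \<epsilon> x"
    using choice_function by blast
  note dch' = defterm_fun1[where F = ch, OF dch]
  \<comment> \<open>\<open>p\<close> holds finitely many values of an assignment, and \<open>x\<close> as value of \<open>v\<^sub>a\<close> refutes \<open>b\<close>.
    The value at \<open>a\<close> is exempt since the quantifier overrides it.\<close>
  define falsifies where "falsifies a b p x \<longleftrightarrow> (\<exists>s. is_function s omega V \<and>
      (\<forall>i y. opair i y \<epsilon> p \<and> i \<noteq> a \<longrightarrow> vapp s i = y) \<and> vapp s a = x \<and> \<not> opair b s \<epsilon> T)" for a b p x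
  have dfals: "definable UNIV (\<lambda>e. falsifies (e 0) (e 1) (e 2) (e 3))" unfolding falsifies_def by (intro dfn)
  note dfals' = definable_pred4[where R = falsifies, OF dfals]
  define witness where "witness a b p = (if \<exists>x. x \<epsilon> V \<and> falsifies a b p x then ch (sep V (falsifies a b p)) else vempty)" for a b p
  have dW: "defterm UNIV (\<lambda>e. witness (e 0) (e 1) (e 2))" unfolding witness_def by (intro dfn dch' dfals')
  note dW' = defterm_fun3[where F = witness, OF dW]
  have witness: "witness a b p \<epsilon> V \<and> falsifies a b p (witness a b p)" if "x \<epsilon> V" "falsifies a b p x" for a b p x
  proof -
    have D: "y \<epsilon> sep V (falsifies a b p) \<longleftrightarrow> y \<epsilon> V \<and> falsifies a b p y" for y
      by (rule mem_sep) (intro dfals' dfn)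
    have "sep V (falsifies a b p) \<noteq> vempty" using D that mem_vempty by metis
    moreover have "sub (sep V (falsifies a b p)) V" unfolding sub_def D by blast
    ultimately have "ch (sep V (falsifies a b p)) \<epsilon> sep V (falsifies a b p)" by (intro ch)
    then show ?thesis unfolding witness_def using that D by auto
  qed
  have WV: "witness a b p \<epsilon> V" for a b p
  proof (cases "\<exists>x. x \<epsilon> V \<and> falsifies a b p x")
    case True then show ?thesis using witness by blast
  next
    case False then show ?thesis by (simp only: witness_def if_False zV)
  qed
  \<comment> \<open>Codes of terms: \<open>(0, u, u)\<close> for the constant \<open>u\<close>; \<open>(1, a, (b, z))\<close> for the Skolem function of
    \<open>\<forall>v\<^sub>a. b\<close>, where \<open>z\<close> maps variables to terms; any other set for \<open>l\<close>.\<close>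
  define hull_step where "hull_step w f = (if \<exists>u. w = fnode 0 u u then vsnd (vsnd w)
      else if \<exists>a b z. w = fnode 1 a (opair b z)
      then witness (vfst (vsnd w)) (vfst (vsnd (vsnd w))) (vimg (vsnd (vsnd (vsnd w))) (\<lambda>q. opair (vfst q) (vapp f (vsnd q))))
      else l)" for w f
  have "defterm UNIV (\<lambda>e. hull_step (e 0) (e 1))" unfolding hull_step_def by (intro dfn dW')
  from rank_recursion[OF this] obtain hull where
    dhull: "defterm UNIV (\<lambda>e. hull (e 0))" and hull: "\<And>w. hull w = hull_step w (vlam (Vset (rank w)) hull)" by blast
  note dhull' = defterm_fun1[where F = hull, OF dhull]
  have F0: "hull (fnode 0 u u) = u" for u
    by (subst hull) (auto simp: hull_step_def fnode_def)
  have Fz: "hull vempty = l"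
    by (subst hull) (simp add: hull_step_def opair_neq_vempty[symmetric])
  have F1: "hull (fnode 1 a (opair b z)) = witness a b (vimg z (\<lambda>q. opair (vfst q) (hull (vsnd q))))"
    if z: "\<And>q. q \<epsilon> z \<Longrightarrow> \<exists>i u. q = opair i u" for a b z
  proof -
    let ?w = "fnode 1 a (opair b z)"
    have "vapp (vlam (Vset (rank ?w)) hull) (vsnd q) = hull (vsnd q)" if "q \<epsilon> z" for q
    proof (rule vapp_vlam[OF dhull])
      from z[OF that] obtain i u where q: "q = opair i u" by blast
      have "rank u \<epsilon> rank q" "rank q \<epsilon> rank z" "rank z \<epsilon> rank (opair b z)" "rank (opair b z) \<epsilon> rank ?w"
        using q rank_opair rank_mem that rank_fnode by blast+
      then have "rank u \<epsilon> rank ?w" using ordinal_trans rank(1) by metis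
      then show "vsnd q \<epsilon> Vset (rank ?w)" by (simp add: q mem_Vset_rank rank)
    qed
    then have "vimg z (\<lambda>q. opair (vfst q) (vapp (vlam (Vset (rank ?w)) hull) (vsnd q))) =
        vimg z (\<lambda>q. opair (vfst q) (hull (vsnd q)))"
      by (intro vimg_cong) simp
    moreover have "\<not> (\<exists>u. ?w = fnode 0 u u)" "\<exists>a' b' z'. ?w = fnode 1 a' (opair b' z')"
      by (auto simp del: One_nat_def)
    moreover have "vfst (vsnd ?w) = a" "vfst (vsnd (vsnd ?w)) = b" "vsnd (vsnd (vsnd ?w)) = z"
      unfolding fnode_def by simp_all
    ultimately show ?thesis by (subst hull) (simp only: hull_step_def if_True if_False simp_thms)
  qed
  have FV: "hull w \<epsilon> V" if "w \<epsilon> Vset l" for w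
  proof (cases "\<exists>u. w = fnode 0 u u")
    case True
    then obtain u where u: "w = fnode 0 u u" by blast
    then have "rank u \<epsilon> rank w" "rank w \<epsilon> l" using rank_fnode that ol mem_Vset_rank by blast+
    then have "u \<epsilon> Vset l" using ol mem_Vset_rank ordinal_trans by blast
    then show ?thesis using u F0 VlV subD by metis
  next
    case False
    then show ?thesis by (subst hull) (simp add: hull_step_def WV lV)
  qed
  define X where "X = vimg (Vset l) hull"
  have X: "x \<epsilon> X \<longleftrightarrow> (\<exists>w. w \<epsilon> Vset l \<and> x = hull w)" for x
    unfolding X_def by (rule mem_vimg[OF dhull])
  have XV: "sub X V" unfolding sub_def X using FV by blast
  have baseX: "sub base X"
    unfolding sub_def X b0m
  proof (intro allI impI)
    fix x assume "x \<epsilon> Vset l \<or> x = l"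
    then show "\<exists>w. w \<epsilon> Vset l \<and> x = hull w"
    proof
      assume "x \<epsilon> Vset l"
      then have "fnode 0 x x \<epsilon> Vset l" using fnode_mem_Vset[OF ll] by blast
      then show ?thesis using F0 by metis
    next
      assume "x = l" then show ?thesis using Fz Vset_vempty[OF ll] by metis
    qed
  qed
  have lX: "sub l X"
    using baseX ol ordinal_mem_Vset ordinal_mem unfolding sub_def b0m by blast
  have "has_cardinality X l"
  proof -
    \<comment> \<open>A set is sent to the least index of a term for it, where \<open>g\<close> indexes terms by elements of \<open>l\<close>.\<close>
    define N where "N x a \<longleftrightarrow> (\<exists>w. w \<epsilon> Vset l \<and> vapp g w = a \<and> hull w = x)" for x a
    have dN: "definable UNIV (\<lambda>e. N (e 0) (e 1))" unfolding N_def by (intro dfn dhull')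
    note dN' = definable_pred2[where R = N, OF dN]
    define J where "J x = least_ord (N x)" for x
    have dJ: "defterm UNIV (\<lambda>e. J (e 0))" unfolding J_def by (intro dfn dN')
    have gf: "is_function g base l" using g unfolding is_bijection_def by blast
    have J: "N x (J x)" if x: "x \<epsilon> X" for x
    proof -
      from x obtain w where w: "w \<epsilon> Vset l" "x = hull w" unfolding X by blast
      then have "vapp g w \<epsilon> l" using fun_vapp(1)[OF gf] b0m by blast
      then have "ordinal (vapp g w)" using ol ordinal_mem by blast
      moreover have "N x (vapp g w)" unfolding N_def using w by blast
      moreover have "definable UNIV (\<lambda>e. N x (e 0))" by (intro dN' dfn)
      ultimately show ?thesis unfolding J_def using least_ord(2)[where P = "N x"] by blast
    qed
    have "J x \<epsilon> l" if "x \<epsilon> X" for x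
      using J[OF that] fun_vapp(1)[OF gf] b0m unfolding N_def by metis
    moreover have "x = y" if "x \<epsilon> X" "y \<epsilon> X" "J x = J y" for x y
    proof -
      from J[OF that(1)] J[OF that(2)] that(3) obtain v w where
        "v \<epsilon> Vset l" "w \<epsilon> Vset l" "vapp g v = vapp g w" "hull v = x" "hull w = y" unfolding N_def by metis
      with bijection_inj[OF g] b0m show ?thesis by metis
    qed
    ultimately show ?thesis
      unfolding has_cardinality_def using l schroeder_bernstein[OF dJ lX] by blast
  qed
  moreover have "elementary_substructure X V"
  proof (rule elementary_substructureI[OF T])
    show "X \<noteq> vempty" using lX ne subD mem_vempty by metis
    show "tarski_vaught X V T"
      unfolding tarski_vaught_def
    proof (intro conjI allI impI)
      show "sub X V" by (rule XV)
      fix b a s x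
      assume "formula b \<and> a \<epsilon> omega \<and> is_function s omega X \<and> x \<epsilon> V \<and> \<not> opair b (update s a x) \<epsilon> T"
      then have b: "formula b" and a: "a \<epsilon> omega" and s: "is_function s omega X" and x: "x \<epsilon> V"
        and nT: "\<not> opair b (update s a x) \<epsilon> T" by blast+
      have sV: "is_function s omega V" using s XV is_function_mono by blast
      obtain n where n: "n \<epsilon> omega"
        and supp: "\<And>s s'. is_function s omega V \<Longrightarrow> is_function s' omega V \<Longrightarrow>
          (\<And>i. i \<epsilon> n \<Longrightarrow> vapp s i = vapp s' i) \<Longrightarrow> opair b s \<epsilon> T \<longleftrightarrow> opair b s' \<epsilon> T"
        using finite_support[OF T b] by blast
      \<comment> \<open>Terms for the first \<open>n\<close> values of \<open>s\<close> are collected one at a time, so that \<open>z\<close> stays in \<open>V\<^sub>l\<close>.\<close>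
      have "\<exists>z. z \<epsilon> Vset l \<and> (\<forall>q. q \<epsilon> z \<longrightarrow> (\<exists>i u. q = opair i u \<and> i \<epsilon> omega \<and> hull u = vapp s i)) \<and>
          (\<forall>i. i \<epsilon> n \<longrightarrow> (\<exists>u. opair i u \<epsilon> z))"
        using n
      proof (induction n rule: omega_induct)
        case def show ?case by (intro dfn dhull')
      next
        case vempty show ?case by (rule exI[of _ vempty]) (simp add: Vset_vempty[OF ll])
      next
        case (vsucc n)
        then obtain z where z: "z \<epsilon> Vset l"
          "\<forall>q. q \<epsilon> z \<longrightarrow> (\<exists>i u. q = opair i u \<and> i \<epsilon> omega \<and> hull u = vapp s i)"
          "\<forall>i. i \<epsilon> n \<longrightarrow> (\<exists>u. opair i u \<epsilon> z)" by blast
        have "vapp s n \<epsilon> X" using s vsucc(1) fun_vapp(1) by blast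
        then obtain u where u: "u \<epsilon> Vset l" "hull u = vapp s n" unfolding X by metis
        have "opair n u \<epsilon> Vset l" using Vset_opair[OF ll] omega_mem_Vset[OF vsucc(1) ll] u(1) by blast
        then have "vunion z (vpair (opair n u) (opair n u)) \<epsilon> Vset l" using Vset_insert[OF ll] z(1) by blast
        moreover have "\<exists>i u. q = opair i u \<and> i \<epsilon> omega \<and> hull u = vapp s i"
          if "q \<epsilon> vunion z (vpair (opair n u) (opair n u))" for q
          using that z(2) u(2) vsucc(1) unfolding mem_vunion mem_vpair by metis
        moreover have "\<exists>v. opair i v \<epsilon> vunion z (vpair (opair n u) (opair n u))" if "i \<epsilon> vsucc n" for i
          using that z(3) unfolding mem_vunion mem_vpair mem_vsucc by metis
        ultimately show ?case by blast
      qed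
      then obtain z where z: "z \<epsilon> Vset l"
        "\<And>q. q \<epsilon> z \<Longrightarrow> \<exists>i u. q = opair i u \<and> i \<epsilon> omega \<and> hull u = vapp s i"
        "\<And>i. i \<epsilon> n \<Longrightarrow> \<exists>u. opair i u \<epsilon> z" by blast
      define p where "p = vimg z (\<lambda>q. opair (vfst q) (hull (vsnd q)))"
      have dp: "defterm UNIV (\<lambda>e. opair (vfst (e 0)) (hull (vsnd (e 0))))" by (intro dfn dhull')
      have p: "opair i y \<epsilon> p \<Longrightarrow> i \<epsilon> omega \<and> y = vapp s i" for i y
        unfolding p_def mem_vimg[OF dp] using z(2) by (metis vfst_opair vsnd_opair opair_eq)
      have p': "opair i (vapp s i) \<epsilon> p" if "i \<epsilon> n" for i
      proof -
        from z(3)[OF that] obtain u where u: "opair i u \<epsilon> z" by blast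
        with z(2) have "hull u = vapp s i" by (metis opair_eq)
        with u show ?thesis unfolding p_def mem_vimg[OF dp] by (metis vfst_opair vsnd_opair)
      qed
      define w where "w = fnode 1 a (opair b z)"
      have wl: "w \<epsilon> Vset l" unfolding w_def
        by (intro fnode_mem_Vset[OF ll] Vset_opair[OF ll] omega_mem_Vset[OF a ll] formula_mem_Vset[OF ll b] z(1))
      have Fw: "hull w = witness a b p" unfolding w_def p_def by (rule F1) (use z(2) in blast)
      have "falsifies a b p x" unfolding falsifies_def
        by (rule exI[of _ "update s a x"]) (use nT p update_fun[OF sV x] vapp_update a in auto)
      with witness[OF x] Fw have "falsifies a b p (hull w)" by metis
      then obtain s1 where s1: "is_function s1 omega V"
        "\<And>i y. opair i y \<epsilon> p \<Longrightarrow> i \<noteq> a \<Longrightarrow> vapp s1 i = y" "vapp s1 a = hull w" "\<not> opair b s1 \<epsilon> T"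
        unfolding falsifies_def by blast
      have "vapp s1 i = vapp (update s a (hull w)) i" if "i \<epsilon> n" for i
      proof -
        have "i \<epsilon> omega" using that n ordinal_trans[OF ordinal_omega] by blast
        then show ?thesis using s1(2)[OF p'[OF that]] s1(3) by (simp add: vapp_update)
      qed
      with supp[OF s1(1) update_fun[OF sV FV[OF wl]]] s1(4)
      have "\<not> opair b (update s a (hull w)) \<epsilon> T" by blast
      moreover have "hull w \<epsilon> X" using X wl by blast
      ultimately show "\<exists>y. y \<epsilon> X \<and> \<not> opair b (update s a y) \<epsilon> T" by blast
    qed
  qed
  ultimately show ?thesis
    unfolding exacting_domain_def is_V_iff using z base baseX V_def by blast
qed

section \<open>Definable ordinals are not critical\<close>

text \<open>
  Meeting a club class is itself a closure condition: ask for an element of the class between \<open>a\<close>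
  and its bound. A limit ordinal closed under this is a limit of the class.
\<close>

lemma reflect_in_class:
  assumes B: "bounding B" and dM: "definable UNIV (\<lambda>e. M (e 0))"
    and unb: "\<And>a. ordinal a \<Longrightarrow> \<exists>d. M d \<and> ordinal d \<and> a \<epsilon> d"
    and cl: "\<And>d. limit_ordinal d \<Longrightarrow> (\<And>a. a \<epsilon> d \<Longrightarrow> \<exists>b. M b \<and> b \<epsilon> d \<and> a \<epsilon> b) \<Longrightarrow> M d"
    and a: "ordinal a"
  obtains d where "limit_ordinal d" "a \<epsilon> d" "closed_under B d" "M d"
proof -
  note dM' = definable_pred1[where R = M, OF dM]
  define U where "U a b \<longleftrightarrow> (\<exists>d. M d \<and> ordinal d \<and> a \<epsilon> d \<and> d \<epsilon> b)" for a b
  have "bounding U"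
    unfolding bounding_def
  proof (intro conjI allI impI)
    show "definable UNIV (\<lambda>e. U (e 0) (e 1))" unfolding U_def by (intro dfn dM')
    fix a a' b b'
    assume *: "ordinal a \<and> ordinal a' \<and> ordinal b \<and> ordinal b' \<and> U a b \<and> sub a' a \<and> sub b b'"
    then obtain d where d: "M d" "ordinal d" "a \<epsilon> d" "d \<epsilon> b" unfolding U_def by blast
    have "a' \<epsilon> a \<or> a' = a" using * ordinal_sub by blast
    with d have "a' \<epsilon> d" using ordinal_trans by metis
    with d * show "U a' b'" unfolding U_def sub_def by blast
  next
    fix a assume "ordinal a"
    then obtain d where "M d" "ordinal d" "a \<epsilon> d" using unb by blast
    then show "\<exists>b. ordinal b \<and> U a b" unfolding U_def by (intro exI[of _ "vsucc d"]) auto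
  qed
  from closed_limit_exists[OF bounding_conj[OF B this] a] obtain d where
    d: "limit_ordinal d" "a \<epsilon> d" "closed_under (\<lambda>a b. B a b \<and> U a b) d" by blast
  have "M d"
  proof (rule cl[OF d(1)])
    fix x assume "x \<epsilon> d"
    with d(3) obtain b where "b \<epsilon> d" "U x b" unfolding closed_under_def by blast
    then show "\<exists>b. M b \<and> b \<epsilon> d \<and> x \<epsilon> b"
      unfolding U_def using ordinal_trans[OF limit_ordinal(1)[OF d(1)]] by blast
  qed
  moreover have "closed_under B d" using d(3) unfolding closed_under_def by blast
  ultimately show thesis using d that by blast
qed

text \<open>
  Truth of \<open>p\<close> at \<open>(m, l)\<close> passes from the model to \<open>V\<^sub>d\<close> by reflection, to \<open>X\<close> because \<open>X \<prec> V\<^sub>d\<close>,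
  along \<open>j\<close> to \<open>(y, l)\<close> in \<open>V\<^sub>d\<close>, and back.
\<close>

lemma embedding_fixes_definable:
  assumes d: "limit_ordinal d" and refl: "\<And>e. (\<forall>i. e i \<epsilon> Vset d) \<Longrightarrow> sat_in (Vset d) e p \<longleftrightarrow> sat e p"
    and X: "elementary_substructure X (Vset d)" and j: "elementary_embedding j X (Vset d)"
    and l: "rel j l l" and m: "rel j m y" and p: "sat (\<lambda>k. if k = 0 then m else l) p"
  shows "sat (\<lambda>k. if k = 0 then y else l) p"
proof -
  define as where "as x = vlam omega (\<lambda>k. if k = vempty then x else l)" for x
  have da: "defterm UNIV (\<lambda>e. if e 0 = vempty then x else l)" for x by (intro dfn)
  have as_fun: "is_function (as x) omega Y" if "x \<epsilon> Y" "l \<epsilon> Y" for x Y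
    unfolding as_def by (rule is_function_vlam[OF da]) (use that in simp)
  have as_opair: "opair k z \<epsilon> as x \<longleftrightarrow> k \<epsilon> omega \<and> z = (if k = vempty then x else l)" for k z x
    unfolding as_def by (rule opair_mem_vlam[OF da])
  have vnum_vempty: "vnum i = vempty \<longleftrightarrow> i = 0" for i by (cases i) auto
  have as_vapp: "(\<lambda>i. vapp (as x) (vnum i)) = (\<lambda>k. if k = 0 then x else l)" for x
    unfolding as_def by (rule ext) (simp add: vapp_vlam[OF da] vnum_vempty)
  have jf: "is_function j X (Vset d)" using j unfolding elementary_embedding_def by blast
  have XV: "sub X (Vset d)" using X unfolding elementary_substructure_def by blast
  have mem: "m \<epsilon> X" "l \<epsilon> X" "y \<epsilon> Vset d"
    using l m fun_opair[OF jf] fun_vapp(1)[OF jf] unfolding rel_iff by metis+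
  have jj: "z = l" if "opair l z \<epsilon> j" for z using that l fun_opair[OF jf] unfolding rel_iff by metis
  have jm: "z = y" if "opair m z \<epsilon> j" for z using that m fun_opair[OF jf] unfolding rel_iff by metis
  have memV: "m \<epsilon> Vset d" "l \<epsilon> Vset d" using mem XV subD by blast+
  have "sat_in (Vset d) (\<lambda>k. if k = 0 then m else l) p" using refl p memV by simp
  then have "satisfies (Vset d) (code p) (as m)"
    using satisfies_code[OF as_fun[OF memV]] as_vapp by simp
  then have "satisfies X (code p) (as m)"
    using X formula_code as_fun[OF mem(1,2)] unfolding elementary_substructure_def assignment_iff by blast
  moreover have "opair k z' \<epsilon> as y" if "opair k z \<epsilon> as m" "opair z z' \<epsilon> j" for k z z'
    using that jj jm unfolding as_opair by metis
  ultimately have "satisfies (Vset d) (code p) (as y)"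
    using j formula_code as_fun[OF mem(1,2)] as_fun[OF mem(3) memV(2)]
    unfolding elementary_embedding_def assignment_iff rel_iff by blast
  then have "sat_in (Vset d) (\<lambda>k. if k = 0 then y else l) p"
    using satisfies_code[OF as_fun[OF mem(3) memV(2)]] as_vapp by simp
  then show ?thesis using refl mem(3) memV(2) by simp
qed

text \<open>
  The minimum has to be taken over the parameters of one fixed formula \<open>p\<close>, as \<open>m\<close> must be
  definable. It may be smaller than \<open>\<mu>\<close>, but it comes with a club class of its own.
\<close>

lemma no_uniform_critical_cardinal:
  assumes l: "cardinal l" and adm: "admits_domains l" and \<mu>: "cardinal \<mu>" "\<mu> \<epsilon> l"
    and C: "club_class C" and crit: "\<And>\<zeta>. \<zeta> \<in> C \<Longrightarrow> critical_at \<mu> l \<zeta>"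
  shows False
proof -
  obtain p e where p: "C = {x. sat (e(0 := x)) p}"
    using C unfolding club_class_def definable_class_def by blast
  define n where "n = var_bound p"
  \<comment> \<open>Variable \<open>0\<close> is the argument of the class, the others are read off the code \<open>z\<close>.\<close>
  define M where "M z x \<longleftrightarrow> sat (\<lambda>k. if k = 0 then x else decode_env n z k) p" for z x
  have dM: "definable A (\<lambda>e. M (e 0) (e 1))" for A unfolding M_def
  proof (rule definable_sat)
    show "defterm A (\<lambda>e. if k = 0 then e 1 else decode_env n (e 0) k)" for k
      by (cases "k = 0") (auto intro: dfn)
  qed
  note dM' = definable_pred2[where R = M, OF dM]
  have M_C: "M (encode_env n e) x \<longleftrightarrow> x \<in> C" for x
    unfolding M_def p mem_Collect_eq
    by (rule sat_cong_below) (simp add: decode_env_encode_env n_def)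
  define club where "club z \<longleftrightarrow> (\<forall>x. M z x \<longrightarrow> ordinal x) \<and>
    (\<forall>a. ordinal a \<longrightarrow> (\<exists>x. M z x \<and> a \<epsilon> x)) \<and>
    (\<forall>d. limit_ordinal d \<and> (\<forall>a. a \<epsilon> d \<longrightarrow> (\<exists>b. M z b \<and> b \<epsilon> d \<and> a \<epsilon> b)) \<longrightarrow> M z d)" for z
  define Good where "Good m \<longleftrightarrow> ordinal m \<and>
    (\<exists>z. club z \<and> (\<forall>x. M z x \<longrightarrow> critical_at m l x))" for m
  \<comment> \<open>Only \<open>l\<close> may occur as a parameter here: the parameters of \<open>C\<close> need not lie in the domain
    of the embedding, let alone be fixed.\<close>
  have dGood: "definable {l} (\<lambda>e. Good (e 0))"
    unfolding Good_def club_def by (intro dfn dM' defterm_const singletonI)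
  have dGood2: "definable UNIV (\<lambda>e. Good (e 0))"
    unfolding Good_def club_def by (intro dfn dM')
  note dGood' = definable_pred1[where R = Good, OF dGood]
  have "club (encode_env n e)" using C unfolding club_def M_C club_class_def by blast
  moreover have "\<forall>x. M (encode_env n e) x \<longrightarrow> critical_at \<mu> l x" using crit unfolding M_C by blast
  ultimately have "Good \<mu>" unfolding Good_def using \<mu>(1) cardinal_ordinal by blast
  obtain m where m: "ordinal m" "Good m" "\<And>c. c \<epsilon> m \<Longrightarrow> \<not> Good c"
    using ordinal_least[where P = Good, OF dGood2 cardinal_ordinal[OF \<mu>(1)] \<open>Good \<mu>\<close>] by blast
  define least where "least x \<longleftrightarrow> Good x \<and> (\<forall>c. c \<epsilon> x \<longrightarrow> \<not> Good c)" for x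
  have least_m: "least x \<longleftrightarrow> x = m" for x
    using m ordinal_linear[of x m] unfolding least_def Good_def by metis
  have "definable {l} (\<lambda>e. least (e 0))"
    unfolding least_def by (intro dfn dGood')
  then obtain q c where c: "range c \<subseteq> {l}" and q: "\<And>e. least (e 0) \<longleftrightarrow> sat (interleave e c) q"
    unfolding definable_def by auto
  \<comment> \<open>Every parameter of \<open>q\<close> is \<open>l\<close>, so one environment serves for variables and parameters.\<close>
  have "interleave (\<lambda>k. if k = 0 then x else l) c = (\<lambda>k. if k = 0 then x else l)" for x
    using c by (auto simp: interleave_def fun_eq_iff elim!: evenE)
  with q[of "\<lambda>k. if k = 0 then _ else l"]
  have q': "sat (\<lambda>k. if k = 0 then x else l) q \<longleftrightarrow> x = m" for x
    using least_m by simp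
  from m(2) obtain z where z: "club z" "\<And>x. M z x \<Longrightarrow> critical_at m l x" unfolding Good_def by blast
  obtain B where B: "bounding B" "\<And>d e. limit_ordinal d \<Longrightarrow> closed_under B d \<Longrightarrow>
      (\<forall>i. e i \<epsilon> Vset d) \<Longrightarrow> sat_in (Vset d) e q \<longleftrightarrow> sat e q"
    using reflection[of q] by blast
  have "definable UNIV (\<lambda>e. M z (e 0))" by (intro dM' dfn)
  from reflect_in_class[where M = "M z", OF B(1) this _ _ cardinal_ordinal[OF l]]
  obtain d where d: "limit_ordinal d" "l \<epsilon> d" "closed_under B d" "M z d"
    using z(1) unfolding club_def by metis
  from z(2)[OF d(4)] have crit_m: "m \<epsilon> l"
    "\<And>X. exacting_domain l d X \<Longrightarrow> \<exists>j. exacting_embedding m l d X j"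
    unfolding critical_at_def by blast+
  obtain X where X: "exacting_domain l d X"
    using exacting_domain_exists[OF l adm crit_m(1) limit_ordinal(1)[OF d(1)] d(2)] by blast
  with crit_m(2) obtain j where j: "exacting_embedding m l d X j" by blast
  have eX: "elementary_substructure X (Vset d)"
    using X unfolding exacting_domain_def is_V_iff by blast
  have ej: "elementary_embedding j X (Vset d)" and jl: "rel j l l" and cr: "is_crit j m"
    using j unfolding exacting_embedding_def is_V_iff by blast+
  obtain y where y: "rel j m y" "y \<noteq> m" using cr unfolding is_crit_def by blast
  have "sat (\<lambda>k. if k = 0 then y else l) q"
    by (rule embedding_fixes_definable[OF d(1) B(2)[OF d(1,3)] eX ej jl y(1)]) (simp_all add: q')
  with y(2) q' show False by blast
qed

lemma club_class_above:
  assumes "ordinal l"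
  shows "club_class {\<zeta>. ordinal \<zeta> \<and> l \<epsilon> \<zeta>}"
  unfolding club_class_def
proof (intro conjI ballI allI impI)
  have "definable UNIV (\<lambda>e. ordinal (e 0) \<and> l \<epsilon> e 0)" by (intro dfn)
  from definable_as_formula[of "\<lambda>x. ordinal x \<and> l \<epsilon> x", OF this]
  show "definable_class {\<zeta>. ordinal \<zeta> \<and> l \<epsilon> \<zeta>}"
    unfolding definable_class_def by (auto simp: set_eq_iff)
  fix a assume a: "ordinal a"
  have "\<exists>b. ordinal b \<and> a \<epsilon> b \<and> l \<epsilon> b"
    using ordinal_linear[OF a assms] a assms
    by (metis mem_vsucc ordinal_vsucc)
  then show "\<exists>\<zeta>\<in>{\<zeta>. ordinal \<zeta> \<and> l \<epsilon> \<zeta>}. a \<epsilon> \<zeta>" by blast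
next
  fix d assume d: "limit_ordinal d \<and>
    (\<forall>a. a \<epsilon> d \<longrightarrow> (\<exists>b\<in>{\<zeta>. ordinal \<zeta> \<and> l \<epsilon> \<zeta>}. b \<epsilon> d \<and> a \<epsilon> b))"
  then have "ordinal d" "vempty \<epsilon> d" using limit_ordinal(1) limit_vempty by blast+
  with d show "d \<in> {\<zeta>. ordinal \<zeta> \<and> l \<epsilon> \<zeta>}" using ordinal_trans by blast
qed simp

end

theorem proposition5p8:
  fixes E :: "'v \<Rightarrow> 'v \<Rightarrow> bool"
  assumes "ZFC_model E"
  shows
    "(\<nexists>\<mu> l. set_structure.cardinal E \<mu> \<and> set_structure.cardinal E l \<and> E \<mu> l \<and>
        set_structure.admits_domains E l \<and>
        (\<exists>C. set_structure.club_class E C \<and>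
             (\<forall>\<zeta>\<in>C. set_structure.critical_at E \<mu> l \<zeta>))) \<and>
     (\<nexists>\<mu> l. set_structure.cardinal E \<mu> \<and> set_structure.cardinal E l \<and> E \<mu> l \<and>
        set_structure.admits_domains E l \<and>
        (\<forall>\<zeta> X. set_structure.ordinal E \<zeta> \<and> E l \<zeta> \<and> set_structure.exacting_domain E l \<zeta> X \<longrightarrow>
             (\<exists>j. set_structure.exacting_embedding E \<mu> l \<zeta> X j)))"
proof -
  interpret ZFC_model E by (rule assms)
  have no_club: False if "cardinal \<mu>" "cardinal l" "E \<mu> l" "admits_domains l" "club_class C"
    "\<forall>\<zeta>\<in>C. critical_at \<mu> l \<zeta>" for \<mu> l C
    by (rule no_uniform_critical_cardinal[of l \<mu> C]) (use that in blast)+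
  have no_all: False if *: "cardinal \<mu>" "cardinal l" "E \<mu> l" "admits_domains l"
    "\<forall>\<zeta> X. ordinal \<zeta> \<and> E l \<zeta> \<and> exacting_domain l \<zeta> X \<longrightarrow> (\<exists>j. exacting_embedding \<mu> l \<zeta> X j)"
    for \<mu> l
  proof (rule no_club[OF *(1-4) club_class_above[OF cardinal_ordinal[OF *(2)]]])
    show "\<forall>\<zeta>\<in>{\<zeta>. ordinal \<zeta> \<and> E l \<zeta>}. critical_at \<mu> l \<zeta>"
      using * unfolding critical_at_def by blast
  qed
  show ?thesis using no_club no_all by blast
qed

end
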